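(* Let $r\ge 2$ and let $m,n\ge 1$ be coprime integers, and let $M_0$ be the associated (uncollapsed) ab initio Hrushovski generic structure. Suppose either that $r=2$ and $n>m$, or that $r\ge 3$ and $n\ge m$. Then $\mathrm{Aut}(M_0/\mathrm{cl}^d(\emptyset))$ is a simple group. In fact, if $g\in \mathrm{Aut}(M_0/\mathrm{cl}^d(\emptyset))$ is not the identity, then every element of $\mathrm{Aut}(M_0/\mathrm{cl}^d(\emptyset))$ can be written as a product of 96 conjugates of $g^{\pm 1}$.
   Context: Fix $r\ge 2$ and coprime integers $m,n\ge 1$. Let $\mathcal{C}$ be the class of finite $r$-uniform hypergraphs, i.e. finite structures with a single $r$-ary relation $R$ that is invariant under permutation of coordinates and holds only of tuples of distinct elements; $R[B]$ denotes the set of hyperedges ($r$-element subsets) of $B$. Put $\delta(B)=n|B|-m|R[B]|$ for $B\in\mathcal{C}$. For $A\subseteq B\in\mathcal{C}$ (substructures are induced) write $A\le B$ if $\delta(A)\le\delta(B')$ for all $A\subseteq B'\subseteq B$. Let $\mathcal{C}_0=\{B\in\mathcal{C}:\emptyset\le B\}$ and let $\bar{\mathcal{C}}_0$ be the class of structures all of whose finite substructures are in $\mathcal{C}_0$. For $C\subseteq B\in\bar{\mathcal{C}}_0$ write $C\le B$ if $X\cap C\le X$ for all finite $X\subseteq B$. $M_0$ denotes the generic structure for $(\mathcal{C}_0,\le)$: the countable structure in $\bar{\mathcal{C}}_0$, unique up to isomorphism, such that $M_0$ is a union of a chain of finite substructures $X$ with $X\le M_0$, and whenever $X\le M_0$ is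 finite and $X\le A\in\mathcal{C}_0$, there is an embedding $\alpha:A\to M_0$ which is the identity on $X$ and satisfies $\alpha(A)\le M_0$. For finite $X\subseteq M_0$ there is a smallest set $\mathrm{cl}_0(X)$ with $X\subseteq\mathrm{cl}_0(X)\le M_0$, and it is finite; put $d(X)=\delta(\mathrm{cl}_0(X))$. For finite $X$, $\mathrm{cl}^d(X)=\{a\in M_0: d(X\cup\{a\})=d(X)\}$. In particular $\mathrm{cl}^d(\emptyset)=\bigcup\{X\subseteq M_0 \text{ finite}:\delta(X)=0\}$. $\mathrm{Aut}(M/X)$ is the group of automorphisms of $M$ fixing every element of $X$. Conjugates of $g$ are taken in the group $\mathrm{Aut}(M_0/\mathrm{cl}^d(\emptyset))$; "conjugates of $g^{\pm1}$" means conjugates of $g$ or of $g^{-1}$. *)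

theory Defs
  imports Complex_Main "HOL-Library.Countable_Set" "HOL-Algebra.Bij" "HOL-Algebra.Coset"
begin

section \<open>Uniform hypergraphs\<close>

text \<open>
  A structure with one \<open>r\<close>-ary relation that is symmetric and holds only of tuples of distinct
  elements is given by its set of hyperedges, which are \<open>r\<close>-element sets of vertices.
\<close>

record 'a hypergraph =
  verts :: "'a set"
  edges :: "'a set set"

definition uniform_hypergraph :: "nat \<Rightarrow> 'a hypergraph \<Rightarrow> bool" where
  "uniform_hypergraph r H \<longleftrightarrow> (\<forall>e\<in>edges H. e \<subseteq> verts H \<and> finite e \<and> card e = r)"

definition edges_on :: "'a hypergraph \<Rightarrow> 'a set \<Rightarrow> 'a set set" where
  "edges_on H B = {e \<in> edges H. e \<subseteq> B}"

definition induced :: "'a hypergraph \<Rightarrow> 'a set \<Rightarrow> 'a hypergraph" where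
  "induced H B = \<lparr>verts = B, edges = edges_on H B\<rparr>"

definition embedding :: "('a \<Rightarrow> 'b) \<Rightarrow> 'a hypergraph \<Rightarrow> 'b hypergraph \<Rightarrow> bool" where
  "embedding f A B \<longleftrightarrow>
     inj_on f (verts A) \<and> f ` verts A \<subseteq> verts B \<and>
     (\<forall>e. e \<subseteq> verts A \<longrightarrow> (e \<in> edges A \<longleftrightarrow> f ` e \<in> edges B))"


section \<open>Predimension and self-sufficient sets\<close>

text \<open>
  Substructures are induced, so they are represented by their vertex sets inside an ambient
  structure \<open>H\<close>.  The predimension is only meant for finite sets of vertices.
\<close>

definition delta :: "nat \<Rightarrow> nat \<Rightarrow> 'a hypergraph \<Rightarrow> 'a set \<Rightarrow> int" where
  "delta m n H B = int n * int (card B) - int m * int (card (edges_on H B))"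

text \<open>The relation \<open>A \<le> B\<close> for finite \<open>B\<close>.\<close>

definition strong_fin :: "nat \<Rightarrow> nat \<Rightarrow> 'a hypergraph \<Rightarrow> 'a set \<Rightarrow> 'a set \<Rightarrow> bool" where
  "strong_fin m n H A B \<longleftrightarrow>
     A \<subseteq> B \<and> (\<forall>B'. A \<subseteq> B' \<and> B' \<subseteq> B \<longrightarrow> delta m n H A \<le> delta m n H B')"

definition in_C0 :: "nat \<Rightarrow> nat \<Rightarrow> nat \<Rightarrow> 'a hypergraph \<Rightarrow> bool" where
  "in_C0 r m n B \<longleftrightarrow>
     uniform_hypergraph r B \<and> finite (verts B) \<and> strong_fin m n B {} (verts B)"

definition in_C0bar :: "nat \<Rightarrow> nat \<Rightarrow> nat \<Rightarrow> 'a hypergraph \<Rightarrow> bool" where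
  "in_C0bar r m n M \<longleftrightarrow>
     uniform_hypergraph r M \<and>
     (\<forall>B. finite B \<and> B \<subseteq> verts M \<longrightarrow> in_C0 r m n (induced M B))"

text \<open>The relation \<open>C \<le> M\<close> for a possibly infinite structure \<open>M\<close>.\<close>

definition strong :: "nat \<Rightarrow> nat \<Rightarrow> 'a hypergraph \<Rightarrow> 'a set \<Rightarrow> bool" where
  "strong m n M C \<longleftrightarrow>
     C \<subseteq> verts M \<and>
     (\<forall>X. finite X \<and> X \<subseteq> verts M \<longrightarrow> strong_fin m n M (X \<inter> C) X)"


section \<open>The generic structure\<close>

text \<open>
  The extension property speaks of a finite structure \<open>A\<close> that contains \<open>X\<close>.  The vertex set of
  \<open>M\<close> may exhaust its type, so \<open>A\<close> is taken on natural numbers (every finite structure has a copy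
  there) and the inclusion of \<open>X\<close> in \<open>A\<close> becomes an embedding \<open>f\<close>; that \<open>\<alpha>\<close> is the identity on
  \<open>X\<close> becomes \<open>\<alpha> (f x) = x\<close>.
\<close>

definition is_generic :: "nat \<Rightarrow> nat \<Rightarrow> nat \<Rightarrow> 'a hypergraph \<Rightarrow> bool" where
  "is_generic r m n M \<longleftrightarrow>
     countable (verts M) \<and> in_C0bar r m n M \<and>
     (\<exists>X :: nat \<Rightarrow> 'a set.
        incseq X \<and> (\<forall>i. finite (X i) \<and> strong m n M (X i)) \<and> (\<Union>i. X i) = verts M) \<and>
     (\<forall>X (A :: nat hypergraph) f.
        finite X \<and> strong m n M X \<and> in_C0 r m n A \<and>
        embedding f (induced M X) A \<and> strong_fin m n A (f ` X) (verts A) \<longrightarrow>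
        (\<exists>\<alpha>. embedding \<alpha> A M \<and> (\<forall>x\<in>X. \<alpha> (f x) = x) \<and> strong m n M (\<alpha> ` verts A)))"


section \<open>Closures and dimension\<close>

definition cl0 :: "nat \<Rightarrow> nat \<Rightarrow> 'a hypergraph \<Rightarrow> 'a set \<Rightarrow> 'a set" where
  "cl0 m n M X = (LEAST Y. X \<subseteq> Y \<and> strong m n M Y)"

definition dim0 :: "nat \<Rightarrow> nat \<Rightarrow> 'a hypergraph \<Rightarrow> 'a set \<Rightarrow> int" where
  "dim0 m n M X = delta m n M (cl0 m n M X)"

definition cld :: "nat \<Rightarrow> nat \<Rightarrow> 'a hypergraph \<Rightarrow> 'a set \<Rightarrow> 'a set" where
  "cld m n M X = {a \<in> verts M. dim0 m n M (X \<union> {a}) = dim0 m n M X}"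


section \<open>Automorphism groups, simplicity, conjugates\<close>

text \<open>
  As in the library's group of bijections, automorphisms are extensional functions on the vertex
  set, so that equal automorphisms are equal as functions.
\<close>

definition Aut_over :: "'a hypergraph \<Rightarrow> 'a set \<Rightarrow> ('a \<Rightarrow> 'a) monoid" where
  "Aut_over M X =
     BijGroup (verts M)
       \<lparr>carrier := {f \<in> Bij (verts M). embedding f M M \<and> (\<forall>x\<in>X. f x = x)}\<rparr>"

text \<open>
  The library's locale \<open>simple_group\<close> demands \<open>order G > 1\<close>; since \<open>order\<close> is a cardinality in
  \<open>nat\<close>, which is \<open>0\<close> for infinite carriers, that locale has only finite models.
\<close>

definition is_simple_group :: "('g, 'x) monoid_scheme \<Rightarrow> bool" where
  "is_simple_group G \<longleftrightarrow>
     group G \<and> carrier G \<noteq> {\<one>\<^bsub>G\<^esub>} \<and>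
     (\<forall>N. N \<lhd> G \<longrightarrow> N = {\<one>\<^bsub>G\<^esub>} \<or> N = carrier G)"

definition conjugates :: "('g, 'x) monoid_scheme \<Rightarrow> 'g \<Rightarrow> 'g set" where
  "conjugates G g = {k \<otimes>\<^bsub>G\<^esub> g \<otimes>\<^bsub>G\<^esub> inv\<^bsub>G\<^esub> k | k. k \<in> carrier G}"

definition list_product :: "('g, 'x) monoid_scheme \<Rightarrow> 'g list \<Rightarrow> 'g" where
  "list_product G xs = foldr (\<lambda>x y. x \<otimes>\<^bsub>G\<^esub> y) xs \<one>\<^bsub>G\<^esub>"

end

theory Submission
  imports Defs
begin

text \<open>The theorem is proved by treating the sets \<open>cl X\<close> of elements of dimension zero over a finite
set \<open>X\<close> like the models of a stable theory.

\<^bold>\<open>Independence.\<close> If two closed sets are independent over their intersection, then their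
finite self-sufficient subsets are in free amalgamation (\<open>free_union\<close>), so the isomorphism type
of their union is determined. A back-and-forth between finite self-sufficient sets, in which
finite parts of closed sets can always be adjoined (\<open>absorb_union\<close>), turns this into two facts on
automorphisms that fix a closed set pointwise: every finite set can be moved to an independent
position (\<open>independent_copy\<close>), and two independent positions of the same type are conjugate
(\<open>stationarity\<close>).

\<^bold>\<open>No automorphism is bounded.\<close> Because \<open>m\<close> and \<open>n\<close> are coprime and \<open>m \<le> n\<close>, the generic
structure contains paths along which the predimension changes from any value in \<open>{0..m}\<close> to any
other one without leaving this range. With them one finds elements of dimension one over any
closed set \<open>cl A\<close>, and realizations of their type inside the closure of \<open>A\<close> and any further
element (\<open>dim_one_transfer\<close>). Hence an automorphism \<open>g\<close> that keeps all realizations \<open>y\<close> of one such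
type inside \<open>cl (A \<union> {y})\<close> keeps every \<open>x\<close> inside \<open>cl (C \<union> {x})\<close> for some larger \<open>C\<close>. Now let \<open>b\<close>
have maximal dimension over \<open>C\<close> and lie on a hyperedge that makes its vertices as independent as a
hyperedge can; a second hyperedge between the closures of these vertices would lower the dimension
too much, so \<open>g\<close> fixes the hyperedge and \<open>b\<close>. All other elements are determined by hyperedges to
elements of larger dimension, and \<open>g\<close> is the identity (\<open>bounded_trivial\<close>); this is where
\<open>m < (r - 1) * n\<close> is needed. Moving the members of a basis one by one, it follows that a
non-trivial \<open>g\<close> moves some realization of every type over a closed set independently from itself
(\<open>moves_independently\<close>).

\<^bold>\<open>Products of conjugates.\<close> Therefore a product of three conjugates of \<open>g\<close> is flexible: after
the conjugators have been adjusted, it can be made to agree on any finite set with any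
automorphism with which it already agrees on a closed set (\<open>three_conjugates\<close>). For a given \<open>h\<close>,
two such products \<open>p\<close> and \<open>q\<close> are built by a back-and-forth in which \<open>p\<close> and \<open>h \<circ> q\<close> agree on larger
and larger closed sets while the conjugators are only changed outside larger and larger sets. In
the limit \<open>p = h \<circ> q\<close>, so \<open>h\<close> is a product of six conjugates of \<open>g\<close> and its inverse; the number
96 is reached by adding factors \<open>g\<close> and its inverse in pairs. Simplicity is an immediate
consequence.\<close>

section \<open>Predimension, dimension and closure\<close>

lemma embedding_delta:
  assumes "embedding f A B" "U \<subseteq> verts A" shows "delta m n B (f ` U) = delta m n A U"
proof -
  have i: "inj_on f U" using assms by (auto simp: embedding_def intro: inj_on_subset)
  have ed: "e \<in> edges A \<longleftrightarrow> f ` e \<in> edges B" if "e \<subseteq> U" for e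
    using assms that by (auto simp: embedding_def)
  have "edges_on B (f ` U) = image f ` edges_on A U"
  proof (intro equalityI subsetI)
    fix e assume e: "e \<in> edges_on B (f ` U)"
    then obtain d where "d \<subseteq> U" "e = f ` d" by (auto simp: edges_on_def subset_image_iff)
    then show "e \<in> image f ` edges_on A U" using e ed by (auto simp: edges_on_def)
  next
    fix e assume "e \<in> image f ` edges_on A U"
    then show "e \<in> edges_on B (f ` U)" using ed by (auto simp: edges_on_def)
  qed
  moreover have "inj_on (image f) (edges_on A U)"
    using inj_on_image_Pow[OF i] by (rule inj_on_subset) (auto simp: edges_on_def)
  ultimately show ?thesis using i by (simp add: delta_def card_image)
qed

locale hrushovski_generic =
  fixes r m n :: nat and M :: "'a hypergraph"
  assumes r_ge_2: "2 \<le> r" and m_pos: "1 \<le> m" and n_pos: "1 \<le> n" and coprime_mn: "coprime m n"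
    and generic: "is_generic r m n M"
    and m_le_n: "m \<le> n" and edge_positive: "m < (r - 1) * n"
begin

abbreviation V :: "'a set" where "V \<equiv> verts M"
abbreviation E :: "'a set set" where "E \<equiv> edges M"
abbreviation dl :: "'a set \<Rightarrow> int" where "dl B \<equiv> delta m n M B"

definition fs :: "'a set \<Rightarrow> bool" where
  "fs X \<longleftrightarrow> finite X \<and> X \<subseteq> V"

lemma fs_simps [simp]:
  "fs {}" "fs (X \<union> Y) \<longleftrightarrow> fs X \<and> fs Y" "fs (insert a X) \<longleftrightarrow> a \<in> V \<and> fs X"
  by (auto simp: fs_def)

lemma fs_finite: "fs X \<Longrightarrow> finite X"
  by (simp add: fs_def)

lemma fs_subset: "fs X \<Longrightarrow> Y \<subseteq> X \<Longrightarrow> fs Y"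
  by (auto simp: fs_def intro: finite_subset)

lemma fs_Int: "fs X \<Longrightarrow> fs (X \<inter> Y)" "fs X \<Longrightarrow> fs (Y \<inter> X)"
  by (auto intro: fs_subset)

lemma V_countable: "countable V"
  using generic by (simp add: is_generic_def)

lemma edge_props:
  assumes "e \<in> E" shows "e \<subseteq> V" "finite e" "card e = r" "e \<noteq> {}"
proof -
  show "e \<subseteq> V" "finite e" "card e = r"
    using generic assms by (auto simp: is_generic_def in_C0bar_def uniform_hypergraph_def)
  then show "e \<noteq> {}" using r_ge_2 by auto
qed

lemma finite_edges_on: "finite B \<Longrightarrow> finite (edges_on M B)"
  by (rule finite_subset[of _ "Pow B"]) (auto simp: edges_on_def)

lemma delta_modular:
  assumes "finite X" "finite Y"
  shows "dl (X \<union> Y) + dl (X \<inter> Y) + int m * int (card {e \<in> E. e \<subseteq> X \<union> Y \<and> \<not> e \<subseteq> X \<and> \<not> e \<subseteq> Y})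
    = dl X + dl Y"
proof -
  let ?C = "{e \<in> E. e \<subseteq> X \<union> Y \<and> \<not> e \<subseteq> X \<and> \<not> e \<subseteq> Y}"
  have fin: "finite (edges_on M X)" "finite (edges_on M Y)" "finite (edges_on M (X \<union> Y))"
    using assms by (auto intro: finite_edges_on)
  have eq: "edges_on M (X \<union> Y) = (edges_on M X \<union> edges_on M Y) \<union> ?C"
    by (auto simp: edges_on_def)
  have "finite ?C" by (rule finite_subset[OF _ fin(3)]) (auto simp: edges_on_def)
  then have "card (edges_on M X \<union> edges_on M Y \<union> ?C) = card (edges_on M X \<union> edges_on M Y) + card ?C"
    using fin by (intro card_Un_disjoint) (auto simp: edges_on_def)
  then have "card (edges_on M (X \<union> Y)) = card (edges_on M X \<union> edges_on M Y) + card ?C"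
    unfolding eq .
  moreover have "edges_on M X \<inter> edges_on M Y = edges_on M (X \<inter> Y)"
    by (auto simp: edges_on_def)
  ultimately have "card (edges_on M (X \<union> Y)) + card (edges_on M (X \<inter> Y))
      = card (edges_on M X) + card (edges_on M Y) + card ?C"
    using card_Un_Int[OF fin(1,2)] by simp
  then have e: "int (card (edges_on M (X \<union> Y))) = int (card (edges_on M X)) + int (card (edges_on M Y))
      + int (card ?C) - int (card (edges_on M (X \<inter> Y)))" by linarith
  have v: "int (card (X \<union> Y)) = int (card X) + int (card Y) - int (card (X \<inter> Y))"
    using card_Un_Int[OF assms] by linarith
  show ?thesis unfolding delta_def e v by (simp add: algebra_simps)
qed

lemma delta_submodular:
  assumes "finite X" "finite Y" shows "dl (X \<union> Y) + dl (X \<inter> Y) \<le> dl X + dl Y"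
proof -
  have "0 \<le> int m * int (card {e \<in> E. e \<subseteq> X \<union> Y \<and> \<not> e \<subseteq> X \<and> \<not> e \<subseteq> Y})" by simp
  then show ?thesis using delta_modular[OF assms] by linarith
qed

lemma delta_nonneg: assumes "fs B" shows "0 \<le> dl B"
proof -
  have "in_C0 r m n (induced M B)"
    using generic assms by (simp add: is_generic_def in_C0bar_def fs_def)
  then have "delta m n (induced M B) {} \<le> delta m n (induced M B) B"
    unfolding in_C0_def strong_fin_def by (auto simp: induced_def)
  moreover have "delta m n (induced M B) {} = 0"
    using edge_props(4) by (auto simp: delta_def edges_on_def induced_def)
  moreover have "delta m n (induced M B) B = dl B"
    by (auto simp: delta_def edges_on_def induced_def)
  ultimately show ?thesis by simp
qed

text \<open>Self-sufficiency of a finite set is tested on its finite supersets. By submodularity it is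
  then inherited by intersections with arbitrary finite sets, as the general definition demands.\<close>

definition ss :: "'a set \<Rightarrow> bool" where
  "ss S \<longleftrightarrow> fs S \<and> (\<forall>B. fs B \<longrightarrow> S \<subseteq> B \<longrightarrow> dl S \<le> dl B)"

lemma ss_fs: "ss S \<Longrightarrow> fs S" by (simp add: ss_def)

lemma ss_le: "ss S \<Longrightarrow> fs B \<Longrightarrow> S \<subseteq> B \<Longrightarrow> dl S \<le> dl B" by (simp add: ss_def)

lemma ss_cut:
  assumes "ss S" "fs B" shows "dl (B \<inter> S) \<le> dl B"
proof -
  have "dl S \<le> dl (B \<union> S)" using assms by (intro ss_le) (auto simp: ss_fs)
  then show ?thesis using delta_submodular[of B S] assms by (auto simp: ss_def fs_def)
qed

lemma strong_iff_ss:
  assumes "finite S" shows "strong m n M S \<longleftrightarrow> ss S"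
proof
  assume s: "strong m n M S"
  show "ss S" unfolding ss_def
  proof (intro conjI allI impI)
    show "fs S" using s assms by (simp add: strong_def fs_def)
    fix B assume "fs B" "S \<subseteq> B"
    then show "dl S \<le> dl B"
      using s unfolding strong_def strong_fin_def fs_def by (metis Int_absorb1 order_refl)
  qed
next
  assume s: "ss S"
  show "strong m n M S" unfolding strong_def
  proof (intro conjI allI impI)
    show "S \<subseteq> V" using s by (simp add: ss_def fs_def)
    fix X assume X: "finite X \<and> X \<subseteq> V"
    show "strong_fin m n M (X \<inter> S) X" unfolding strong_fin_def
    proof (intro conjI allI impI)
      fix B assume B: "X \<inter> S \<subseteq> B \<and> B \<subseteq> X"
      then have "B \<inter> S = X \<inter> S" "fs B" using X by (auto simp: fs_def intro: finite_subset)
      then show "dl (X \<inter> S) \<le> dl B" using ss_cut[OF s, of B] by simp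
    qed auto
  qed
qed

lemma ss_subI:
  assumes "ss S" "X \<subseteq> S" "\<And>T. X \<subseteq> T \<Longrightarrow> T \<subseteq> S \<Longrightarrow> dl X \<le> dl T"
  shows "ss X"
  unfolding ss_def
proof (intro conjI allI impI)
  show "fs X" using assms by (auto intro: fs_subset ss_fs)
  fix B assume B: "fs B" "X \<subseteq> B"
  have "dl X \<le> dl (B \<inter> S)" using B assms(2) by (intro assms(3)) auto
  then show "dl X \<le> dl B" using ss_cut[OF assms(1) B(1)] by simp
qed

lemma ss_Int: assumes "ss S" "ss T" shows "ss (S \<inter> T)"
proof (rule ss_subI[OF assms(1)])
  fix U assume U: "S \<inter> T \<subseteq> U" "U \<subseteq> S"
  then have "U \<inter> T = S \<inter> T" "fs U" using fs_subset[OF ss_fs[OF assms(1)]] by auto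
  then show "dl (S \<inter> T) \<le> dl U" using ss_cut[OF assms(2), of U] by simp
qed auto

text \<open>Any finite superset may compete, so that the dimension can be estimated without knowing the
  smallest self-sufficient superset.\<close>

definition dm :: "'a set \<Rightarrow> int" where
  "dm X = int (LEAST k. \<exists>B. fs B \<and> X \<subseteq> B \<and> dl B = int k)"

lemma dm_le: assumes "fs B" "X \<subseteq> B" shows "dm X \<le> dl B"
proof -
  have "\<exists>C. fs C \<and> X \<subseteq> C \<and> dl C = int (nat (dl B))" using assms delta_nonneg by auto
  then have "(LEAST k. \<exists>B. fs B \<and> X \<subseteq> B \<and> dl B = int k) \<le> nat (dl B)"
    by (rule Least_le)
  then show ?thesis using delta_nonneg[OF assms(1)] by (simp add: dm_def)
qed

lemma dm_attained: assumes "fs X" obtains B where "ss B" "X \<subseteq> B" "dl B = dm X"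
proof -
  have "\<exists>C. fs C \<and> X \<subseteq> C \<and> dl C = int (nat (dl X))" using assms delta_nonneg by auto
  then have "\<exists>B. fs B \<and> X \<subseteq> B \<and> dl B = dm X" unfolding dm_def by (rule LeastI)
  then obtain B where B: "fs B" "X \<subseteq> B" "dl B = dm X" by auto
  have "ss B" unfolding ss_def using B dm_le by auto
  then show ?thesis using B that by auto
qed

lemma dm_ss: assumes "ss S" shows "dm S = dl S"
proof -
  obtain B where "ss B" "S \<subseteq> B" "dl B = dm S" using dm_attained assms ss_fs by blast
  then show ?thesis using assms dm_le[of S S] ss_le[of S B] ss_fs by auto
qed

lemma dm_mono: assumes "fs Y" "X \<subseteq> Y" shows "dm X \<le> dm Y"
proof -
  obtain B where "ss B" "Y \<subseteq> B" "dl B = dm Y" using dm_attained assms(1) by blast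
  then show ?thesis using assms dm_le[of B X] ss_fs by auto
qed

text \<open>The intersection of optimal supersets of \<open>X\<close> and of \<open>Y\<close> is a superset of \<open>Z\<close>.\<close>

lemma dm_submodular:
  assumes "fs X" "fs Y" "Z \<subseteq> X" "Z \<subseteq> Y" shows "dm (X \<union> Y) + dm Z \<le> dm X + dm Y"
proof -
  obtain B where B: "ss B" "X \<subseteq> B" "dl B = dm X" using dm_attained assms(1) by blast
  obtain C where C: "ss C" "Y \<subseteq> C" "dl C = dm Y" using dm_attained assms(2) by blast
  have "dm (X \<union> Y) \<le> dl (B \<union> C)" using B C by (intro dm_le) (auto simp: ss_fs)
  moreover have "dm Z \<le> dl (B \<inter> C)" using B C assms by (intro dm_le) (auto simp: ss_fs intro: fs_Int)
  ultimately show ?thesis using delta_submodular[of B C] B C by (auto simp: ss_def fs_def)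
qed

definition cl :: "'a set \<Rightarrow> 'a set" where
  "cl X = {a \<in> V. dm (insert a X) = dm X}"

lemma cl_V: "cl X \<subseteq> V" by (auto simp: cl_def)

lemma dm_absorb:
  assumes "fs X" "finite Y" "Y \<subseteq> cl X" shows "dm (X \<union> Y) = dm X"
  using assms(2,3)
proof (induction Y rule: finite_induct)
  case (insert a Y)
  then have Y: "fs Y" using cl_V by (auto simp: fs_def)
  have "dm ((X \<union> Y) \<union> insert a X) + dm X \<le> dm (X \<union> Y) + dm (insert a X)"
    using insert assms Y by (intro dm_submodular) (auto simp: cl_def)
  moreover have "(X \<union> Y) \<union> insert a X = X \<union> insert a Y" by auto
  moreover have "dm (insert a X) = dm X" using insert by (auto simp: cl_def)
  moreover have "dm X \<le> dm (X \<union> insert a Y)"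
    using insert assms Y by (intro dm_mono) (auto simp: cl_def)
  ultimately show ?case using insert by auto
qed auto

lemma cl_I: assumes "fs X" "fs Y" "dm (X \<union> Y) \<le> dm X" shows "Y \<subseteq> cl X"
proof
  fix a assume a: "a \<in> Y"
  then have "a \<in> V" using assms by (auto simp: fs_def)
  moreover have "dm (insert a X) \<le> dm (X \<union> Y)" using a assms by (intro dm_mono) auto
  moreover have "dm X \<le> dm (insert a X)" using assms \<open>a \<in> V\<close> by (intro dm_mono) auto
  ultimately show "a \<in> cl X" using assms by (auto simp: cl_def)
qed

lemma cl_iff: assumes "fs X" "a \<in> V" shows "a \<in> cl X \<longleftrightarrow> dm (insert a X) \<le> dm X"
proof -
  have "dm X \<le> dm (insert a X)" using assms by (intro dm_mono) auto
  then show ?thesis using assms by (auto simp: cl_def)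
qed

lemma cl_sup: "fs X \<Longrightarrow> X \<subseteq> cl X"
  by (rule cl_I) auto

lemma cl_least:
  assumes "fs X" "fs Y" "Y \<subseteq> cl X" shows "cl Y \<subseteq> cl X"
proof
  fix a assume a: "a \<in> cl Y"
  then have aV: "a \<in> V" by (auto simp: cl_def)
  have "dm ((X \<union> Y) \<union> insert a Y) + dm Y \<le> dm (X \<union> Y) + dm (insert a Y)"
    using assms aV by (intro dm_submodular) auto
  moreover have "dm (insert a Y) = dm Y" using a by (auto simp: cl_def)
  moreover have "dm (X \<union> Y) = dm X" using assms by (intro dm_absorb) (auto simp: fs_def)
  moreover have "(X \<union> Y) \<union> insert a Y = X \<union> insert a Y" by auto
  ultimately have "dm (X \<union> insert a Y) \<le> dm X" by simp
  then have "insert a Y \<subseteq> cl X" using assms aV by (intro cl_I) auto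
  then show "a \<in> cl X" by auto
qed

lemma cl_mono: "fs Y \<Longrightarrow> X \<subseteq> Y \<Longrightarrow> cl X \<subseteq> cl Y"
  using cl_sup[of Y] fs_subset[of Y X] by (intro cl_least) auto

lemma ss_subset_cl:
  assumes "ss S" "X \<subseteq> S" "dl S \<le> dm X" shows "S \<subseteq> cl X"
proof (rule cl_I)
  show "fs X" "fs S" using assms by (auto intro: fs_subset ss_fs)
  have "X \<union> S = S" using assms by auto
  then show "dm (X \<union> S) \<le> dm X" using assms dm_ss by simp
qed

text \<open>A superset of \<open>X \<union> Y\<close> that is optimal for the dimension has only elements of dimension zero
  over \<open>X\<close>.\<close>

lemma cl_ss_cover:
  assumes "fs X" "finite Y" "Y \<subseteq> cl X"
  obtains S where "ss S" "X \<union> Y \<subseteq> S" "dl S = dm X" "S \<subseteq> cl X"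
proof -
  have Y: "fs Y" using assms cl_V by (auto simp: fs_def)
  have d: "dm (X \<union> Y) = dm X" using assms by (rule dm_absorb)
  obtain S where S: "ss S" "X \<union> Y \<subseteq> S" "dl S = dm (X \<union> Y)"
    using dm_attained[of "X \<union> Y"] assms(1) Y by auto
  then have "S \<subseteq> cl X" using d by (intro ss_subset_cl) auto
  then show ?thesis using S d that by auto
qed

lemma ss_Int_cl:
  assumes "ss S" "X \<subseteq> S" shows "ss (S \<inter> cl X)"
proof -
  have X: "fs X" using assms fs_subset ss_fs by auto
  obtain T where T: "ss T" "X \<union> (S \<inter> cl X) \<subseteq> T" "T \<subseteq> cl X"
    using cl_ss_cover[OF X, of "S \<inter> cl X"] fs_finite[OF ss_fs[OF assms(1)]]
    by (metis Int_lower2 finite_Int)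
  then have "S \<inter> cl X = S \<inter> T" by auto
  then show ?thesis using ss_Int[OF assms(1) T(1)] by simp
qed

text \<open>If submodularity holds with equality, then there is no room for hyperedges that cross between
  the two sets, nor for a superset of smaller predimension.\<close>

lemma free_union:
  assumes "ss S" "ss T" "dl S + dl T \<le> dm (S \<union> T) + dl (S \<inter> T)"
  shows "ss (S \<union> T)" "dl (S \<union> T) = dl S + dl T - dl (S \<inter> T)"
    "\<And>e. e \<in> E \<Longrightarrow> e \<subseteq> S \<union> T \<Longrightarrow> e \<subseteq> S \<or> e \<subseteq> T"
proof -
  let ?C = "{e \<in> E. e \<subseteq> S \<union> T \<and> \<not> e \<subseteq> S \<and> \<not> e \<subseteq> T}"
  have f: "finite S" "finite T" "fs (S \<union> T)" using assms by (auto simp: ss_def fs_def)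
  have mm: "dl (S \<union> T) + dl (S \<inter> T) + int m * int (card ?C) = dl S + dl T"
    using delta_modular[OF f(1,2)] .
  have le: "dm (S \<union> T) \<le> dl (S \<union> T)" using f by (intro dm_le) auto
  have nn: "0 \<le> int m * int (card ?C)" by simp
  have sq: "a = b \<and> c = 0 \<and> a = u - d" if "a + d + c = u" "b \<le> a" "0 \<le> c" "u \<le> b + d" for a b c d u :: int
    using that by linarith
  have "dl (S \<union> T) = dm (S \<union> T)" and mc: "int m * int (card ?C) = 0"
    using sq[OF mm le nn assms(3)] by blast+
  show "dl (S \<union> T) = dl S + dl T - dl (S \<inter> T)" using sq[OF mm le nn assms(3)] by blast
  have "finite ?C" by (rule finite_subset[of _ "Pow (S \<union> T)"]) (use f in auto)
  moreover have "card ?C = 0" using mc m_pos by auto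
  ultimately have "?C = {}" by simp
  then show "\<And>e. e \<in> E \<Longrightarrow> e \<subseteq> S \<union> T \<Longrightarrow> e \<subseteq> S \<or> e \<subseteq> T" by blast
  show "ss (S \<union> T)" unfolding ss_def using f \<open>dl (S \<union> T) = dm (S \<union> T)\<close> dm_le by auto
qed

text \<open>Finite parts of \<open>cl X\<close> are free from every self-sufficient set that contains \<open>X\<close>.\<close>

lemma absorb_union:
  assumes "ss S" "ss T" "X \<subseteq> S" "X \<subseteq> T" "dl T = dm X"
  shows "ss (S \<union> T)" "dl (S \<union> T) = dl S"
    "\<And>e. e \<in> E \<Longrightarrow> e \<subseteq> S \<union> T \<Longrightarrow> e \<subseteq> S \<or> e \<subseteq> T"
proof -
  have f: "fs (S \<union> T)" using assms by (simp add: ss_fs)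
  have "dm X \<le> dl (S \<inter> T)" using assms by (intro dm_le) (auto intro: fs_Int ss_fs)
  moreover have "dl (S \<inter> T) \<le> dl T"
    using ss_le[OF ss_Int[OF assms(1,2)], of T] assms by (auto simp: ss_fs)
  moreover have "dl S \<le> dm (S \<union> T)" using dm_mono[OF f, of S] dm_ss assms by auto
  ultimately have c: "dl S + dl T \<le> dm (S \<union> T) + dl (S \<inter> T)" "dl (S \<inter> T) = dl T"
    using assms by auto
  show "ss (S \<union> T)" "dl (S \<union> T) = dl S"
    "\<And>e. e \<in> E \<Longrightarrow> e \<subseteq> S \<union> T \<Longrightarrow> e \<subseteq> S \<or> e \<subseteq> T"
    using free_union[OF assms(1,2) c(1)] c by auto
qed

lemma strong_Int_ss:
  assumes "strong m n M Y" "ss S" shows "ss (S \<inter> Y)"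
proof (rule ss_subI[OF assms(2)])
  fix T assume "S \<inter> Y \<subseteq> T" "T \<subseteq> S"
  then show "dl (S \<inter> Y) \<le> dl T"
    using assms unfolding strong_def strong_fin_def ss_def fs_def by auto
qed auto

text \<open>A self-sufficient superset of least cardinality is contained in every strong superset, because
  intersections with strong sets are self-sufficient.\<close>

lemma dim0_eq_dm: assumes "fs X" shows "dim0 m n M X = dm X"
proof -
  let ?P = "\<lambda>S. ss S \<and> X \<subseteq> S"
  obtain B where B: "ss B" "X \<subseteq> B" "dl B = dm X" using dm_attained assms by blast
  define S where "S = arg_min card ?P"
  have S: "ss S" "X \<subseteq> S" "\<And>T. ?P T \<Longrightarrow> card S \<le> card T"
    using arg_min_natI[of ?P B card] arg_min_nat_le[of ?P _ card] B unfolding S_def by auto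
  have least: "S \<subseteq> Y" if "X \<subseteq> Y" "strong m n M Y" for Y
  proof -
    have "card S \<le> card (S \<inter> Y)" using S that strong_Int_ss[of Y S] by auto
    then have "S \<inter> Y = S" using S(1) by (intro card_seteq) (auto simp: ss_def fs_def)
    then show ?thesis by auto
  qed
  \<comment> \<open>\<open>S\<close> has least cardinality, hence it is the least strong superset.\<close>
  have "cl0 m n M X = S" unfolding cl0_def
    using S least strong_iff_ss[of S] by (intro Least_equality) (auto simp: ss_def fs_def)
  moreover have "S \<subseteq> B" using least B strong_iff_ss[of B] by (auto simp: ss_def fs_def)
  then have "dl S \<le> dm X" using ss_le[OF S(1), of B] B ss_fs by auto
  moreover have "dm X \<le> dl S" using S by (intro dm_le) (auto simp: ss_fs)
  ultimately show ?thesis by (simp add: dim0_def)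
qed

lemma cld_eq_cl: assumes "fs X" shows "cld m n M X = cl X"
  using assms by (auto simp: cld_def cl_def dim0_eq_dm)


section \<open>Automorphisms and independence\<close>

text \<open>Automorphisms are treated as permutations of the whole type that move only vertices, so that
  composition and inversion are those of functions.\<close>

definition aut :: "('a \<Rightarrow> 'a) \<Rightarrow> bool" where
  "aut p \<longleftrightarrow> bij p \<and> (\<forall>x. x \<notin> V \<longrightarrow> p x = x) \<and> (\<forall>e. p ` e \<in> E \<longleftrightarrow> e \<in> E)"

lemma aut_bij: "aut p \<Longrightarrow> bij p" by (simp add: aut_def)
lemma aut_inj: "aut p \<Longrightarrow> inj_on p A" by (meson aut_bij bij_is_inj inj_on_subset subset_UNIV)

lemma aut_id: "aut id" "aut (\<lambda>x. x)" by (auto simp: aut_def id_def[symmetric])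

lemma aut_comp: "aut p \<Longrightarrow> aut q \<Longrightarrow> aut (p \<circ> q)"
  unfolding aut_def using bij_comp[of q p] by (auto simp only: o_apply image_comp[symmetric]) simp

text \<open>The symbol \<open>inv\<close> denotes inverses in groups.\<close>

abbreviation iv :: "('a \<Rightarrow> 'a) \<Rightarrow> 'a \<Rightarrow> 'a" where "iv p \<equiv> inv_into UNIV p"

lemma aut_inv_apply [simp]: "aut p \<Longrightarrow> iv p (p x) = x" "aut p \<Longrightarrow> p (iv p x) = x"
  using aut_bij[of p] by (simp_all add: bij_is_inj bij_is_surj surj_f_inv_f)

lemma aut_inv_image [simp]: "aut p \<Longrightarrow> iv p ` p ` A = A" "aut p \<Longrightarrow> p ` iv p ` A = A"
  by (auto simp: image_image)

lemma aut_inv: assumes "aut p" shows "aut (iv p)"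
  unfolding aut_def
proof (intro conjI allI impI)
  show "bij (iv p)" using assms aut_bij bij_imp_bij_inv by blast
  fix x assume "x \<notin> V" then show "iv p x = x" using assms by (metis aut_def aut_inv_apply(1))
next
  fix e show "(iv p ` e \<in> E) = (e \<in> E)" using assms by (metis aut_def aut_inv_image(2))
qed

lemma aut_inv_inv: "aut p \<Longrightarrow> iv (iv p) = p" by (simp add: aut_bij inv_inv_eq)

lemma aut_V: assumes "aut p" shows "p x \<in> V \<longleftrightarrow> x \<in> V"
  using assms aut_inj[OF assms, of UNIV] by (metis aut_def injD)

lemma aut_fs: "aut p \<Longrightarrow> fs (p ` X) \<longleftrightarrow> fs X"
  using aut_V[of p] aut_inj[of p X] by (auto simp: fs_def finite_image_iff image_subset_iff)

definition iso :: "('a \<Rightarrow> 'a) \<Rightarrow> 'a set \<Rightarrow> bool" where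
  "iso f S \<longleftrightarrow> inj_on f S \<and> (\<forall>e. e \<subseteq> S \<longrightarrow> (f ` e \<in> E \<longleftrightarrow> e \<in> E))"

lemma iso_subset: "iso f S \<Longrightarrow> T \<subseteq> S \<Longrightarrow> iso f T"
  unfolding iso_def by (meson inj_on_subset order_trans)

lemma aut_iso: "aut p \<Longrightarrow> iso p S" by (simp add: iso_def aut_def aut_inj)

lemma iso_inv: assumes "iso f S" shows "iso (inv_into S f) (f ` S)"
  unfolding iso_def
proof (intro conjI allI impI)
  show "inj_on (inv_into S f) (f ` S)" by (simp add: inj_on_inv_into)
  fix e assume e: "e \<subseteq> f ` S"
  have "inv_into S f ` e \<subseteq> S" using e by (auto intro: inv_into_into)
  moreover have "f ` inv_into S f ` e = e" using e by (rule image_inv_into_cancel[OF refl])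
  ultimately show "(inv_into S f ` e \<in> E) = (e \<in> E)" using assms unfolding iso_def by metis
qed

lemma delta_induced: "B \<subseteq> S \<Longrightarrow> delta m n (induced M S) B = dl B"
proof -
  assume "B \<subseteq> S"
  then have "edges_on (induced M S) B = edges_on M B" by (auto simp: edges_on_def induced_def)
  then show ?thesis by (simp add: delta_def)
qed

lemma iso_delta: assumes "iso f S" shows "dl (f ` S) = dl S"
proof -
  have "embedding f (induced M S) \<lparr>verts = UNIV, edges = E\<rparr>"
    using assms by (auto simp: embedding_def iso_def induced_def edges_on_def)
  from embedding_delta[OF this, of S m n]
  have "delta m n \<lparr>verts = UNIV, edges = E\<rparr> (f ` S) = dl S"
    using delta_induced[of S S] by (simp add: induced_def)
  then show ?thesis by (simp add: delta_def edges_on_def)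
qed

lemma iso_dm_le:
  assumes "iso f S" "ss S" "ss (f ` S)" "X \<subseteq> S" shows "dm (f ` X) \<le> dm X"
proof -
  have X: "fs X" using assms by (auto intro: fs_subset ss_fs)
  obtain B where B: "ss B" "X \<subseteq> B" "dl B = dm X" using dm_attained X by blast
  have "dm (f ` X) \<le> dl (f ` (B \<inter> S))"
    using assms B by (intro dm_le) (auto intro: fs_subset[OF ss_fs[OF assms(3)]])
  also have "\<dots> = dl (B \<inter> S)" by (rule iso_delta) (rule iso_subset[OF assms(1)], auto)
  also have "\<dots> \<le> dm X" using ss_cut[OF assms(2), of B] B ss_fs by auto
  finally show ?thesis .
qed

lemma iso_dm:
  assumes "iso f S" "ss S" "ss (f ` S)" "X \<subseteq> S" shows "dm (f ` X) = dm X"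
proof (rule antisym)
  show "dm (f ` X) \<le> dm X" using iso_dm_le assms .
  have i: "inj_on f S" using assms by (simp add: iso_def)
  have "dm (inv_into S f ` f ` X) \<le> dm (f ` X)"
    using assms i by (intro iso_dm_le[OF iso_inv[OF assms(1)]]) auto
  then show "dm X \<le> dm (f ` X)" using i assms(4) by (simp add: inv_into_image_cancel)
qed

lemma aut_dm_le: assumes "aut p" "fs X" shows "dm (p ` X) \<le> dm X"
proof -
  obtain B where B: "ss B" "X \<subseteq> B" "dl B = dm X" using dm_attained assms by blast
  have "dm (p ` X) \<le> dl (p ` B)" using B assms by (intro dm_le) (auto simp: aut_fs ss_fs)
  then show ?thesis using iso_delta[OF aut_iso[OF assms(1)]] B by simp
qed

lemma aut_dm: assumes "aut p" "fs X" shows "dm (p ` X) = dm X"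
  using aut_dm_le[OF assms] aut_dm_le[OF aut_inv[OF assms(1)], of "p ` X"] assms
  by (simp add: aut_fs)

lemma aut_ss: assumes "aut p" "ss S" shows "ss (p ` S)"
proof -
  have "dl (p ` S) \<le> dl B" if "fs B" "p ` S \<subseteq> B" for B
  proof -
    have "dl (p ` S) = dm (p ` S)"
      using iso_delta[OF aut_iso[OF assms(1)]] aut_dm[OF assms(1)] dm_ss assms ss_fs by simp
    then show ?thesis using dm_le that by simp
  qed
  then show ?thesis using assms by (simp add: ss_def aut_fs)
qed

lemma aut_cl: assumes "aut p" "fs X" shows "p x \<in> cl (p ` X) \<longleftrightarrow> x \<in> cl X"
proof -
  have "dm (insert (p x) (p ` X)) = dm (insert x X)" if "x \<in> V"
    using aut_dm[OF assms(1), of "insert x X"] that assms by simp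
  then show ?thesis using assms aut_V[OF assms(1)] by (auto simp: cl_def aut_dm)
qed

lemma aut_cl_image: assumes "aut p" "fs X" shows "p ` cl X = cl (p ` X)"
proof (intro equalityI subsetI)
  fix y assume "y \<in> cl (p ` X)"
  then have "iv p y \<in> cl X" using aut_cl[OF assms, of "iv p y"] assms by simp
  then show "y \<in> p ` cl X" using assms by (metis aut_inv_apply(2) imageI)
qed (use aut_cl assms in auto)

definition Stab :: "'a set \<Rightarrow> ('a \<Rightarrow> 'a) set" where
  "Stab A = {p. aut p \<and> (\<forall>x\<in>cl A. p x = x)}"

lemma Stab_aut: "p \<in> Stab A \<Longrightarrow> aut p" by (simp add: Stab_def)

lemma Stab_id: "id \<in> Stab A" "(\<lambda>x. x) \<in> Stab A" by (simp_all add: Stab_def aut_id)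

lemma Stab_comp: "p \<in> Stab A \<Longrightarrow> q \<in> Stab A \<Longrightarrow> p \<circ> q \<in> Stab A"
  by (auto simp: Stab_def aut_comp)

lemma Stab_inv: assumes "p \<in> Stab A" shows "iv p \<in> Stab A"
proof -
  have "iv p x = x" if "x \<in> cl A" for x
    using assms that aut_inv_apply(1)[of p x] by (auto simp: Stab_def)
  then show ?thesis using assms by (auto simp: Stab_def aut_inv)
qed

lemma Stab_mono: "fs B \<Longrightarrow> A \<subseteq> B \<Longrightarrow> p \<in> Stab B \<Longrightarrow> p \<in> Stab A"
  using cl_mono[of B A] by (auto simp: Stab_def)

lemma Stab_fixes: "p \<in> Stab A \<Longrightarrow> x \<in> cl A \<Longrightarrow> p x = x" by (simp add: Stab_def)

lemma Stab_image: assumes "p \<in> Stab A" "X \<subseteq> cl A" shows "p ` X = X"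
proof -
  have "p ` X = (\<lambda>x. x) ` X" using assms by (intro image_cong) (auto simp: Stab_def)
  then show ?thesis by simp
qed

text \<open>The symmetric form of the condition that \<open>X\<close> has the same dimension over \<open>A \<union> B\<close> as over
  \<open>A\<close>.\<close>

definition ind :: "'a set \<Rightarrow> 'a set \<Rightarrow> 'a set \<Rightarrow> bool" where
  "ind A X B \<longleftrightarrow> dm (A \<union> X \<union> B) + dm A = dm (A \<union> X) + dm (A \<union> B)"

lemma ind_sym: "ind A X B \<longleftrightarrow> ind A B X"
  by (simp add: ind_def Un_ac add.commute)

lemma ind_iff: 
  assumes "fs A" "fs X" "fs B"
  shows "ind A X B \<longleftrightarrow> dm (A \<union> X) + dm (A \<union> B) \<le> dm (A \<union> X \<union> B) + dm A"
proof -
  have "dm ((A \<union> X) \<union> (A \<union> B)) + dm A \<le> dm (A \<union> X) + dm (A \<union> B)"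
    using assms by (intro dm_submodular) auto
  moreover have "(A \<union> X) \<union> (A \<union> B) = A \<union> X \<union> B" by auto
  ultimately show ?thesis by (auto simp: ind_def)
qed

lemma ind_mono:
  assumes "ind A X B" "fs A" "fs X" "fs B" "C \<subseteq> B" shows "ind A X C"
proof -
  have C: "fs C" using assms fs_subset by blast
  have "dm ((A \<union> X \<union> C) \<union> (A \<union> B)) + dm (A \<union> C) \<le> dm (A \<union> X \<union> C) + dm (A \<union> B)"
    using assms C by (intro dm_submodular) auto
  moreover have "(A \<union> X \<union> C) \<union> (A \<union> B) = A \<union> X \<union> B" using assms(5) by auto
  ultimately show ?thesis using assms C by (subst ind_iff) (auto simp: ind_def)
qed

lemma ind_cl:
  assumes "ind A X B" "fs A" "fs X" "fs B" "finite C" "C \<subseteq> cl (A \<union> B)" shows "ind A X C"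
proof -
  have C: "fs C" using assms cl_V by (auto simp: fs_def)
  have "dm (A \<union> B \<union> C) = dm (A \<union> B)" using assms by (intro dm_absorb) auto
  moreover have "dm (A \<union> X \<union> B) \<le> dm (A \<union> X \<union> (B \<union> C))" using assms C by (intro dm_mono) auto
  ultimately have "ind A X (B \<union> C)" using assms C by (subst ind_iff) (auto simp: ind_def Un_ac)
  then show ?thesis 
      by (rule ind_mono[of A X "B \<union> C" C]) (use assms C in auto)
qed

lemma ind_base:
  assumes "ind A X (B \<union> C)" "fs A" "fs X" "fs B" "fs C" shows "ind (A \<union> B) X C"
proof -
  have "ind A X B" 
      by (rule ind_mono[of A X "B \<union> C"]) (use assms in auto)
  then show ?thesis using assms by (auto simp: ind_def Un_ac)
qed

lemma ind_trans:
  assumes "ind A X B" "ind (A \<union> B) X C" shows "ind A X (B \<union> C)"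
  using assms by (auto simp: ind_def Un_ac)

lemma ind_aut:
  assumes "aut p" "fs A" "fs X" "fs B" shows "ind (p ` A) (p ` X) (p ` B) \<longleftrightarrow> ind A X B"
  using assms by (simp add: ind_def image_Un[symmetric] aut_dm)

text \<open>An element of both closures is independent from itself over \<open>A\<close>.\<close>

lemma ind_Int_cl:
  assumes "ind A X B" "fs A" "fs X" "fs B" shows "cl (A \<union> X) \<inter> cl (A \<union> B) = cl A"
proof (intro equalityI subsetI)
  fix a assume a: "a \<in> cl (A \<union> X) \<inter> cl (A \<union> B)"
  have "ind A X {a}" by (rule ind_cl[of A X B]) (use assms a in auto)
  then have "ind A {a} X" by (simp add: ind_sym)
  then have "ind A {a} {a}"
    by (rule ind_cl[of A "{a}" X]) (use a assms in \<open>auto simp: cl_def\<close>)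
  then have "dm (insert a A) = dm A" by (simp add: ind_def)
  then show "a \<in> cl A" using a by (auto simp: cl_def)
next
  fix a assume a: "a \<in> cl A"
  show "a \<in> cl (A \<union> X) \<inter> cl (A \<union> B)"
    using a cl_mono[of "A \<union> X" A] cl_mono[of "A \<union> B" A] assms by auto
qed


section \<open>Homogeneity over closures\<close>

text \<open>The defining extension property speaks of structures on the natural numbers; a finite structure
  on any type is replaced by a copy there.\<close>

lemma embed_extension:
  fixes W :: "'b hypergraph" and \<phi> :: "'a \<Rightarrow> 'b"
  assumes "ss S" "in_C0 r m n W" "embedding \<phi> (induced M S) W"
    "strong_fin m n W (\<phi> ` S) (verts W)"
  obtains \<alpha> where "embedding \<alpha> W M" "\<And>x. x \<in> S \<Longrightarrow> \<alpha> (\<phi> x) = x" "ss (\<alpha> ` verts W)"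
proof -
  have fW: "finite (verts W)" using assms by (simp add: in_C0_def)
  obtain c :: "'b \<Rightarrow> nat" where c: "inj_on c (verts W)"
    using finite_imp_inj_to_nat_seg[OF fW] by auto
  define W' where "W' = \<lparr>verts = c ` verts W, edges = image c ` edges W\<rparr>"
  have unif: "e \<subseteq> verts W" "card e = r" "finite e" if "e \<in> edges W" for e
    using assms(2) that unfolding in_C0_def uniform_hypergraph_def by blast+
  have vW': "verts W' = c ` verts W" by (simp add: W'_def)
  have cW: "embedding c W W'" unfolding embedding_def
  proof (intro conjI allI impI)
    fix e assume e: "e \<subseteq> verts W"
    have "c ` e = c ` d \<longleftrightarrow> e = d" if "d \<in> edges W" for d
      using inj_on_image_eq_iff[OF c e] unif[OF that] by simp
    then show "(e \<in> edges W) = (c ` e \<in> edges W')" by (auto simp: W'_def)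
  qed (use c in \<open>auto simp: W'_def\<close>)
  have preim: "\<exists>U\<subseteq>verts W. c ` U = B \<and> (\<forall>v\<in>verts W. c v \<in> B \<longrightarrow> v \<in> U)" if "B \<subseteq> verts W'" for B
    by (rule exI[of _ "{v \<in> verts W. c v \<in> B}"]) (use that vW' in auto)
  have d0: "delta m n W {} = delta m n W' {}"
    using embedding_delta[OF cW, of "{}"] by simp
  have "in_C0 r m n W'" unfolding in_C0_def strong_fin_def
  proof (intro conjI allI impI)
    show "uniform_hypergraph r W'" unfolding uniform_hypergraph_def
    proof
      fix e assume "e \<in> edges W'"
      then obtain d where d: "d \<in> edges W" "e = c ` d" by (auto simp: W'_def)
      moreover have "inj_on c d" using unif(1)[OF d(1)] c by (rule inj_on_subset[rotated])
      ultimately show "e \<subseteq> verts W' \<and> finite e \<and> card e = r"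
        using unif[OF d(1)] by (auto simp: W'_def card_image)
    qed
    fix B assume "{} \<subseteq> B \<and> B \<subseteq> verts W'"
    then obtain U where U: "U \<subseteq> verts W" "c ` U = B" using preim[of B] by auto
    then have "delta m n W {} \<le> delta m n W U" using assms(2) by (simp add: in_C0_def strong_fin_def)
    then show "delta m n W' {} \<le> delta m n W' B" using embedding_delta[OF cW U(1)] U d0 by simp
  qed (use fW vW' in auto)
  moreover have vS: "\<phi> ` S \<subseteq> verts W" using assms(3) by (auto simp: embedding_def induced_def)
  have cS: "(c \<circ> \<phi>) ` S = c ` (\<phi> ` S)" by auto
  have "strong_fin m n W' ((c \<circ> \<phi>) ` S) (verts W')" unfolding strong_fin_def
  proof (intro conjI allI impI)
    show "(c \<circ> \<phi>) ` S \<subseteq> verts W'" using vS vW' by auto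
    fix B assume B: "(c \<circ> \<phi>) ` S \<subseteq> B \<and> B \<subseteq> verts W'"
    then obtain U where U: "U \<subseteq> verts W" "c ` U = B" "\<forall>v\<in>verts W. c v \<in> B \<longrightarrow> v \<in> U"
      using preim[of B] by auto
    have "\<phi> ` S \<subseteq> U" using U(3) vS B by auto
    then have "delta m n W (\<phi> ` S) \<le> delta m n W U" using assms(4) U by (simp add: strong_fin_def)
    then show "delta m n W' ((c \<circ> \<phi>) ` S) \<le> delta m n W' B"
      unfolding cS using embedding_delta[OF cW] U vS by metis
  qed
  moreover have "embedding (c \<circ> \<phi>) (induced M S) W'" unfolding embedding_def
  proof (intro conjI allI impI)
    show "inj_on (c \<circ> \<phi>) (verts (induced M S))"
      using assms(3) c vS by (intro comp_inj_on) (auto simp: embedding_def induced_def intro: inj_on_subset)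
    show "(c \<circ> \<phi>) ` verts (induced M S) \<subseteq> verts W'" using vS vW' by (auto simp: induced_def)
    fix e assume e: "e \<subseteq> verts (induced M S)"
    then have "\<phi> ` e \<subseteq> verts W" using vS by (auto simp: induced_def)
    moreover have "(c \<circ> \<phi>) ` e = c ` \<phi> ` e" by auto
    ultimately show "(e \<in> edges (induced M S)) = ((c \<circ> \<phi>) ` e \<in> edges W')"
      using cW assms(3) e unfolding embedding_def by metis
  qed
  moreover have "strong m n M S" "finite S" using assms(1) strong_iff_ss by (auto simp: ss_def fs_def)
  ultimately obtain \<alpha> where \<alpha>: "embedding \<alpha> W' M" "\<forall>x\<in>S. \<alpha> ((c \<circ> \<phi>) x) = x"
      "strong m n M (\<alpha> ` verts W')"
    using generic unfolding is_generic_def by blast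
  show ?thesis
  proof (rule that[of "\<alpha> \<circ> c"])
    show "embedding (\<alpha> \<circ> c) W M" unfolding embedding_def
    proof (intro conjI allI impI)
      show "inj_on (\<alpha> \<circ> c) (verts W)"
        using \<alpha>(1) c vW' by (intro comp_inj_on) (auto simp: embedding_def)
      show "(\<alpha> \<circ> c) ` verts W \<subseteq> V" using \<alpha>(1) vW' by (auto simp: embedding_def)
      fix e assume e: "e \<subseteq> verts W"
      then have "c ` e \<subseteq> verts W'" using vW' by auto
      moreover have "(\<alpha> \<circ> c) ` e = \<alpha> ` c ` e" by auto
      ultimately show "(e \<in> edges W) = ((\<alpha> \<circ> c) ` e \<in> E)"
        using cW \<alpha>(1) e unfolding embedding_def by metis
    qed
    have "(\<alpha> \<circ> c) ` verts W = \<alpha> ` verts W'" using vW' by auto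
    then show "ss ((\<alpha> \<circ> c) ` verts W)" using \<alpha>(3) strong_iff_ss[of "\<alpha> ` verts W'"] fW vW' by simp
  qed (use \<alpha>(2) in auto)
qed

lemma V_nonempty: "V \<noteq> {}"
proof -
  define W :: "unit hypergraph" where "W = \<lparr>verts = {()}, edges = {}\<rparr>"
  have e0: "edges_on M {} = {}" using edge_props(4) by (auto simp: edges_on_def)
  have "ss {}" unfolding ss_def using delta_nonneg e0 by (auto simp: delta_def)
  moreover have "in_C0 r m n W"
    by (auto simp: in_C0_def W_def uniform_hypergraph_def strong_fin_def delta_def edges_on_def)
  moreover have "embedding (\<lambda>x. ()) (induced M {}) W"
    using e0 by (auto simp: embedding_def induced_def W_def)
  moreover have "strong_fin m n W ((\<lambda>x. ()) ` {}) (verts W)"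
    by (auto simp: W_def strong_fin_def delta_def edges_on_def)
  ultimately obtain \<alpha> where "embedding \<alpha> W M" using embed_extension by blast
  then show ?thesis by (auto simp: embedding_def W_def)
qed

text \<open>The inverse of \<open>f\<close> embeds \<open>f ` P\<close> into \<open>Y\<close>, to which the extension property applies.\<close>

lemma extend_iso:
  assumes "ss P" "ss Y" "P \<subseteq> Y" "iso f P" "ss (f ` P)"
  obtains g where "\<And>x. x \<in> P \<Longrightarrow> g x = f x" "iso g Y" "ss (g ` Y)"
proof -
  let ?W = "induced M Y" and ?\<phi> = "inv_into P f"
  have i: "inj_on f P" using assms(4) by (simp add: iso_def)
  have fP: "?\<phi> ` f ` P = P" using i by (simp add: inv_into_image_cancel)
  have "in_C0 r m n ?W" using generic ss_fs[OF assms(2)] by (simp add: is_generic_def in_C0bar_def fs_def)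
  moreover have "embedding ?\<phi> (induced M (f ` P)) ?W" unfolding embedding_def
  proof (intro conjI allI impI)
    show "inj_on ?\<phi> (verts (induced M (f ` P)))" by (simp add: induced_def inj_on_inv_into)
    show "?\<phi> ` verts (induced M (f ` P)) \<subseteq> verts ?W" using fP assms(3) by (simp add: induced_def)
    fix e assume "e \<subseteq> verts (induced M (f ` P))"
    then have e: "e \<subseteq> f ` P" by (simp add: induced_def)
    then have "?\<phi> ` e \<subseteq> Y" using fP assms(3) by blast
    then show "(e \<in> edges (induced M (f ` P))) = (?\<phi> ` e \<in> edges ?W)"
      using iso_inv[OF assms(4)] e by (simp add: iso_def induced_def edges_on_def)
  qed
  moreover have "strong_fin m n ?W (?\<phi> ` f ` P) (verts ?W)"
    unfolding fP strong_fin_def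
  proof (intro conjI allI impI)
    show "P \<subseteq> verts ?W" using assms(3) by (simp add: induced_def)
    fix B assume "P \<subseteq> B \<and> B \<subseteq> verts ?W"
    then have B: "P \<subseteq> B" "B \<subseteq> Y" by (auto simp: induced_def)
    then have "dl P \<le> dl B" using assms(1) fs_subset[OF ss_fs[OF assms(2)]] by (intro ss_le) auto
    then show "delta m n ?W P \<le> delta m n ?W B" using B assms(3) by (simp add: delta_induced)
  qed
  ultimately obtain \<alpha> where \<alpha>: "embedding \<alpha> ?W M" "\<And>x. x \<in> f ` P \<Longrightarrow> \<alpha> (?\<phi> x) = x"
      "ss (\<alpha> ` verts ?W)"
    using embed_extension[OF assms(5)] by blast
  show ?thesis
  proof (rule that[of \<alpha>])
    fix x assume "x \<in> P" then show "\<alpha> x = f x" using \<alpha>(2)[of "f x"] i by simp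
  next
    show "iso \<alpha> Y" using \<alpha>(1) by (auto simp: embedding_def iso_def induced_def edges_on_def)
    show "ss (\<alpha> ` Y)" using \<alpha>(3) by (simp add: induced_def)
  qed
qed

lemma iso_cl:
  assumes "iso f Y" "ss Y" "ss (f ` Y)" "T \<subseteq> Y" "y \<in> Y"
  shows "f y \<in> cl (f ` T) \<longleftrightarrow> y \<in> cl T"
proof -
  have "dm (f ` insert y T) = dm (insert y T)" "dm (f ` T) = dm T"
    using assms by (intro iso_dm[OF assms(1-3)]; auto)+
  moreover have "y \<in> V" "f y \<in> V" using assms by (auto simp: ss_def fs_def)
  ultimately show ?thesis by (simp add: cl_def)
qed

text \<open>Injectivity of the common extension is the assumption that the images meet only where they
  have to; hyperedges are preserved because none of them crosses, on either side.\<close>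

lemma glue_iso:
  fixes f g h :: "'a \<Rightarrow> 'a"
  assumes "iso f S" "iso g T" "\<And>x. x \<in> S \<Longrightarrow> h x = f x" "\<And>x. x \<in> T \<Longrightarrow> h x = g x"
    and meet: "\<And>x y. x \<in> S \<Longrightarrow> y \<in> T \<Longrightarrow> f x = g y \<Longrightarrow> x = y"
    and split: "\<And>e. e \<in> E \<Longrightarrow> e \<subseteq> S \<union> T \<Longrightarrow> e \<subseteq> S \<or> e \<subseteq> T"
    and split': "\<And>e. e \<in> E \<Longrightarrow> e \<subseteq> f ` S \<union> g ` T \<Longrightarrow> e \<subseteq> f ` S \<or> e \<subseteq> g ` T"
  shows "iso h (S \<union> T)" "h ` (S \<union> T) = f ` S \<union> g ` T"
proof -
  have hS: "h ` e = f ` e" if "e \<subseteq> S" for e using that assms(3) by (intro image_cong) auto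
  have hT: "h ` e = g ` e" if "e \<subseteq> T" for e using that assms(4) by (intro image_cong) auto
  show im: "h ` (S \<union> T) = f ` S \<union> g ` T" using hS[of S] hT[of T] by (simp add: image_Un)
  have inj: "inj_on h (S \<union> T)"
  proof (rule inj_onI)
    fix x y assume xy: "x \<in> S \<union> T" "y \<in> S \<union> T" "h x = h y"
    have i: "inj_on f S" "inj_on g T" using assms by (simp_all add: iso_def)
    show "x = y"
      using xy assms(3)[of x] assms(3)[of y] assms(4)[of x] assms(4)[of y] meet[of x y] meet[of y x]
        inj_onD[OF i(1), of x y] inj_onD[OF i(2), of x y] by (metis Un_iff)
  qed
  have "h ` e \<in> E \<longleftrightarrow> e \<in> E" if e: "e \<subseteq> S \<union> T" for e
  proof -
    have "e \<subseteq> S \<or> e \<subseteq> T" if "h ` e \<in> E"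
    proof -
      have "h ` e \<subseteq> f ` S \<union> g ` T" using e im by blast
      then have "h ` e \<subseteq> h ` S \<or> h ` e \<subseteq> h ` T" using split'[OF that] hS[of S] hT[of T] by auto
      moreover have "e \<subseteq> A" if "h ` e \<subseteq> h ` A" "A \<subseteq> S \<union> T" for A
        using that e inj_onD[OF inj] by (auto simp: subset_eq image_iff) (metis Un_iff)
      ultimately show ?thesis by blast
    qed
    then show ?thesis using hS[of e] hT[of e] split[of e] e assms(1,2) unfolding iso_def by metis
  qed
  then show "iso h (S \<union> T)" using inj by (simp add: iso_def)
qed

text \<open>Only finite sets of vertices have to be compared, as no other set is a hyperedge on either side,
  and a finite set of vertices lies in some \<open>F i\<close>.\<close>

lemma aut_limit:
  fixes F :: "nat \<Rightarrow> 'a set" and f :: "nat \<Rightarrow> 'a \<Rightarrow> 'a"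
  assumes iso: "\<And>i. iso (f i) (F i)" and inc: "\<And>i. F i \<subseteq> F (Suc i)"
    and ext: "\<And>i x. x \<in> F i \<Longrightarrow> f (Suc i) x = f i x"
    and FV: "\<And>i. F i \<subseteq> V" "\<And>i. f i ` F i \<subseteq> V"
    and dom: "V \<subseteq> (\<Union>i. F i)" and ran: "V \<subseteq> (\<Union>i. f i ` F i)"
  obtains p where "aut p" "\<And>i x. x \<in> F i \<Longrightarrow> p x = f i x"
proof -
  have mono: "F i \<subseteq> F j" if "i \<le> j" for i j using lift_Suc_mono_le[of F, OF inc that] .
  have const: "f j x = f i x" if "i \<le> j" "x \<in> F i" for i j x
    using that
  proof (induction j rule: dec_induct)
    case (step j)
    then show ?case using ext[of x j] mono[of i j] by auto
  qed auto
  define p where "p x = (if x \<in> V then f (LEAST i. x \<in> F i) x else x)" for x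
  have pF: "p x = f i x" if "x \<in> F i" for i x
  proof -
    have "(LEAST i. x \<in> F i) \<le> i" "x \<in> F (LEAST i. x \<in> F i)"
      using that by (auto intro: Least_le LeastI)
    moreover have "x \<in> V" using FV(1)[of i] that by auto
    ultimately show ?thesis using const[of "LEAST i. x \<in> F i" i x] by (simp add: p_def)
  qed
  have fin: "\<exists>i. e \<subseteq> F i" if "finite e" "e \<subseteq> V" for e
    using that
  proof (induction e rule: finite_induct)
    case (insert x e)
    then obtain i j where "e \<subseteq> F i" "x \<in> F j" using dom by auto
    then have "insert x e \<subseteq> F (max i j)" using mono[of i "max i j"] mono[of j "max i j"] by auto
    then show ?case by blast
  qed auto
  have pV: "p x \<in> V \<longleftrightarrow> x \<in> V" for x
  proof (cases "x \<in> V")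
    case True
    then obtain i where "x \<in> F i" using dom by auto
    then show ?thesis using pF[of x i] FV(2)[of i] True by auto
  qed (simp add: p_def)
  have inj: "inj p"
  proof (rule injI)
    fix x y assume xy: "p x = p y"
    show "x = y"
    proof (cases "x \<in> V")
      case True
      then have "y \<in> V" using xy pV by metis
      then obtain i where "{x, y} \<subseteq> F i" using fin[of "{x, y}"] True by auto
      moreover have "inj_on (f i) (F i)" using iso by (simp add: iso_def)
      ultimately show ?thesis using xy pF by (auto dest: inj_onD)
    next
      case False
      then have "y \<notin> V" using xy pV by metis
      then show ?thesis using False xy by (simp add: p_def)
    qed
  qed
  have "surj p" unfolding surj_def
  proof
    fix y show "\<exists>x. y = p x"
    proof (cases "y \<in> V")
      case True
      then obtain i x where "x \<in> F i" "y = f i x" using ran by auto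
      then show ?thesis using pF by metis
    qed (auto simp: p_def)
  qed
  have "p ` e \<in> E \<longleftrightarrow> e \<in> E" for e
  proof (cases "finite e \<and> e \<subseteq> V")
    case True
    then obtain i where i: "e \<subseteq> F i" using fin[of e] by auto
    then have "p ` e = f i ` e" using pF by (intro image_cong) auto
    then show ?thesis using iso[of i] i by (simp add: iso_def)
  next
    case False
    have "finite (p ` e) \<longleftrightarrow> finite e" using inj by (simp add: finite_image_iff inj_on_def)
    moreover have "p ` e \<subseteq> V \<longleftrightarrow> e \<subseteq> V" using pV by auto
    ultimately show ?thesis using False edge_props[of e] edge_props[of "p ` e"] by blast
  qed
  then have "aut p" using inj \<open>surj p\<close> by (simp add: aut_def bij_def p_def)
  then show ?thesis using that pF by blast
qed

text \<open>The restrictions of \<open>p\<close> to \<open>cl A\<close> and of \<open>q\<close> to \<open>cl B\<close> have a union that is a bijection.\<close>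

definition glue :: "('a \<Rightarrow> 'a) \<Rightarrow> 'a set \<Rightarrow> ('a \<Rightarrow> 'a) \<Rightarrow> 'a set \<Rightarrow> bool" where
  "glue p A q B \<longleftrightarrow> aut p \<and> aut q \<and> fs A \<and> fs B \<and> (\<forall>y\<in>cl A \<inter> cl B. p y = q y) \<and>
     (\<forall>y\<in>cl A. p y \<in> cl (q ` B) \<longrightarrow> y \<in> cl B) \<and> (\<forall>y\<in>cl B. q y \<in> cl (p ` A) \<longrightarrow> y \<in> cl A)"

text \<open>A state of the back-and-forth that looks for a common extension of \<open>p\<close> on \<open>cl A\<close> and \<open>q\<close> on
  \<open>cl B\<close>.\<close>

definition state :: "('a \<Rightarrow> 'a) \<Rightarrow> 'a set \<Rightarrow> ('a \<Rightarrow> 'a) \<Rightarrow> 'a set \<Rightarrow> 'a set \<Rightarrow> ('a \<Rightarrow> 'a) \<Rightarrow> bool" where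
  "state p A q B Y f \<longleftrightarrow> ss Y \<and> ss (f ` Y) \<and> iso f Y \<and> A \<subseteq> Y \<and> B \<subseteq> Y \<and>
     (\<forall>y\<in>Y \<inter> cl A. f y = p y) \<and> (\<forall>y\<in>Y \<inter> cl B. f y = q y)"

lemma glue_sym: "glue p A q B \<Longrightarrow> glue q B p A" by (auto simp: glue_def)

lemma state_sym: "state p A q B Y f \<Longrightarrow> state q B p A Y f" by (auto simp: state_def)

lemma state_image:
  assumes "glue p A q B" "state p A q B Y f" shows "f ` A = p ` A"
proof (rule image_cong)
  fix x assume "x \<in> A"
  then show "f x = p x" using assms cl_sup[of A] unfolding glue_def state_def by blast
qed simp

text \<open>Inside \<open>Y\<close> dimensions are preserved by \<open>f\<close>, which agrees with \<open>p\<close> on \<open>A\<close>.\<close>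

lemma state_reflects:
  assumes "glue p A q B" "state p A q B Y f" "y \<in> Y" shows "f y \<in> cl (p ` A) \<longleftrightarrow> y \<in> cl A"
proof -
  have "f y \<in> cl (f ` A) \<longleftrightarrow> y \<in> cl A"
    using assms by (intro iso_cl[of f Y]) (auto simp: state_def)
  then show ?thesis using state_image[OF assms(1,2)] by simp
qed

text \<open>\<open>S\<close> has the dimension of \<open>A\<close>, so that \<open>absorb_union\<close> applies to \<open>Y\<close> and \<open>S\<close> and to their
  images.\<close>

lemma state_adjoin:
  assumes g: "glue p A q B" and s: "state p A q B Y f" and S: "ss S" "Y \<inter> cl A \<subseteq> S" "S \<subseteq> cl A"
  shows "state p A q B (Y \<union> S) (\<lambda>x. if x \<in> Y then f x else p x)" (is "state _ _ _ _ _ ?h")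
proof -
  have fsA: "fs A" and p: "aut p" using g by (auto simp: glue_def)
  have Y: "ss Y" "ss (f ` Y)" "iso f Y" "A \<subseteq> Y" using s by (auto simp: state_def)
  have AS: "A \<subseteq> S" using S Y cl_sup[OF fsA] by auto
  have fp: "f y = p y" if "y \<in> Y" "y \<in> cl A" for y using s that by (auto simp: state_def)
  have "dm (A \<union> S) = dm A" using S by (intro dm_absorb[OF fsA]) (auto simp: ss_def fs_def)
  then have dS: "dl S = dm A" using dm_ss[OF S(1)] AS by (simp add: Un_absorb1)
  have pA: "p ` A \<subseteq> f ` Y" using state_image[OF g s] Y(4) by auto
  have dpS: "dl (p ` S) = dm (p ` A)"
    using iso_delta[OF aut_iso[OF p], of S] aut_dm[OF p fsA] dS by simp
  note u = absorb_union[OF Y(1) S(1) Y(4) AS dS]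
  note u' = absorb_union[OF Y(2) aut_ss[OF p S(1)] pA image_mono[OF AS] dpS]
  have h: "iso ?h (Y \<union> S)" "?h ` (Y \<union> S) = f ` Y \<union> p ` S"
  proof (rule_tac [!] glue_iso[OF Y(3) aut_iso[OF p]])
    fix x y assume xy: "x \<in> Y" "y \<in> S" "f x = p y"
    then have "f x \<in> cl (p ` A)" using S(3) aut_cl[OF p fsA] by auto
    then have "x \<in> cl A" using state_reflects[OF g s xy(1)] by simp
    then have "p x = p y" using fp xy by auto
    then show "x = y" using aut_inj[OF p, of UNIV] by (auto dest: injD)
    show "x = y" by fact
  qed (use u(3) u'(3) fp S in auto)
  have "?h y = q y" if "y \<in> (Y \<union> S) \<inter> cl B" for y
    using that s g S by (auto simp: state_def glue_def)
  moreover have "?h y = p y" if "y \<in> (Y \<union> S) \<inter> cl A" for y using that fp by auto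
  ultimately show ?thesis unfolding state_def h(2) using h(1) u(1) u'(1) Y s by (auto simp: state_def)
qed

text \<open>A self-sufficient set \<open>Z\<close> that contains \<open>z\<close> may contain further elements of the two closures.
  These are adjoined first, as their images are prescribed; the rest of \<open>Z\<close> is mapped by the
  extension property.\<close>

lemma state_forth:
  assumes g: "glue p A q B" and s: "state p A q B Y f" and z: "z \<in> V"
  obtains Z h where "state p A q B Z h" "Y \<subseteq> Z" "z \<in> Z" "\<And>y. y \<in> Y \<Longrightarrow> h y = f y"
proof -
  have Y: "ss Y" "A \<subseteq> Y" "B \<subseteq> Y" using s by (auto simp: state_def)
  obtain Z where Z: "ss Z" "insert z Y \<subseteq> Z" using dm_attained[of "insert z Y"] z ss_fs[OF Y(1)] by auto
  define S where "S = Z \<inter> cl A"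
  define T where "T = Z \<inter> cl B"
  have ST: "ss S" "ss T" unfolding S_def T_def using Z Y by (auto intro: ss_Int_cl)
  let ?f1 = "\<lambda>x. if x \<in> Y then f x else p x"
  let ?f2 = "\<lambda>x. if x \<in> Y \<union> S then ?f1 x else q x"
  have s1: "state p A q B (Y \<union> S) ?f1"
    using Z by (intro state_adjoin[OF g s ST(1)]) (auto simp: S_def)
  have s2: "state p A q B (Y \<union> S \<union> T) ?f2"
    by (rule state_sym, rule state_adjoin[OF glue_sym[OF g] state_sym[OF s1] ST(2)])
       (use Z in \<open>auto simp: S_def T_def\<close>)
  obtain h where h: "\<And>x. x \<in> Y \<union> S \<union> T \<Longrightarrow> h x = ?f2 x" "iso h Z" "ss (h ` Z)"
    using extend_iso[of "Y \<union> S \<union> T" Z ?f2] s2 Z by (auto simp: state_def S_def T_def)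
  have hp: "h y = p y" if "y \<in> Z \<inter> cl A" for y
  proof -
    have "y \<in> (Y \<union> S \<union> T) \<inter> cl A" using that by (auto simp: S_def)
    moreover from this have "?f2 y = p y" using s2 unfolding state_def by blast
    ultimately show ?thesis using h(1)[of y] by simp
  qed
  have hq: "h y = q y" if "y \<in> Z \<inter> cl B" for y
  proof -
    have "y \<in> (Y \<union> S \<union> T) \<inter> cl B" using that by (auto simp: T_def)
    moreover from this have "?f2 y = q y" using s2 unfolding state_def by blast
    ultimately show ?thesis using h(1)[of y] by simp
  qed
  have "state p A q B Z h" unfolding state_def using h Z Y hp hq by auto
  then show ?thesis using that[of Z h] Z h(1) by auto
qed

text \<open>The conditions on a state are invariant under inversion, so going back is going forth with
  the inverse maps.\<close>

lemma glue_inverse: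
  assumes g: "glue p A q B" shows "glue (iv p) (p ` A) (iv q) (q ` B)"
proof -
  have a: "aut p" "aut q" "fs A" "fs B" using g by (auto simp: glue_def)
  have p: "y \<in> cl (p ` A) \<Longrightarrow> iv p y \<in> cl A" "y \<in> cl (q ` B) \<Longrightarrow> iv q y \<in> cl B" for y
    using aut_cl[OF a(1,3), of "iv p y"] aut_cl[OF a(2,4), of "iv q y"] a by auto
  have common: "iv p y = iv q y" if "y \<in> cl (p ` A)" "y \<in> cl (q ` B)" for y
  proof -
    have "iv p y \<in> cl B" using g p(1)[OF that(1)] that a unfolding glue_def by fastforce
    then have "p (iv p y) = q (iv p y)" using g p(1)[OF that(1)] unfolding glue_def by blast
    then have "y = q (iv p y)" using a by simp
    then have "iv q y = iv q (q (iv p y))" by simp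
    then show ?thesis using a by simp
  qed
  have 1: "y \<in> cl (q ` B)" if "y \<in> cl (p ` A)" "iv p y \<in> cl B" for y
  proof -
    have "p (iv p y) = q (iv p y)" using g p(1)[OF that(1)] that unfolding glue_def by blast
    then show ?thesis using aut_cl[OF a(2,4), of "iv p y"] that a by simp
  qed
  have 2: "y \<in> cl (p ` A)" if "y \<in> cl (q ` B)" "iv q y \<in> cl A" for y
  proof -
    have "p (iv q y) = q (iv q y)" using g p(2)[OF that(1)] that unfolding glue_def by blast
    then show ?thesis using aut_cl[OF a(1,3), of "iv q y"] that a by simp
  qed
  show ?thesis unfolding glue_def using a common 1 2 by (auto simp: aut_inv aut_fs)
qed

lemma state_inverse:
  assumes g: "glue p A q B" and s: "state p A q B Y f"
  shows "state (iv p) (p ` A) (iv q) (q ` B) (f ` Y) (inv_into Y f)"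
proof -
  have a: "aut p" "aut q" "fs A" "fs B" using g by (auto simp: glue_def)
  have i: "inj_on f Y" and Y: "iso f Y" "ss Y" "ss (f ` Y)" "A \<subseteq> Y" "B \<subseteq> Y"
    using s by (auto simp: state_def iso_def)
  have "inv_into Y f y = iv p y" if "y \<in> f ` Y \<inter> cl (p ` A)" for y
  proof -
    from that have "y \<in> f ` Y" by simp
    then obtain x where x: "y = f x" "x \<in> Y" by (rule imageE)
    then have "x \<in> cl A" using that state_reflects[OF g s] by auto
    then have "f x = p x" using x s by (auto simp: state_def)
    then show ?thesis using x i a by (metis aut_inv_apply(1) inv_into_f_f)
  qed
  moreover have "inv_into Y f y = iv q y" if "y \<in> f ` Y \<inter> cl (q ` B)" for y
  proof -
    from that have "y \<in> f ` Y" by simp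
    then obtain x where x: "y = f x" "x \<in> Y" by (rule imageE)
    then have "x \<in> cl B" using that state_reflects[OF glue_sym[OF g] state_sym[OF s]] by auto
    then have "f x = q x" using x s by (auto simp: state_def)
    then show ?thesis using x i a by (metis aut_inv_apply(1) inv_into_f_f)
  qed
  moreover have "p ` A \<subseteq> f ` Y" "q ` B \<subseteq> f ` Y"
    using state_image[OF g s] state_image[OF glue_sym[OF g] state_sym[OF s]]
      image_mono[OF Y(4), of f] image_mono[OF Y(5), of f] by simp_all
  moreover have "inv_into Y f ` f ` Y = Y" using i by (simp add: inv_into_image_cancel)
  ultimately show ?thesis
    unfolding state_def using Y iso_inv[OF Y(1)] by simp
qed

lemma state_back:
  assumes g: "glue p A q B" and s: "state p A q B Y f" and z: "z \<in> V"
  obtains Z h where "state p A q B Z h" "Y \<subseteq> Z" "z \<in> h ` Z" "\<And>y. y \<in> Y \<Longrightarrow> h y = f y"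
proof -
  have a: "aut p" "aut q" using g by (auto simp: glue_def)
  obtain Z k where k: "state (iv p) (p ` A) (iv q) (q ` B) Z k" "f ` Y \<subseteq> Z" "z \<in> Z"
      "\<And>y. y \<in> f ` Y \<Longrightarrow> k y = inv_into Y f y"
    using state_forth[OF glue_inverse[OF g] state_inverse[OF g s] z] by blast
  have i: "inj_on f Y" "inj_on k Z" using s k(1) by (auto simp: state_def iso_def)
  have kf: "k (f y) = y" if "y \<in> Y" for y using k(4)[of "f y"] that i by simp
  show ?thesis
  proof (rule that)
    show "state p A q B (k ` Z) (inv_into Z k)"
      using state_inverse[OF glue_inverse[OF g] k(1)] a by (simp add: aut_inv_inv)
    show "Y \<subseteq> k ` Z" using kf k(2) by force
    show "z \<in> inv_into Z k ` k ` Z" using i k(3) by (simp add: inv_into_image_cancel)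
    fix y assume y: "y \<in> Y"
    then have "f y \<in> Z" using k(2) by auto
    then have "inv_into Z k (k (f y)) = f y" using i by simp
    then show "inv_into Z k y = f y" using kf[OF y] by simp
  qed
qed

lemma extend_two:
  assumes g: "glue p A q B" and s: "state p A q B Y f"
  obtains h where "aut h" "\<And>y. y \<in> Y \<Longrightarrow> h y = f y" "\<And>y. y \<in> cl A \<Longrightarrow> h y = p y"
    "\<And>y. y \<in> cl B \<Longrightarrow> h y = q y"
proof -
  define z where "z = from_nat_into V"
  have z: "range z = V" unfolding z_def using V_nonempty V_countable by (rule range_from_nat_into)
  let ?Q = "\<lambda>i (Z, k) (Z', k'). Z \<subseteq> Z' \<and> (\<forall>y\<in>Z. k' y = k y) \<and> z i \<in> Z' \<and> z i \<in> k' ` Z'"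
  let ?P = "\<lambda>(i::nat) (Z, k). state p A q B Z k \<and> Y \<subseteq> Z \<and> (\<forall>y\<in>Y. k y = f y)"
  have "\<exists>G. \<forall>i. ?P i (G i) \<and> ?Q i (G i) (G (Suc i))"
  proof (rule dependent_nat_choice)
    show "\<exists>G. ?P 0 G" using s by (intro exI[of _ "(Y, f)"]) auto
    fix G :: "'a set \<times> ('a \<Rightarrow> 'a)" and i assume P: "?P i G"
    obtain Z k where G: "G = (Z, k)" by (cases G)
    have Zk: "state p A q B Z k" "Y \<subseteq> Z" "\<And>y. y \<in> Y \<Longrightarrow> k y = f y" using P G by auto
    obtain Z1 k1 where 1: "state p A q B Z1 k1" "Z \<subseteq> Z1" "z i \<in> Z1" "\<And>y. y \<in> Z \<Longrightarrow> k1 y = k y"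
      using state_forth[OF g Zk(1), of "z i"] z by blast
    obtain Z2 k2 where 2: "state p A q B Z2 k2" "Z1 \<subseteq> Z2" "z i \<in> k2 ` Z2" "\<And>y. y \<in> Z1 \<Longrightarrow> k2 y = k1 y"
      using state_back[OF g 1(1), of "z i"] z by blast
    have "k2 y = k y" if "y \<in> Z" for y using that 1(2,4) 2(4) by (metis subsetD)
    moreover have "k2 y = f y" if "y \<in> Y" for y using that calculation Zk(2,3) by (metis subsetD)
    moreover have "z i \<in> Z2" using 1 2 by auto
    ultimately have "?P (Suc i) (Z2, k2) \<and> ?Q i G (Z2, k2)" using Zk(1,2) 1(2) 2(1-3) G by auto
    then show "\<exists>G'. ?P (Suc i) G' \<and> ?Q i G G'" by blast
  qed
  then obtain G where "\<forall>i. ?P i (G i) \<and> ?Q i (G i) (G (Suc i))" ..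
  then have G: "?P i (G i)" "?Q i (G i) (G (Suc i))" for i by simp_all
  define Z where "Z i = fst (G i)" for i
  define k where "k i = snd (G i)" for i
  have st: "state p A q B (Z i) (k i)" and ext0: "Y \<subseteq> Z i" "y \<in> Y \<Longrightarrow> k i y = f y" for i y
    using G(1)[of i] unfolding Z_def k_def by (simp_all add: case_prod_unfold)
  have nx: "Z i \<subseteq> Z (Suc i)" "\<And>y. y \<in> Z i \<Longrightarrow> k (Suc i) y = k i y"
      "z i \<in> Z (Suc i)" "z i \<in> k (Suc i) ` Z (Suc i)" for i
    using G(2)[of i] unfolding Z_def k_def by (simp_all add: case_prod_unfold)
  have kZ: "iso (k i) (Z i)" "Z i \<subseteq> V" "k i ` Z i \<subseteq> V" for i
    using st[of i] by (auto simp: state_def ss_def fs_def)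
  have dom: "V \<subseteq> (\<Union>i. Z i)" "V \<subseteq> (\<Union>i. k i ` Z i)" proof -
    have "v \<in> (\<Union>i. Z i) \<and> v \<in> (\<Union>i. k i ` Z i)" if "v \<in> V" for v
    proof -
      from that z have "v \<in> range z" by simp
      then obtain i where v: "v = z i" by (rule rangeE)
      show ?thesis unfolding v
        by (intro conjI UN_I[of "Suc i"] UNIV_I nx(3,4))
    qed
    then show "V \<subseteq> (\<Union>i. Z i)" "V \<subseteq> (\<Union>i. k i ` Z i)" by (simp_all add: subset_iff)
  qed
  obtain h where h: "aut h" "\<And>i x. x \<in> Z i \<Longrightarrow> h x = k i x"
    using aut_limit[of k Z, OF kZ(1) nx(1,2) kZ(2,3) dom] by metis
  show ?thesis
  proof (rule that[OF h(1)])
    fix y assume "y \<in> Y" then show "h y = f y" using h(2)[of y 0] ext0(1)[of 0] ext0(2)[of y 0] by auto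
  next
    fix y assume y: "y \<in> cl A"
    then obtain i where "y \<in> Z i" using dom cl_V by blast
    then show "h y = p y" using h(2) st[of i] y by (auto simp: state_def)
  next
    fix y assume y: "y \<in> cl B"
    then obtain i where "y \<in> Z i" using dom cl_V by blast
    then show "h y = q y" using h(2) st[of i] y by (auto simp: state_def)
  qed
qed

text \<open>The case of a single closed set that is fixed pointwise.\<close>

lemma homogeneity:
  assumes "fs A" "ss Y" "A \<subseteq> Y" "iso f Y" "ss (f ` Y)" "\<And>y. y \<in> Y \<inter> cl A \<Longrightarrow> f y = y"
  obtains p where "p \<in> Stab A" "\<And>y. y \<in> Y \<Longrightarrow> p y = f y"
proof -
  have g: "glue id A id A" using assms aut_id by (simp add: glue_def)
  have s: "state id A id A Y f" using assms by (simp add: state_def)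
  obtain h where "aut h" "\<And>y. y \<in> Y \<Longrightarrow> h y = f y" "\<And>y. y \<in> cl A \<Longrightarrow> h y = id y"
    using extend_two[OF g s] by metis
  then show ?thesis using that[of h] by (simp add: Stab_def)
qed

text \<open>By independence the closures of \<open>A \<union> X\<close> and \<open>A \<union> B\<close> are in free amalgamation over \<open>cl A\<close>, and
  so are their images. Hence \<open>p\<close> on the first and the identity on the second closure have a common
  extension.\<close>

lemma stationarity:
  assumes "fs A" "fs X" "fs B" "p \<in> Stab A" "ind A X B" "ind A (p ` X) B"
  obtains q where "q \<in> Stab (A \<union> B)" "\<And>x. x \<in> cl (A \<union> X) \<Longrightarrow> q x = p x"
proof -
  have p: "aut p" using assms(4) by (rule Stab_aut)
  have pA: "p ` A = A" using assms cl_sup by (intro Stab_image) auto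
  have pX: "fs (p ` X)" using assms p by (simp add: aut_fs)
  have pAX: "p ` (A \<union> X) = A \<union> p ` X" using pA by (simp add: image_Un)
  have pc: "p x = x" if "x \<in> cl A" for x using that assms(4) by (rule Stab_fixes[rotated])
  have meet: "cl (A \<union> X) \<inter> cl (A \<union> B) = cl A" using assms by (intro ind_Int_cl) auto
  have meet': "cl (p ` (A \<union> X)) \<inter> cl (A \<union> B) = cl A"
    unfolding pAX using assms pX by (intro ind_Int_cl) auto
  have refl: "x \<in> cl A" if "x \<in> cl (A \<union> X)" "p x \<in> cl (A \<union> B)" for x
  proof -
    have "p x \<in> cl (p ` (A \<union> X))" using that aut_cl[OF p] assms by simp
    then have "p x \<in> cl (p ` A)" using that meet' pA by auto
    then show ?thesis using aut_cl[OF p] assms by simp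
  qed
  have g: "glue p (A \<union> X) id (A \<union> B)"
    unfolding glue_def using p aut_id assms meet meet' pc refl by (auto simp del: id_apply) auto
  obtain S where S: "ss S" "A \<union> X \<subseteq> S" "dl S = dm (A \<union> X)" "S \<subseteq> cl (A \<union> X)"
    using cl_ss_cover[of "A \<union> X" "{}"] assms by auto
  obtain T where T: "ss T" "A \<union> B \<subseteq> T" "dl T = dm (A \<union> B)" "T \<subseteq> cl (A \<union> B)"
    using cl_ss_cover[of "A \<union> B" "{}"] assms by auto
  have fsS: "fs S" "fs T" "fs (p ` S)" using S T p by (auto simp: ss_fs aut_fs)
  have S': "ss (p ` S)" "dl (p ` S) = dl S" "A \<union> p ` X \<subseteq> p ` S"
    using aut_ss[OF p S(1)] iso_delta[OF aut_iso[OF p]] image_mono[OF S(2), of p] pAX by auto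
  have free: "dl S + dl T \<le> dm (S \<union> T) + dl (S \<inter> T)"
  proof -
    have "dm (A \<union> X \<union> B) \<le> dm (S \<union> T)" using S T fsS by (intro dm_mono) auto
    moreover have "dm A \<le> dl (S \<inter> T)" using S T fsS by (intro dm_le) (auto intro: fs_Int)
    ultimately show ?thesis using assms(5) S T by (simp add: ind_def)
  qed
  have free': "dl (p ` S) + dl T \<le> dm (p ` S \<union> T) + dl (p ` S \<inter> T)"
  proof -
    have "dm (A \<union> p ` X \<union> B) \<le> dm (p ` S \<union> T)" using S' T fsS by (intro dm_mono) auto
    moreover have "dm A \<le> dl (p ` S \<inter> T)" using S' T fsS by (intro dm_le) (auto intro: fs_Int)
    moreover have "dm (A \<union> p ` X) = dm (A \<union> X)"
      using aut_dm[OF p, of "A \<union> X"] pAX assms by simp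
    ultimately show ?thesis using assms(6) S S' T by (simp add: ind_def)
  qed
  note u = free_union[OF S(1) T(1) free] and u' = free_union[OF S'(1) T(1) free']
  let ?h = "\<lambda>x. if x \<in> S then p x else x"
  have hid: "?h x = x" if "x \<in> cl (A \<union> B)" "x \<in> S \<union> T" for x
    using that S meet pc by auto
  have h: "iso ?h (S \<union> T)" "?h ` (S \<union> T) = p ` S \<union> id ` T"
  proof (rule_tac [!] glue_iso[OF aut_iso[OF p] aut_iso[OF aut_id(1)]])
    fix x y assume xy: "x \<in> S" "y \<in> T" "p x = id y"
    then have "x \<in> cl A" using refl[of x] S T by auto
    then show "x = y" using pc xy by auto
    show "x = y" by fact
  next
    fix x assume "x \<in> T"
    then have "?h x = x" using T by (intro hid) auto
    then show "?h x = id x" by simp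
    show "?h x = id x" by fact
  qed (use u(3) u'(3) in auto)
  have hp: "?h y = p y" if "y \<in> cl (A \<union> X)" "y \<in> S \<union> T" for y
  proof (cases "y \<in> S")
    case False
    then have "y \<in> cl A" using that T meet by auto
    then show ?thesis using pc False by simp
  qed simp
  have st: "state p (A \<union> X) id (A \<union> B) (S \<union> T) ?h"
    unfolding state_def h(2) using h(1) u(1) u'(1) S T hid hp by auto
  obtain q where q: "aut q" "\<And>y. y \<in> cl (A \<union> X) \<Longrightarrow> q y = p y" "\<And>y. y \<in> cl (A \<union> B) \<Longrightarrow> q y = id y"
    using extend_two[OF g st] by metis
  then show ?thesis using that[of q] by (simp add: Stab_def)
qed

end

section \<open>Extensions of self-sufficient sets\<close>

lemma card_missing:
  assumes "\<And>i. i < l \<Longrightarrow> 2 \<le> i \<Longrightarrow> P i" "P 0 \<or> 1 \<le> l" "P 1 \<or> 2 \<le> (l::nat)"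
  shows "int (card {i. i < l \<and> P i}) = int l - of_bool (\<not> P 0) - of_bool (\<not> P 1)"
proof -
  define X where "X = (if P 0 then {} else {0}) \<union> (if P 1 then {} else {1::nat})"
  have pi: "P i" if "i < l" "i \<noteq> 0" "i \<noteq> 1" for i using assms(1)[of i] that by simp
  have "{i. i < l \<and> P i} = {..<l} - X"
  proof (intro equalityI subsetI)
    fix i assume i: "i \<in> {i. i < l \<and> P i}"
    have "i \<notin> X"
    proof
      assume "i \<in> X"
      then show False using i by (auto simp: X_def split: if_splits)
    qed
    then show "i \<in> {..<l} - X" using i by simp
  next
    fix i assume i: "i \<in> {..<l} - X"
    have "P i" by (cases "i = 0"; cases "i = 1") (use i pi in \<open>auto simp: X_def split: if_splits\<close>)
    then show "i \<in> {i. i < l \<and> P i}" using i by simp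
  qed
  moreover have "X \<subseteq> {..<l}" using assms(2,3) by (auto simp: X_def)
  moreover have "finite X" unfolding X_def by simp
  ultimately have "card {i. i < l \<and> P i} = l - card X" "card X \<le> l"
    using card_Diff_subset[of X "{..<l}"] card_mono[of "{..<l}" X] by simp_all
  moreover have "card X = of_bool (\<not> P 0) + of_bool (\<not> P 1)" unfolding X_def by auto
  ultimately show ?thesis by simp
qed

text \<open>Predimensions along a path \<open>q\<^sub>0, q\<^sub>1, \<dots>\<close> in which every vertex has an edge to its
  predecessor. When all predecessors are present the predimension runs through the values \<open>s\<close>; for
  a part \<open>Q\<close> of the path each missing predecessor saves an edge of weight \<open>m\<close>. As the values stay
  in an interval of length \<open>m\<close>, a gap never costs more than it saves.\<close>

definition path_inc :: "int \<Rightarrow> (nat \<Rightarrow> int) \<Rightarrow> bool \<Rightarrow> nat set \<Rightarrow> nat \<Rightarrow> int" where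
  "path_inc m s start Q j =
     s (Suc j) - s j + (if (if j = 0 then start else j - 1 \<in> Q) then 0 else m)"

lemma path_sum:
  assumes "\<And>j. j < t \<Longrightarrow> s j \<le> m" "\<And>j. j \<le> t \<Longrightarrow> lo \<le> s j" "0 \<le> lo"
    "c = (if start then s 0 else 0)" "u \<le> t" "Q \<subseteq> {..<u}"
  shows "0 \<le> c + (\<Sum>j\<in>Q. path_inc m s start Q j) \<and>
    (start \<longrightarrow> lo \<le> c + (\<Sum>j\<in>Q. path_inc m s start Q j)) \<and>
    (u - 1 \<in> Q \<longrightarrow> s u \<le> c + (\<Sum>j\<in>Q. path_inc m s start Q j))"
  using assms(5,6)
proof (induction u arbitrary: Q)
  case 0
  then show ?case using assms(2)[of 0] assms(3,4) by auto
next
  case (Suc u)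
  show ?case
  proof (cases "u \<in> Q")
    case False
    then have "Q \<subseteq> {..<u}" using Suc.prems(2) by (auto simp: less_Suc_eq)
    then show ?thesis using Suc.IH[of Q] Suc.prems False by auto
  next
    case True
    define R where "R = Q - {u}"
    have R: "R \<subseteq> {..<u}" "finite R" "u \<notin> R" "Q = insert u R"
      using Suc.prems(2) True finite_subset[of Q "{..<Suc u}"] by (auto simp: R_def less_Suc_eq)
    have "(\<Sum>j\<in>R. path_inc m s start Q j) = (\<Sum>j\<in>R. path_inc m s start R j)"
      using R by (intro sum.cong) (auto simp: path_inc_def)
    then have sum: "(\<Sum>j\<in>Q. path_inc m s start Q j)
        = path_inc m s start Q u + (\<Sum>j\<in>R. path_inc m s start R j)" (is "_ = _ + ?R")
      using R by simp
    have ih: "0 \<le> c + ?R" "u - 1 \<in> R \<longrightarrow> s u \<le> c + ?R"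
      using Suc.IH[of R] R Suc.prems by auto
    have su: "s u \<le> m" "lo \<le> s (Suc u)" using assms(1)[of u] assms(2)[of "Suc u"] Suc.prems by auto
    have "s (Suc u) \<le> c + (path_inc m s start Q u + ?R)"
    proof (cases "u = 0")
      case True
      then have "R = {}" using R by auto
      then show ?thesis using True su assms(4) by (auto simp: path_inc_def)
    next
      case u: False
      then show ?thesis using R ih su by (auto simp: path_inc_def)
    qed
    then show ?thesis unfolding sum using su assms(3) by auto
  qed
qed

lemma path_sum_full:
  "(\<Sum>j<t. path_inc m s True {..<t} j) = s t - s 0"
proof -
  have "(\<Sum>j<t. path_inc m s True {..<t} j) = (\<Sum>j<t. s (Suc j) - s j)"
    by (intro sum.cong) (auto simp: path_inc_def)
  then show ?thesis by (simp add: sum_lessThan_telescope)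
qed

text \<open>As \<open>n\<close> is invertible modulo \<open>m\<close>, a path can be made to end at any prescribed value. The
  number \<open>l j\<close> is the number of edges at the vertex \<open>q\<^sub>j\<close>; \<open>m \<le> n\<close> makes it
  positive at every step that starts from a positive value.\<close>

lemma path_numbers:
  fixes m n :: nat and a e :: int
  assumes "coprime m n" "1 \<le> m" "m \<le> n" "0 \<le> a" "a \<le> int m" "0 \<le> e" "e \<le> int m"
  obtains t s l where "0 < t" "s 0 = a" "s t = e" "\<And>j. j < t \<Longrightarrow> s j \<le> int m"
    "\<And>j. 0 < j \<Longrightarrow> j < t \<Longrightarrow> 1 \<le> s j"
    "\<And>j. j < t \<Longrightarrow> int n - int m * int (l j) = s (Suc j) - s j"
    "\<And>j. j < t \<Longrightarrow> l j \<le> n + m" "\<And>j. j < t \<Longrightarrow> 1 \<le> s j \<Longrightarrow> 1 \<le> l j"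
    "\<And>j. j < t \<Longrightarrow> 1 \<le> s j \<Longrightarrow> s (Suc j) = 0 \<Longrightarrow> 2 \<le> l j"
proof -
  obtain x y where xy: "n * x = m * y + 1"
    using bezout_nat[of n m] assms by (auto simp: coprime_iff_gcd_eq_1 gcd.commute)
  \<comment> \<open>The summand \<open>m\<close> makes \<open>k\<close>, and thus the length \<open>t\<close>, positive without changing residues.\<close>
  define k where "k = nat ((e - a) mod int m) + m"
  define t where "t = x * k"
  have "x \<noteq> 0" using xy by (cases x) auto
  then have t: "0 < t" using assms by (simp add: t_def k_def)
  have k: "int k = (e - a) mod int m + int m" using assms by (simp add: k_def)
  have "int t * int n = int k * int (n * x)" by (simp add: t_def)
  also have "\<dots> = int k * (int m * int y + 1)" by (simp only: xy of_nat_add of_nat_mult of_nat_1)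
  finally have "a + int t * int n - e = int m * (int k * int y + 1) - ((e - a) - (e - a) mod int m)"
    using k by (simp add: algebra_simps)
  then have tn: "int m dvd a + int t * int n - e"
    by (simp add: minus_mod_eq_mult_div dvd_diff)
  define rep where "rep b = (b - 1) mod int m + 1" for b :: int
  have rep: "1 \<le> rep b" "rep b \<le> int m" "int m dvd b - rep b" for b
  proof -
    show "1 \<le> rep b" "rep b \<le> int m"
      using assms pos_mod_bound[of "int m" "b - 1"] pos_mod_sign[of "int m" "b - 1"]
      unfolding rep_def by linarith+
    have "b - rep b = (b - 1) - (b - 1) mod int m" by (simp add: rep_def)
    then show "int m dvd b - rep b" by (simp add: minus_mod_eq_mult_div)
  qed
  define s where "s j = (if j = 0 then a else if j < t then rep (a + int j * int n) else e)" for j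
  have sd: "int m dvd a + int j * int n - s j" if "j \<le> t" for j
    using that rep(3)[of "a + int j * int n"] tn t by (auto simp: s_def)
  have sm: "s j \<le> int m" "0 \<le> s j" for j
    using rep(1,2)[of "a + int j * int n"] assms by (auto simp: s_def)
  have dv: "int m dvd int n + s j - s (Suc j)" if "j < t" for j
  proof -
    have "int m dvd (a + int (Suc j) * int n - s (Suc j)) - (a + int j * int n - s j)"
      using sd[of j] sd[of "Suc j"] that by (rule_tac dvd_diff) auto
    then show ?thesis by (simp add: algebra_simps)
  qed
  define l where "l j = nat ((int n + s j - s (Suc j)) div int m)" for j
  have ml: "int m * int (l j) = int n + s j - s (Suc j)" if "j < t" for j
  proof -
    have "0 \<le> int n + s j - s (Suc j)" using sm[of "Suc j"] sm(2)[of j] assms by linarith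
    then have "int (l j) = (int n + s j - s (Suc j)) div int m"
      using assms by (simp add: l_def pos_imp_zdiv_nonneg_iff)
    then show ?thesis using dv[OF that] by simp
  qed
  show ?thesis
  proof (rule that[of t s l])
    show "0 < t" "s 0 = a" "s t = e" using t by (auto simp: s_def)
    show "s j \<le> int m" for j by (rule sm)
    show "1 \<le> s j" if "0 < j" "j < t" for j using that rep by (simp add: s_def)
    show "int n - int m * int (l j) = s (Suc j) - s j" if "j < t" for j using ml[OF that] by simp
    show "l j \<le> n + m" if "j < t" for j
    proof -
      have "int (l j) \<le> int m * int (l j)" using assms by (cases "l j") auto
      then show ?thesis using ml[OF that] sm(1)[of j] sm(2)[of "Suc j"] by linarith
    qed
    show "1 \<le> l j" if "j < t" "1 \<le> s j" for j
    proof (rule ccontr)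
      assume "\<not> 1 \<le> l j"
      then have "l j = 0" by simp
      then show False using ml[OF that(1)] sm(1)[of "Suc j"] that assms by simp
    qed
    show "2 \<le> l j" if "j < t" "1 \<le> s j" "s (Suc j) = 0" for j
    proof (rule ccontr)
      assume "\<not> 2 \<le> l j"
      then have "l j = 0 \<or> l j = 1" by auto
      then have "int m * int (l j) \<le> int m" by auto
      then show False using ml[OF that(1)] that assms by simp
    qed
  qed
qed

context hrushovski_generic
begin

lemma Plus_decomp: "B = (Inl -` B) <+> (Inr -` B)"
proof (intro equalityI subsetI)
  fix v assume "v \<in> B" then show "v \<in> (Inl -` B) <+> (Inr -` B)" by (cases v) auto
qed auto

lemma delta_empty: "dl {} = 0"
proof -
  have "edges_on M {} = {}" using edge_props(4) by (auto simp: edges_on_def)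
  then show ?thesis by (simp add: delta_def)
qed

text \<open>The inequality says that no set of new vertices has negative predimension over \<open>S\<close>; it makes
  \<open>S\<close> self-sufficient in the extension.\<close>

lemma extend_by_vertices:
  fixes N :: "'b set" and I :: "'i set" and ed :: "'i \<Rightarrow> ('a + 'b) set"
  assumes S: "ss S" and fin: "finite N" "finite I" and inj: "inj_on ed I"
    and ed: "\<And>i. i \<in> I \<Longrightarrow> ed i \<subseteq> S <+> N" "\<And>i. i \<in> I \<Longrightarrow> card (ed i) = r"
      "\<And>i. i \<in> I \<Longrightarrow> \<not> ed i \<subseteq> Inl ` S"
    and pos: "\<And>N'. N' \<subseteq> N \<Longrightarrow>
      int m * int (card {i \<in> I. ed i \<subseteq> S <+> N'}) \<le> int n * int (card N')"
  obtains \<beta> :: "'b \<Rightarrow> 'a" where "inj_on \<beta> N" "\<beta> ` N \<inter> S = {}" "ss (S \<union> \<beta> ` N)"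
    "\<And>e. e \<subseteq> S \<union> \<beta> ` N \<Longrightarrow> e \<in> E \<longleftrightarrow> (e \<in> E \<and> e \<subseteq> S) \<or> (\<exists>i\<in>I. e = case_sum id \<beta> ` ed i)"
    "\<And>S' N'. S' \<subseteq> S \<Longrightarrow> N' \<subseteq> N \<Longrightarrow> dl (S' \<union> \<beta> ` N') =
       dl S' + int n * int (card N') - int m * int (card {i \<in> I. ed i \<subseteq> S' <+> N'})"
proof -
  define W where "W = \<lparr>verts = S <+> N, edges = image Inl ` edges_on M S \<union> ed ` I\<rparr>"
  have vW: "verts W = S <+> N" by (simp add: W_def)
  have fS: "finite S" "fs S" using S by (auto simp: ss_def fs_def)
  have dW: "delta m n W (S' <+> N') =
      dl S' + int n * int (card N') - int m * int (card {i \<in> I. ed i \<subseteq> S' <+> N'})"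
    if "S' \<subseteq> S" "N' \<subseteq> N" for S' N'
  proof -
    let ?J = "{i \<in> I. ed i \<subseteq> S' <+> N'}"
    have f: "finite S'" "finite N'" using that fS fin finite_subset by auto
    have sub1: "Inl ` e \<subseteq> S' <+> N' \<longleftrightarrow> e \<subseteq> S'" for e by auto
    have "edges_on W (S' <+> N') = image Inl ` edges_on M S' \<union> ed ` ?J"
      using that sub1 by (auto simp: edges_on_def W_def)
    moreover have "card (image Inl ` edges_on M S' \<union> ed ` ?J) = card (edges_on M S') + card ?J"
    proof -
      have "inj_on (image (Inl :: 'a \<Rightarrow> 'a + 'b)) (edges_on M S')" by (rule inj_onI) (simp add: inj_image_eq_iff)
      moreover have "inj_on ed ?J" using inj by (rule inj_on_subset) auto
      moreover have "image Inl ` edges_on M S' \<inter> ed ` ?J = {}"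
      proof (rule equals0I)
        fix d assume "d \<in> image Inl ` edges_on M S' \<inter> ed ` ?J"
        then obtain e i where "i \<in> I" "ed i = Inl ` e" "e \<subseteq> S'" by (auto simp: edges_on_def)
        then show False using ed(3)[of i] that by auto
      qed
      ultimately show ?thesis
        using finite_edges_on[OF f(1)] fin by (subst card_Un_disjoint) (simp_all add: card_image)
    qed
    ultimately show ?thesis using f by (simp add: delta_def card_Plus algebra_simps)
  qed
  have mono: "card {i \<in> I. ed i \<subseteq> S' <+> N'} \<le> card {i \<in> I. ed i \<subseteq> S <+> N'}" if "S' \<subseteq> S" for S' N'
    using that fin by (intro card_mono) auto
  have pos': "int m * int (card {i \<in> I. ed i \<subseteq> S' <+> N'}) \<le> int n * int (card N')"
    if "S' \<subseteq> S" "N' \<subseteq> N" for S' N'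
    using mult_left_mono[of "int (card {i \<in> I. ed i \<subseteq> S' <+> N'})" _ "int m"] mono[OF that(1), of N']
      pos[OF that(2)] by (meson int_ops(1) of_nat_0_le_iff of_nat_mono order_trans)
  have sub: "\<exists>S' N'. B = S' <+> N' \<and> S' \<subseteq> S \<and> N' \<subseteq> N" if "B \<subseteq> S <+> N" for B
    by (rule exI[of _ "Inl -` B"], rule exI[of _ "Inr -` B"]) (use that Plus_decomp[of B] in auto)
  have none: "{i \<in> I. ed i \<subseteq> S' <+> {}} = {}" if "S' \<subseteq> S" for S'
  proof (rule equals0I)
    fix i assume i: "i \<in> {i \<in> I. ed i \<subseteq> S' <+> {}}"
    moreover have "S' <+> {} \<subseteq> Inl ` S" using that by auto
    ultimately have "ed i \<subseteq> Inl ` S" by blast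
    then show False using ed(3) i by auto
  qed
  have d0: "delta m n W {} = 0"
  proof -
    have "({} :: 'a set) <+> ({} :: 'b set) = {}" by auto
    moreover have "delta m n W ({} <+> {}) = 0"
      using dW[of "{}" "{}"] none[of "{}"] delta_empty by simp
    ultimately show ?thesis by metis
  qed
  have dS: "delta m n W (Inl ` S) = dl S"
  proof -
    have "(Inl ` S :: ('a + 'b) set) = S <+> {}" by auto
    then show ?thesis using dW[of S "{}"] none[of S] by simp
  qed
  have C0: "in_C0 r m n W" unfolding in_C0_def strong_fin_def
  proof (intro conjI allI impI)
    show "uniform_hypergraph r W" unfolding uniform_hypergraph_def
    proof
      fix d assume "d \<in> edges W"
      then consider e where "e \<in> E" "e \<subseteq> S" "d = Inl ` e" | i where "i \<in> I" "d = ed i"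
        by (auto simp: W_def edges_on_def)
      then show "d \<subseteq> verts W \<and> finite d \<and> card d = r"
      proof cases
        case 1
        then show ?thesis using edge_props[of e] by (auto simp: vW card_image)
      next
        case 2
        then show ?thesis using ed(1,2)[of i] fS fin by (auto simp: vW intro: finite_subset[of _ "S <+> N"])
      qed
    qed
    show "finite (verts W)" using fS fin by (simp add: vW)
    fix B assume "{} \<subseteq> B \<and> B \<subseteq> verts W"
    then obtain S' N' where B: "B = S' <+> N'" "S' \<subseteq> S" "N' \<subseteq> N" using sub[of B] vW by auto
    have "0 \<le> dl S'" using B fS fs_subset by (intro delta_nonneg) auto
    then show "delta m n W {} \<le> delta m n W B" using dW[OF B(2,3)] pos'[OF B(2,3)] B(1) d0 by simp
  qed auto
  have emb: "embedding Inl (induced M S) W" unfolding embedding_def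
  proof (intro conjI allI impI)
    fix e assume "e \<subseteq> verts (induced M S)"
    then have e: "e \<subseteq> S" by (simp add: induced_def)
    have "Inl ` e \<notin> ed ` I"
    proof
      assume "Inl ` e \<in> ed ` I"
      then obtain i where "i \<in> I" "ed i = Inl ` e" by auto
      then show False using ed(3)[of i] e by auto
    qed
    moreover have "((Inl ` e :: ('a + 'b) set) \<in> image Inl ` edges_on M S) \<longleftrightarrow> e \<in> edges_on M S"
      by (auto simp: inj_image_eq_iff)
    ultimately show "(e \<in> edges (induced M S)) = (Inl ` e \<in> edges W)"
      by (simp add: induced_def W_def)
  qed (auto simp: induced_def vW)
  have str: "strong_fin m n W (Inl ` S) (verts W)" unfolding strong_fin_def
  proof (intro conjI allI impI)
    fix B assume B: "Inl ` S \<subseteq> B \<and> B \<subseteq> verts W"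
    then obtain S' N' where B': "B = S' <+> N'" "S' \<subseteq> S" "N' \<subseteq> N" using sub[of B] vW by auto
    then have "S' = S" using B by auto
    then show "delta m n W (Inl ` S) \<le> delta m n W B" using dS dW[of S N'] pos[of N'] B' by simp
  qed (auto simp: vW)
  obtain \<alpha> where \<alpha>: "embedding \<alpha> W M" "\<And>x. x \<in> S \<Longrightarrow> \<alpha> (Inl x) = x" "ss (\<alpha> ` verts W)"
    using embed_extension[OF S C0 emb str] by metis
  have \<alpha>i: "inj_on \<alpha> (S <+> N)" using \<alpha>(1) by (simp add: embedding_def vW)
  define \<beta> where "\<beta> v = \<alpha> (Inr v)" for v
  have cs: "case_sum id \<beta> v = \<alpha> v" if "v \<in> S <+> N" for v
    using that \<alpha>(2) by (auto simp: \<beta>_def)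
  have aI: "\<alpha> ` Inl ` B = B" if "B \<subseteq> S" for B
  proof -
    have "(\<lambda>x. \<alpha> (Inl x)) ` B = (\<lambda>x. x) ` B" using \<alpha>(2) that by (intro image_cong) auto
    then show ?thesis by (simp add: image_image)
  qed
  have im: "\<alpha> ` (S' <+> N') = S' \<union> \<beta> ` N'" if "S' \<subseteq> S" for S' N'
  proof -
    have "\<alpha> ` Inl ` S' = S'" using aI that .
    then show ?thesis by (auto simp: Plus_def image_Un \<beta>_def)
  qed
  show ?thesis
  proof (rule that[of \<beta>])
    show "inj_on \<beta> N"
      by (rule inj_onI) (use \<alpha>i in \<open>auto simp: \<beta>_def dest: inj_onD\<close>)
    show "\<beta> ` N \<inter> S = {}"
    proof (rule equals0I)
      fix x assume "x \<in> \<beta> ` N \<inter> S"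
      then obtain v where "v \<in> N" "\<alpha> (Inr v) = \<alpha> (Inl x)" "x \<in> S" using \<alpha>(2) by (auto simp: \<beta>_def)
      then show False using inj_onD[OF \<alpha>i, of "Inr v" "Inl x"] by auto
    qed
    show "ss (S \<union> \<beta> ` N)" using \<alpha>(3) im[of S N] by (simp add: vW)
    show "dl (S' \<union> \<beta> ` N') =
       dl S' + int n * int (card N') - int m * int (card {i \<in> I. ed i \<subseteq> S' <+> N'})"
      if "S' \<subseteq> S" "N' \<subseteq> N" for S' N'
    proof -
      have "S' <+> N' \<subseteq> verts W" using that by (auto simp: vW)
      then show ?thesis using embedding_delta[OF \<alpha>(1), of "S' <+> N'" m n] dW[OF that] im[OF that(1)] by simp
    qed
    show "e \<in> E \<longleftrightarrow> (e \<in> E \<and> e \<subseteq> S) \<or> (\<exists>i\<in>I. e = case_sum id \<beta> ` ed i)" if e: "e \<subseteq> S \<union> \<beta> ` N" for e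
    proof -
      have "e \<subseteq> \<alpha> ` (S <+> N)" using e im[of S N] by simp
      then obtain d where d: "d \<subseteq> S <+> N" "e = \<alpha> ` d" by (auto simp: subset_image_iff)
      have "e \<in> E \<longleftrightarrow> d \<in> edges W" using \<alpha>(1) d by (simp add: embedding_def vW)
      also have "\<dots> \<longleftrightarrow> (\<exists>e'. e' \<in> E \<and> e' \<subseteq> S \<and> d = Inl ` e') \<or> (\<exists>i\<in>I. d = ed i)"
        by (auto simp: W_def edges_on_def)
      also have "(\<exists>e'. e' \<in> E \<and> e' \<subseteq> S \<and> d = Inl ` e') \<longleftrightarrow> e \<in> E \<and> e \<subseteq> S"
      proof
        assume "\<exists>e'. e' \<in> E \<and> e' \<subseteq> S \<and> d = Inl ` e'"
        then obtain e' where "e' \<in> E" "e' \<subseteq> S" "d = Inl ` e'" by auto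
        moreover from this have "e = e'" using d(2) aI[of e'] by simp
        ultimately show "e \<in> E \<and> e \<subseteq> S" by simp
      next
        assume es: "e \<in> E \<and> e \<subseteq> S"
        then have "\<alpha> ` Inl ` e = \<alpha> ` d" using aI[of e] d(2) by simp
        moreover have "Inl ` e \<subseteq> S <+> N" using es by auto
        ultimately have "Inl ` e = d" using inj_on_image_eq_iff[OF \<alpha>i _ d(1)] by simp
        then show "\<exists>e'. e' \<in> E \<and> e' \<subseteq> S \<and> d = Inl ` e'" using es by auto
      qed
      also have "(\<exists>i\<in>I. d = ed i) \<longleftrightarrow> (\<exists>i\<in>I. e = case_sum id \<beta> ` ed i)"
      proof (rule bex_cong[OF refl])
        fix i assume i: "i \<in> I"
        have "case_sum id \<beta> ` ed i = \<alpha> ` ed i" using ed(1)[OF i] cs by (intro image_cong) auto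
        then show "(d = ed i) = (e = case_sum id \<beta> ` ed i)"
          using inj_on_image_eq_iff[OF \<alpha>i d(1) ed(1)[OF i]] d(2) by simp
      qed
      finally show ?thesis .
    qed
  qed
qed

lemma ss_empty: "ss {}"
  using delta_nonneg delta_empty by (simp add: ss_def)

text \<open>A second copy of \<open>Y\<close> over \<open>A\<close> is freely amalgamated with \<open>S\<close>, and a path of \<open>t\<close> new vertices is
  added. The vertex \<open>q j\<close> lies on \<open>l j\<close> hyperedges \<open>D \<union> {q j, nb j i}\<close>, where the neighbour \<open>nb j i\<close>
  is in \<open>S\<close>, in the copy, or an earlier vertex of the path. The fixed set \<open>D\<close> of \<open>r - 2\<close> vertices
  makes hyperedges behave like the edges of a graph.\<close>

lemma extend_by_copy_and_path:
  fixes t :: nat and l :: "nat \<Rightarrow> nat" and nb :: "nat \<Rightarrow> nat \<Rightarrow> 'a + ('a + nat)"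
  assumes S: "ss S" and Y: "ss Y" and A: "A \<subseteq> S" "A \<subseteq> Y"
    and D: "D \<subseteq> S" "0 < t \<Longrightarrow> card D = r - 2"
    and nb: "\<And>j i. j < t \<Longrightarrow> i < l j \<Longrightarrow> nb j i \<in> (S - D) <+> ((Y - A) <+> {..<j})"
    and nb_inj: "\<And>j. j < t \<Longrightarrow> inj_on (nb j) {..<l j}"
    and pos: "\<And>Y' Q. Y' \<subseteq> Y - A \<Longrightarrow> Q \<subseteq> {..<t} \<Longrightarrow> 0 \<le> dl (A \<union> Y') - dl A +
      (\<Sum>j\<in>Q. int n - int m * int (card {i. i < l j \<and> nb j i \<in> S <+> (Y' <+> Q)}))"
  obtains f :: "'a \<Rightarrow> 'a" and q :: "nat \<Rightarrow> 'a" where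
    "\<And>x. x \<in> A \<Longrightarrow> f x = x" "iso f Y" "f ` (Y - A) \<inter> S = {}" "ss (S \<union> f ` (Y - A) \<union> q ` {..<t})"
    "inj_on q {..<t}" "q ` {..<t} \<inter> (S \<union> f ` (Y - A)) = {}"
    "\<And>S' Y' Q. A \<union> D \<subseteq> S' \<Longrightarrow> S' \<subseteq> S \<Longrightarrow> Y' \<subseteq> Y - A \<Longrightarrow> Q \<subseteq> {..<t} \<Longrightarrow>
      dl (S' \<union> f ` Y' \<union> q ` Q) = dl S' + (dl (A \<union> Y') - dl A) +
        (\<Sum>j\<in>Q. int n - int m * int (card {i. i < l j \<and> nb j i \<in> S' <+> (Y' <+> Q)}))"
proof -
  define cp :: "'a \<Rightarrow> 'a + ('a + nat)" where "cp v = (if v \<in> A then Inl v else Inr (Inl v))" for v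
  define ed :: "'a set + nat \<times> nat \<Rightarrow> ('a + ('a + nat)) set" where
    "ed = case_sum (image cp) (\<lambda>(j, i). insert (Inr (Inr j)) (insert (nb j i) (Inl ` D)))"
  define I where "I = Inl ` {e \<in> E. e \<subseteq> Y \<and> \<not> e \<subseteq> A} \<union> Inr ` (SIGMA j:{..<t}. {..<l j})"
  define N where "N = (Y - A) <+> {..<t}"
  have fin: "finite S" "finite Y" "finite A" "finite D" using S Y A D(1)
    by (auto simp: ss_def fs_def intro: finite_subset)
  have fN: "finite N" using fin by (simp add: N_def)
  have fE: "finite {e \<in> E. e \<subseteq> Y \<and> \<not> e \<subseteq> A}"
    by (rule finite_subset[of _ "Pow Y"]) (use fin in auto)
  have fI: "finite I" unfolding I_def using fE by simp
  have cpi: "inj cp" by (rule injI) (auto simp: cp_def split: if_splits)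
  have edL: "ed (Inl e) = cp ` e" for e by (simp add: ed_def)
  have edR: "ed (Inr (j, i)) = insert (Inr (Inr j)) (insert (nb j i) (Inl ` D))" for j i
    by (simp add: ed_def)
  have Icases: "(\<And>e. x = Inl e \<Longrightarrow> e \<in> E \<Longrightarrow> e \<subseteq> Y \<Longrightarrow> \<not> e \<subseteq> A \<Longrightarrow> P) \<Longrightarrow>
      (\<And>j i. x = Inr (j, i) \<Longrightarrow> j < t \<Longrightarrow> i < l j \<Longrightarrow> P) \<Longrightarrow> P" if "x \<in> I" for x P
    using that unfolding I_def by auto
  have nbD: "nb j i \<notin> Inl ` D" "nb j i \<noteq> Inr (Inr j)" "nb j i = Inr (Inr j') \<Longrightarrow> j' < j"
    "nb j i \<in> S <+> N" if "j < t" "i < l j" for j i j'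
    using nb[OF that] that by (auto simp: N_def)
  have cpY: "cp ` e \<subseteq> S <+> N" if "e \<subseteq> Y" for e using that A by (auto simp: cp_def N_def)
  have inj: "inj_on ed I"
  proof (rule inj_onI)
    fix x y assume x: "x \<in> I" and y: "y \<in> I" and xy: "ed x = ed y"
    have LR: False if "ed (Inl e) = ed (Inr (j, i))" for e j i
    proof -
      have "Inr (Inr j) \<in> cp ` e" using that edL edR by auto
      then show False by (auto simp: cp_def split: if_splits)
    qed
    show "x = y"
    proof (rule Icases[OF x]; rule Icases[OF y])
      fix e e' assume "x = Inl e" "y = Inl e'"
      then show "x = y" using xy edL inj_image_eq_iff[OF cpi] by auto
    next
      fix e j i assume "x = Inl e" "y = Inr (j, i)" then show "x = y" using LR xy by auto
    next
      fix e j i assume "x = Inr (j, i)" "y = Inl e" then show "x = y" using LR xy by metis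
    next
      fix j i j' i' assume a: "x = Inr (j, i)" "j < t" "i < l j" "y = Inr (j', i')" "j' < t" "i' < l j'"
      have eq: "insert (Inr (Inr j)) (insert (nb j i) (Inl ` D))
          = insert (Inr (Inr j')) (insert (nb j' i') (Inl ` D))" using xy a edR by simp
      \<comment> \<open>The last path vertex on a hyperedge determines \<open>j\<close>, and the remaining vertex outside \<open>D\<close> then \<open>i\<close>.\<close>
      have "Inr (Inr j) \<in> insert (Inr (Inr j')) (insert (nb j' i') (Inl ` D))" using eq by blast
      then have 1: "j = j' \<or> j < j'" using nbD(3)[OF a(5,6), of j] by auto
      have "Inr (Inr j') \<in> insert (Inr (Inr j)) (insert (nb j i) (Inl ` D))" using eq by blast
      then have "j = j' \<or> j' < j" using nbD(3)[OF a(2,3), of j'] by auto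
      then have j: "j = j'" using 1 by auto
      have "nb j i \<in> insert (Inr (Inr j')) (insert (nb j' i') (Inl ` D))" using eq by blast
      then have "nb j i = nb j i'" using nbD(1,2)[OF a(2,3)] j by auto
      then show "x = y" using inj_onD[OF nb_inj[OF a(2)], of i i'] a j by auto
    qed
  qed
  have ed1: "ed x \<subseteq> S <+> N" if "x \<in> I" for x
  proof (rule Icases[OF that])
    fix e assume "x = Inl e" "e \<subseteq> Y" then show ?thesis using cpY edL by simp
  next
    fix j i assume "x = Inr (j, i)" "j < t" "i < l j"
    then show ?thesis using nbD(4)[of j i] D(1) edR by (auto simp: N_def)
  qed
  have ed2: "card (ed x) = r" if "x \<in> I" for x
  proof (rule Icases[OF that])
    fix e assume "x = Inl e" "e \<in> E"
    then show ?thesis using edL edge_props(3)[of e] card_image[OF inj_on_subset[OF cpi]] by simp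
  next
    fix j i assume a: "x = Inr (j, i)" "j < t" "i < l j"
    have "card (Inl ` D :: ('a + ('a + nat)) set) = r - 2"
      using D(2) a by (simp add: card_image)
    then show ?thesis using a nbD(1,2)[OF a(2,3)] fin r_ge_2 unfolding a(1) edR
      by (subst card_insert_disjoint, simp, force, subst card_insert_disjoint) auto
  qed
  have ed3: "\<not> ed x \<subseteq> Inl ` S" if "x \<in> I" for x
  proof (rule Icases[OF that])
    fix e assume "x = Inl e" "\<not> e \<subseteq> A"
    then obtain v where "v \<in> e" "v \<notin> A" by auto
    then have "Inr (Inl v) \<in> cp ` e" by (force simp: cp_def)
    then show ?thesis using edL \<open>x = Inl e\<close> by auto
  qed (auto simp: edR)
  have dY: "dl (A \<union> Y') - dl A = int n * int (card Y') - int m * int (card {e \<in> E. e \<subseteq> A \<union> Y' \<and> \<not> e \<subseteq> A})"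
    if "Y' \<subseteq> Y - A" for Y'
  proof -
    have f: "finite Y'" using that fin finite_subset by auto
    have "edges_on M (A \<union> Y') = edges_on M A \<union> {e \<in> E. e \<subseteq> A \<union> Y' \<and> \<not> e \<subseteq> A}"
      by (auto simp: edges_on_def)
    moreover have "finite {e \<in> E. e \<subseteq> A \<union> Y' \<and> \<not> e \<subseteq> A}"
      by (rule finite_subset[of _ "Pow (A \<union> Y')"]) (use f fin in auto)
    moreover have "edges_on M A \<inter> {e \<in> E. e \<subseteq> A \<union> Y' \<and> \<not> e \<subseteq> A} = {}" by (auto simp: edges_on_def)
    ultimately have "card (edges_on M (A \<union> Y')) = card (edges_on M A) + card {e \<in> E. e \<subseteq> A \<union> Y' \<and> \<not> e \<subseteq> A}"
      using finite_edges_on[OF fin(3)] by (simp add: card_Un_disjoint)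
    moreover have "card (A \<union> Y') = card A + card Y'" using f fin that by (intro card_Un_disjoint) auto
    ultimately show ?thesis by (simp add: delta_def algebra_simps)
  qed
  have count: "int n * int (card (Y' <+> Q)) - int m * int (card {x \<in> I. ed x \<subseteq> S' <+> (Y' <+> Q)}) =
      (dl (A \<union> Y') - dl A) +
        (\<Sum>j\<in>Q. int n - int m * int (card {i. i < l j \<and> nb j i \<in> S' <+> (Y' <+> Q)}))"
    if h: "A \<union> D \<subseteq> S'" "S' \<subseteq> S" "Y' \<subseteq> Y - A" "Q \<subseteq> {..<t}" for S' Y' Q
  proof -
    have f: "finite Y'" "finite Q"
      using finite_subset[OF h(3)] finite_subset[OF h(4)] fin by auto
    let ?K = "\<lambda>j. {i. i < l j \<and> nb j i \<in> S' <+> (Y' <+> Q)}"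
    let ?L = "{e \<in> E. e \<subseteq> A \<union> Y' \<and> \<not> e \<subseteq> A}"
    have fL: "finite ?L" by (rule finite_subset[of _ "Pow (A \<union> Y')"]) (use f fin in auto)
    have "{x \<in> I. ed x \<subseteq> S' <+> (Y' <+> Q)} = Inl ` ?L \<union> Inr ` (SIGMA j:Q. ?K j)"
    proof (intro equalityI subsetI)
      fix x assume x: "x \<in> {x \<in> I. ed x \<subseteq> S' <+> (Y' <+> Q)}"
      then have xI: "x \<in> I" by simp
      show "x \<in> Inl ` ?L \<union> Inr ` (SIGMA j:Q. ?K j)"
      proof (rule Icases[OF xI])
        fix e assume e: "x = Inl e" "e \<in> E" "\<not> e \<subseteq> A"
        have "e \<subseteq> A \<union> Y'"
        proof
          fix v assume v: "v \<in> e"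
          have "cp v \<in> S' <+> (Y' <+> Q)" using x e v edL by auto
          then show "v \<in> A \<union> Y'" by (auto simp: cp_def split: if_splits)
        qed
        then show ?thesis using e by auto
      next
        fix j i assume a: "x = Inr (j, i)" "j < t" "i < l j"
        then have "Inr (Inr j) \<in> S' <+> (Y' <+> Q)" "nb j i \<in> S' <+> (Y' <+> Q)" using x edR by auto
        then show ?thesis using a by auto
      qed
    next
      fix x assume "x \<in> Inl ` ?L \<union> Inr ` (SIGMA j:Q. ?K j)"
      then show "x \<in> {x \<in> I. ed x \<subseteq> S' <+> (Y' <+> Q)}"
      proof (elim UnE imageE SigmaE)
        fix e assume e: "x = Inl e" "e \<in> ?L"
        have "cp v \<in> S' <+> (Y' <+> Q)" if "v \<in> e" for v using that e h by (auto simp: cp_def)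
        moreover have "e \<subseteq> Y" using e h A by auto
        ultimately show ?thesis using e edL by (auto simp: I_def)
      next
        fix y j i assume "x = Inr y" "j \<in> Q" "i \<in> ?K j" "y = (j, i)"
        then show ?thesis using h by (auto simp: I_def edR)
      qed
    qed
    moreover have "card (Inl ` ?L \<union> Inr ` (SIGMA j:Q. ?K j)) = card ?L + (\<Sum>j\<in>Q. card (?K j))"
    proof -
      have "card (Inl ` ?L \<union> Inr ` (SIGMA j:Q. ?K j)) =
          card (Inl ` ?L :: ('a set + nat \<times> nat) set) +
          card (Inr ` (SIGMA j:Q. ?K j) :: ('a set + nat \<times> nat) set)"
        using fL f by (intro card_Un_disjoint) auto
      then show ?thesis using f by (simp add: card_image)
    qed
    moreover have "(\<Sum>j\<in>Q. int n - int m * int (card (?K j)))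
        = int n * int (card Q) - int m * int (\<Sum>j\<in>Q. card (?K j))"
      by (simp add: sum_subtractf sum_distrib_left)
    ultimately show ?thesis using dY[OF h(3)] f by (simp add: card_Plus algebra_simps)
  qed
  have pos2: "int m * int (card {i \<in> I. ed i \<subseteq> S <+> N'}) \<le> int n * int (card N')" if "N' \<subseteq> N" for N'
  proof -
    have N': "N' = (Inl -` N') <+> (Inr -` N')" by (rule Plus_decomp)
    have "Inl -` N' \<subseteq> Y - A" "Inr -` N' \<subseteq> {..<t}" using that by (auto simp: N_def)
    from pos[OF this] count[OF _ order_refl this] A D(1)
    show ?thesis by (subst (1 2) N') simp
  qed
  obtain \<beta> :: "'a + nat \<Rightarrow> 'a" where \<beta>: "inj_on \<beta> N" "\<beta> ` N \<inter> S = {}" "ss (S \<union> \<beta> ` N)"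
    "\<And>e. e \<subseteq> S \<union> \<beta> ` N \<Longrightarrow> e \<in> E \<longleftrightarrow> (e \<in> E \<and> e \<subseteq> S) \<or> (\<exists>i\<in>I. e = case_sum id \<beta> ` ed i)"
    "\<And>S' N'. S' \<subseteq> S \<Longrightarrow> N' \<subseteq> N \<Longrightarrow> dl (S' \<union> \<beta> ` N') =
       dl S' + int n * int (card N') - int m * int (card {i \<in> I. ed i \<subseteq> S' <+> N'})"
    apply (rule extend_by_vertices[OF S fN fI inj ed1 ed2 ed3 pos2])
        apply (assumption)+
    subgoal premises p by (rule that[OF p(2-6)])
    done
  define f where "f v = case_sum id \<beta> (cp v)" for v
  define q where "q j = \<beta> (Inr j)" for j
  have fA: "f x = x" if "x \<in> A" for x using that by (simp add: f_def cp_def)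
  have fY: "f x = \<beta> (Inl x)" if "x \<notin> A" for x using that by (simp add: f_def cp_def)
  have im: "\<beta> ` (Y' <+> Q) = f ` Y' \<union> q ` Q" if "Y' \<subseteq> Y - A" for Y' Q
  proof -
    have "f ` Y' = \<beta> ` Inl ` Y'" unfolding image_image using that fY by (intro image_cong) auto
    then show ?thesis by (simp add: Plus_def image_Un q_def image_image)
  qed
  have imN: "\<beta> ` N = f ` (Y - A) \<union> q ` {..<t}" using im[of "Y - A"] by (simp add: N_def)
  have new: "f x \<notin> S" if "x \<in> Y - A" for x
  proof -
    have "Inl x \<in> N" using that by (auto simp: N_def)
    then show ?thesis using \<beta>(2) fY[of x] that by auto
  qed
  have fi: "inj_on f Y"
  proof (rule inj_onI)
    fix x y assume xy: "x \<in> Y" "y \<in> Y" "f x = f y"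
    show "x = y"
    proof (cases "x \<in> A"; cases "y \<in> A")
      assume "x \<notin> A" "y \<notin> A"
      then show ?thesis using xy inj_onD[OF \<beta>(1), of "Inl x" "Inl y"] fY by (auto simp: N_def)
    next
      assume "x \<in> A" "y \<notin> A" then show ?thesis using new[of y] xy fA[of x] A by auto
    next
      assume "x \<notin> A" "y \<in> A" then show ?thesis using new[of x] xy fA[of y] A by auto
    qed (use xy fA in auto)
  qed
  have qN: "q j \<notin> S \<union> f ` Y" if "j < t" for j
  proof
    assume "q j \<in> S \<union> f ` Y"
    moreover have "Inr j \<in> N" using that by (auto simp: N_def)
    then have "q j \<notin> S" using \<beta>(2) by (auto simp: q_def)
    ultimately obtain x where x: "x \<in> Y" "q j = f x" by auto
    have "x \<notin> A" using x fA A \<open>q j \<notin> S\<close> by auto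
    then show False
      using x inj_onD[OF \<beta>(1), of "Inr j" "Inl x"] fY \<open>Inr j \<in> N\<close> by (auto simp: q_def N_def)
  qed
  have iso: "iso f Y" unfolding iso_def
  proof (intro conjI allI impI)
    show "inj_on f Y" by (rule fi)
    fix e assume e: "e \<subseteq> Y"
    have fe: "f ` e \<subseteq> S \<union> \<beta> ` N"
    proof (rule image_subsetI)
      fix v assume "v \<in> e"
      then show "f v \<in> S \<union> \<beta> ` N" using e imN fA[of v] A by (cases "v \<in> A") auto
    qed
    show "(f ` e \<in> E) = (e \<in> E)"
    proof (cases "e \<subseteq> A")
      case True
      then have "f ` e = (\<lambda>x. x) ` e" using fA by (intro image_cong) auto
      then show ?thesis by simp
    next
      case False
      then obtain v where v: "v \<in> e" "v \<notin> A" by auto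
      then have "\<not> f ` e \<subseteq> S" using new e by auto
      then have "f ` e \<in> E \<longleftrightarrow> (\<exists>x\<in>I. f ` e = case_sum id \<beta> ` ed x)" using \<beta>(4)[OF fe] by auto
      also have "\<dots> \<longleftrightarrow> e \<in> E"
      proof
        assume "\<exists>x\<in>I. f ` e = case_sum id \<beta> ` ed x"
        then obtain x where x: "x \<in> I" "f ` e = case_sum id \<beta> ` ed x" by auto
        show "e \<in> E"
        proof (rule Icases[OF x(1)])
          fix e' assume e': "x = Inl e'" "e' \<in> E" "e' \<subseteq> Y"
          then have "f ` e = f ` e'" using x(2) by (simp add: edL image_image f_def)
          then show ?thesis using e' inj_on_image_eq_iff[OF fi e e'(3)] by simp
        next
          fix j i assume a: "x = Inr (j, i)" "j < t"
          then have "q j \<in> f ` e" using x(2) by (auto simp: edR q_def)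
          then show ?thesis using qN[OF a(2)] e by auto
        qed
      next
        assume "e \<in> E"
        then have "Inl e \<in> I" using e False by (auto simp: I_def)
        moreover have "f ` e = case_sum id \<beta> ` ed (Inl e)" by (simp add: edL image_image f_def)
        ultimately show "\<exists>x\<in>I. f ` e = case_sum id \<beta> ` ed x" by blast
      qed
      finally show ?thesis .
    qed
  qed
  show ?thesis
  proof (rule that[of f q])
    show "ss (S \<union> f ` (Y - A) \<union> q ` {..<t})" using \<beta>(3) imN by (simp add: Un_assoc)
    show "f ` (Y - A) \<inter> S = {}" using new by auto
    show "inj_on q {..<t}"
    proof (rule inj_onI)
      fix i j assume "i \<in> {..<t}" "j \<in> {..<t}" "q i = q j"
      then show "i = j" using inj_onD[OF \<beta>(1), of "Inr i" "Inr j"] by (auto simp: N_def q_def)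
    qed
    show "q ` {..<t} \<inter> (S \<union> f ` (Y - A)) = {}" using qN by auto
    fix S' Y' Q assume h: "A \<union> D \<subseteq> S'" "S' \<subseteq> S" "Y' \<subseteq> Y - A" "Q \<subseteq> {..<t}"
    have "dl (S' \<union> \<beta> ` (Y' <+> Q)) = dl S' + int n * int (card (Y' <+> Q)) -
        int m * int (card {i \<in> I. ed i \<subseteq> S' <+> (Y' <+> Q)})"
      using h by (intro \<beta>(5)) (auto simp: N_def)
    then show "dl (S' \<union> f ` Y' \<union> q ` Q) = dl S' + (dl (A \<union> Y') - dl A) +
        (\<Sum>j\<in>Q. int n - int m * int (card {i. i < l j \<and> nb j i \<in> S' <+> (Y' <+> Q)}))"
      using count[OF h] im[OF h(3), of Q] by (simp add: Un_assoc)
  qed (use fA iso in auto)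
qed

end

context hrushovski_generic
begin

lemma dm_ge:
  assumes "ss W" "X \<subseteq> W" "\<And>T. X \<subseteq> T \<Longrightarrow> T \<subseteq> W \<Longrightarrow> k \<le> dl T" shows "k \<le> dm X"
proof -
  have "fs X" using assms fs_subset ss_fs by blast
  then obtain B where B: "ss B" "X \<subseteq> B" "dl B = dm X" by (rule dm_attained)
  have "k \<le> dl (B \<inter> W)" using assms(2) B(2) by (intro assms(3)) auto
  also have "\<dots> \<le> dl B" using ss_cut[OF assms(1) ss_fs[OF B(1)]] .
  finally show ?thesis using B by simp
qed

text \<open>Before two sets are amalgamated over \<open>cl A\<close>, both are enlarged inside \<open>cl A\<close> until they have the
  same intersection with it.\<close>

lemma ss_covers_common_closure:
  assumes "fs A" "ss S0" "A \<subseteq> S0" "ss Y0" "A \<subseteq> Y0"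
  obtains C where "ss C" "A \<subseteq> C" "C \<subseteq> cl A" "dl C = dm A" "ss (S0 \<union> C)" "dl (S0 \<union> C) = dl S0"
    "(S0 \<union> C) \<inter> cl A = C" "ss (Y0 \<union> C)" "dl (Y0 \<union> C) = dl Y0" "(Y0 \<union> C) \<inter> cl A = C"
proof -
  have fin: "finite ((S0 \<union> Y0) \<inter> cl A)"
    using assms(2,4) by (auto simp: ss_def fs_def)
  have sub: "(S0 \<union> Y0) \<inter> cl A \<subseteq> cl A" by auto
  obtain C where C: "ss C" "A \<union> ((S0 \<union> Y0) \<inter> cl A) \<subseteq> C" "dl C = dm A" "C \<subseteq> cl A"
    by (rule cl_ss_cover[OF assms(1) fin sub])
  then have "A \<subseteq> C" by auto
  note a = absorb_union[OF assms(2) C(1) assms(3) \<open>A \<subseteq> C\<close> C(3)]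
  note b = absorb_union[OF assms(4) C(1) assms(5) \<open>A \<subseteq> C\<close> C(3)]
  show ?thesis
    by (rule that[of C]) (use a b C \<open>A \<subseteq> C\<close> in auto)
qed

text \<open>A free amalgam over a common finite part \<open>C\<close> of \<open>cl A\<close> is realized in the generic structure; by
  homogeneity the copy is conjugate to the original over all of \<open>cl A\<close>.\<close>

lemma independent_copy:
  assumes "fs A" "fs X" "fs B"
  obtains p where "p \<in> Stab A" "ind A (p ` X) B"
proof -
  obtain S0 where S0: "ss S0" "A \<union> B \<subseteq> S0" using dm_attained[of "A \<union> B"] assms by (metis fs_simps(2))
  obtain Y0 where Y0: "ss Y0" "A \<union> X \<subseteq> Y0" using dm_attained[of "A \<union> X"] assms by (metis fs_simps(2))
  have AS: "A \<subseteq> S0" "A \<subseteq> Y0" using S0 Y0 by auto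
  obtain C where C: "ss C" "A \<subseteq> C" "C \<subseteq> cl A" "dl C = dm A" and S: "ss (S0 \<union> C)"
    and Y: "ss (Y0 \<union> C)" "(Y0 \<union> C) \<inter> cl A = C"
    by (rule ss_covers_common_closure[OF assms(1) S0(1) AS(1) Y0(1) AS(2)])
  define S where "S = S0 \<union> C"
  define Y where "Y = Y0 \<union> C"
  have SY: "ss S" "ss Y" "C \<subseteq> S" "C \<subseteq> Y" using S Y by (auto simp: S_def Y_def)
  have pos: "0 \<le> dl (C \<union> Y') - dl C + (\<Sum>j\<in>Q. int n - int m * int (card {i. i < (0::nat) \<and> undefined j i \<in> S <+> (Y' <+> Q)}))"
    if "Y' \<subseteq> Y - C" "Q \<subseteq> {..<(0::nat)}" for Y' Q
  proof -
    have "fs (C \<union> Y')" using that SY(4) by (intro fs_subset[OF ss_fs[OF SY(2)]]) auto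
    then have "dl C \<le> dl (C \<union> Y')" by (intro ss_le[OF C(1)]) auto
    then show ?thesis using that by simp
  qed
  obtain f :: "'a \<Rightarrow> 'a" and q :: "nat \<Rightarrow> 'a" where f: "\<And>x. x \<in> C \<Longrightarrow> f x = x" "iso f Y"
      "ss (S \<union> f ` (Y - C) \<union> q ` {..<0})"
      "\<And>S' Y' Q. C \<union> {} \<subseteq> S' \<Longrightarrow> S' \<subseteq> S \<Longrightarrow> Y' \<subseteq> Y - C \<Longrightarrow> Q \<subseteq> {..<0} \<Longrightarrow>
      dl (S' \<union> f ` Y' \<union> q ` Q) = dl S' + (dl (C \<union> Y') - dl C) +
        (\<Sum>j\<in>Q. int n - int m * int (card {i. i < (0::nat) \<and> undefined j i \<in> S' <+> (Y' <+> Q)}))"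
    \<comment> \<open>A path of length zero: only the copy is added.\<close>
    apply (rule extend_by_copy_and_path[where t = 0 and l = "\<lambda>_. 0" and nb = undefined, OF SY empty_subsetI])
        apply (simp, simp, simp)
     apply (rule pos; assumption)
    subgoal premises p for f q by (rule p(1)[OF p(2,3,5,8)])
    done
  have dT: "dl (S' \<union> f ` (Y - C)) = dl S' + dl Y - dl C" if "C \<subseteq> S'" "S' \<subseteq> S" for S'
    using f(4)[of S' "Y - C" "{}"] that SY(4) by (simp add: Un_absorb1)
  have W: "ss (S \<union> f ` (Y - C))" using f(3) by simp
  have fY: "f ` Y = C \<union> f ` (Y - C)"
  proof -
    have "f ` C = (\<lambda>x. x) ` C" using f(1) by (intro image_cong) auto
    moreover have "f ` Y = f ` C \<union> f ` (Y - C)" using SY(4) by auto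
    ultimately show ?thesis by simp
  qed
  have fYs: "ss (f ` Y)"
  proof (rule ss_subI[OF W])
    show "f ` Y \<subseteq> S \<union> f ` (Y - C)" using fY SY by auto
    fix T assume T: "f ` Y \<subseteq> T" "T \<subseteq> S \<union> f ` (Y - C)"
    have "T = (T \<inter> S) \<union> f ` (Y - C)" using T fY by auto
    moreover have "C \<subseteq> T \<inter> S" using T fY SY by auto
    moreover from this have "dl C \<le> dl (T \<inter> S)"
      using SY fs_subset[OF ss_fs[OF SY(1)]] by (intro ss_le[OF C(1)]) auto
    ultimately show "dl (f ` Y) \<le> dl T" using dT[of "T \<inter> S"] iso_delta[OF f(2)] by simp
  qed
  have fid: "f y = y" if "y \<in> Y \<inter> cl A" for y using that Y(2) f(1) by (auto simp: Y_def)
  have AY: "A \<subseteq> Y" using C SY by auto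
  obtain p where p: "p \<in> Stab A" "\<And>y. y \<in> Y \<Longrightarrow> p y = f y"
    using homogeneity[OF assms(1) SY(2) AY f(2) fYs fid] by metis
  have pX: "p ` X \<subseteq> f ` Y" using p(2) Y0(2) by (auto simp: Y_def image_iff)
  have fsfY: "fs (f ` Y)" "fs S" using fYs SY ss_fs by auto
  have "ind A (f ` Y) S"
  proof -
    have "dm A = dl C" using C by simp
    moreover have "A \<union> f ` Y = f ` Y" "A \<union> S = S" using fY C SY by auto
    moreover have "A \<union> f ` Y \<union> S = S \<union> f ` (Y - C)" using fY C SY by auto
    moreover have "dm (f ` Y) = dl Y" "dm S = dl S" using fYs SY dm_ss iso_delta[OF f(2)] by auto
    moreover have "dm (S \<union> f ` (Y - C)) = dl S + dl Y - dl C" using W dm_ss dT[of S] SY by simp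
    ultimately show ?thesis by (simp add: ind_def)
  qed
  then have "ind A (f ` Y) B"
    by (rule ind_mono) (use S0 assms fsfY in \<open>auto simp: S_def\<close>)
  then have "ind A B (f ` Y)" by (simp add: ind_sym)
  then have "ind A B (p ` X)" by (rule ind_mono) (use assms fsfY pX in auto)
  then show ?thesis using that p(1) by (simp add: ind_sym)
qed

text \<open>The new vertices with their hyperedge have predimension \<open>(r - 1) * n - m\<close> over \<open>S\<close>, which is
  positive.\<close>

lemma add_edge:
  assumes "ss S" "y \<in> S"
  obtains N where "finite N" "card N = r - 1" "N \<inter> S = {}" "ss (S \<union> N)" "insert y N \<in> E"
    "\<And>e. e \<in> E \<Longrightarrow> e \<subseteq> S \<union> N \<Longrightarrow> e \<subseteq> S \<or> e = insert y N"
    "\<And>S' N'. S' \<subseteq> S \<Longrightarrow> N' \<subseteq> N \<Longrightarrow> dl (S' \<union> N') =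
       dl S' + int n * int (card N') - (if y \<in> S' \<and> N' = N then int m else 0)"
proof -
  let ?N = "{..<r - 1}" and ?ed = "\<lambda>_::unit. insert (Inl y) (Inr ` {..<r - 1}) :: ('a + nat) set"
  have ne: "?N \<noteq> {}" using r_ge_2 by (simp add: lessThan_empty_iff)
  have sub: "?ed i \<subseteq> S' <+> N' \<longleftrightarrow> y \<in> S' \<and> N' = ?N" if "N' \<subseteq> ?N" for i S' N'
    using that by auto
  have cnt: "{i \<in> UNIV. ?ed i \<subseteq> S' <+> N'} = (if y \<in> S' \<and> N' = ?N then UNIV else {})"
    if "N' \<subseteq> ?N" for S' N' using sub[OF that] by auto
  have 1: "finite ?N" "finite (UNIV :: unit set)" "inj_on ?ed UNIV" by (auto simp: inj_on_def)
  have 2: "?ed i \<subseteq> S <+> ?N" for i using assms by auto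
  have 3: "card (?ed i) = r" for i
    using r_ge_2 by (subst card_insert_disjoint) (auto simp: card_image)
  have 4: "\<not> ?ed i \<subseteq> Inl ` S" for i using ne by auto
  have 5: "int m * int (card {i \<in> UNIV. ?ed i \<subseteq> S <+> N'}) \<le> int n * int (card N')"
    if "N' \<subseteq> ?N" for N'
  proof (cases "N' = ?N")
    case True
    have "m \<le> n * (r - 1)" using edge_positive by (simp add: mult.commute)
    then have "int m \<le> int (n * (r - 1))" by (simp only: of_nat_le_iff)
    moreover have "int m * int (card {i \<in> UNIV. ?ed i \<subseteq> S <+> N'}) = int m"
      unfolding cnt[OF that] using True assms by simp
    moreover have "int n * int (card N') = int (n * (r - 1))" by (simp only: True card_lessThan of_nat_mult)
    ultimately show ?thesis by linarith
  qed (simp only: cnt[OF that], simp)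
  obtain \<beta> :: "nat \<Rightarrow> 'a" where b: "inj_on \<beta> ?N" "\<beta> ` ?N \<inter> S = {}" "ss (S \<union> \<beta> ` ?N)"
    "\<And>e. e \<subseteq> S \<union> \<beta> ` ?N \<Longrightarrow> e \<in> E \<longleftrightarrow> (e \<in> E \<and> e \<subseteq> S) \<or> (\<exists>i\<in>UNIV. e = case_sum id \<beta> ` ?ed i)"
    "\<And>S' N'. S' \<subseteq> S \<Longrightarrow> N' \<subseteq> ?N \<Longrightarrow> dl (S' \<union> \<beta> ` N') =
       dl S' + int n * int (card N') - int m * int (card {i \<in> UNIV. ?ed i \<subseteq> S' <+> N'})"
    apply (rule extend_by_vertices[OF assms(1) 1 2 3 4 5])
        apply assumption
    subgoal premises p by (rule that[OF p(2-6)])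
    done
  have im: "case_sum id \<beta> ` ?ed i = insert y (\<beta> ` ?N)" for i by (simp add: image_image)
  show ?thesis
  proof (rule that[of "\<beta> ` ?N"])
    show "finite (\<beta> ` ?N)" "\<beta> ` ?N \<inter> S = {}" "ss (S \<union> \<beta> ` ?N)" using b by auto
    show "card (\<beta> ` ?N) = r - 1" using b(1) by (simp add: card_image)
    have "insert y (\<beta> ` ?N) \<subseteq> S \<union> \<beta> ` ?N" using assms by auto
    then show "insert y (\<beta> ` ?N) \<in> E" using b(4)[of "insert y (\<beta> ` ?N)"] im by simp
    show "e \<subseteq> S \<or> e = insert y (\<beta> ` ?N)" if "e \<in> E" "e \<subseteq> S \<union> \<beta> ` ?N" for e
      using b(4)[OF that(2)] that(1) im by simp
    show "dl (S' \<union> N') = dl S' + int n * int (card N') - (if y \<in> S' \<and> N' = \<beta> ` ?N then int m else 0)"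
      if h: "S' \<subseteq> S" "N' \<subseteq> \<beta> ` ?N" for S' N'
    proof -
      obtain K where K: "K \<subseteq> ?N" "N' = \<beta> ` K" using h(2) by (auto simp: subset_image_iff)
      have c: "card N' = card K" using K b(1) by (simp add: card_image inj_on_subset)
      have "N' = \<beta> ` ?N \<longleftrightarrow> K = ?N" using K inj_on_image_eq_iff[OF b(1) K(1)] by simp
      then show ?thesis using b(5)[OF h(1) K(1)] unfolding cnt[OF K(1)] using c by (simp add: K(2))
    qed
  qed
qed

section \<open>Elements of dimension one\<close>

text \<open>Isolated new vertices.\<close>

lemma enlarge:
  assumes "fs A" obtains B where "fs B" "A \<subseteq> B" "(k::nat) \<le> card B"
proof -
  obtain S where S: "ss S" "A \<subseteq> S" using dm_attained assms by blast
  obtain \<beta> :: "nat \<Rightarrow> 'a" where b: "inj_on \<beta> {..<k}" "ss (S \<union> \<beta> ` {..<k})"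
    by (rule extend_by_vertices[OF S(1), of "{..<k}" "{}" "\<lambda>_::unit. {}"]) simp_all
  have "k = card (\<beta> ` {..<k})" using b(1) by (simp add: card_image)
  also have "\<dots> \<le> card (S \<union> \<beta> ` {..<k})" using b(2) by (intro card_mono) (auto simp: ss_def fs_def)
  finally have "k \<le> card (S \<union> \<beta> ` {..<k})" .
  then show ?thesis using S by (intro that[OF ss_fs[OF b(2)]]) auto
qed

text \<open>A vertex of a path needs at most \<open>n + m\<close> neighbours, besides the \<open>r - 2\<close> vertices that complete
  its hyperedges.\<close>

lemma attachment_points:
  assumes "fs A" "r + n + m \<le> card A"
  obtains D c where "D \<subseteq> A" "card D = r - 2" "inj_on c {..n + m}"
    "c ` {..n + m} \<subseteq> A - D"
proof -
  obtain D where D: "D \<subseteq> A" "card D = r - 2" "finite D"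
    using obtain_subset_with_card_n[of "r - 2" A] assms(2) by (metis diff_le_self add.assoc le_trans le_add1)
  have "card (A - D) = card A - (r - 2)" using D by (simp add: card_Diff_subset)
  then have k: "n + m < card (A - D)" using assms(2) r_ge_2 by linarith
  have "finite (A - D)" using assms fs_finite by simp
  then obtain c where c: "bij_betw c {0..<card (A - D)} (A - D)"
    using ex_bij_betw_nat_finite by blast
  show ?thesis
  proof (rule that[of D c])
    show "inj_on c {..n + m}"
      using bij_betw_imp_inj_on[OF c] by (rule inj_on_subset) (use k in auto)
    show "c ` {..n + m} \<subseteq> A - D" using bij_betwE[OF c] k by auto
  qed (use D in auto)
qed

lemma weight_missing: "c = L - a - b \<Longrightarrow> (N::int) - k * c = (N - k * L) + k * a + k * b"
  by (hypsubst, simp add: algebra_simps)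

text \<open>The last vertex of a path over \<open>A\<close> along which the predimension runs from zero to one.\<close>

lemma exists_dim_one:
  assumes A: "fs A" "r + n + m \<le> card A"
  obtains y where "y \<in> V" "dm (insert y A) = dm A + 1"
proof -
  obtain S where S: "ss S" "A \<subseteq> S" "dl S = dm A" using dm_attained[OF A(1)] by metis
  obtain D c where D: "D \<subseteq> A" "card D = r - 2" and c0: "inj_on c {..n + m}"
      "c ` {..n + m} \<subseteq> A - D"
    by (rule attachment_points[OF A])
  have c: "inj_on c {..n + m}" "\<And>i. i \<le> n + m \<Longrightarrow> c i \<in> A - D" using c0 by auto
  obtain t s l where t: "0 < t" "s 0 = 0" "s t = 1" "\<And>j. j < t \<Longrightarrow> s j \<le> int m"
      "\<And>j. 0 < j \<Longrightarrow> j < t \<Longrightarrow> 1 \<le> s j"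
      "\<And>j. j < t \<Longrightarrow> int n - int m * int (l j) = s (Suc j) - s j"
      "\<And>j. j < t \<Longrightarrow> l j \<le> n + m" "\<And>j. j < t \<Longrightarrow> 1 \<le> s j \<Longrightarrow> 1 \<le> l j"
    by (rule path_numbers[of m n 0 1]) (use coprime_mn m_pos m_le_n in \<open>auto simp: coprime_commute\<close>)
  define nb :: "nat \<Rightarrow> nat \<Rightarrow> 'a + ('a + nat)" where
    "nb j i = (if i = 0 \<and> 0 < j then Inr (Inr (j - 1)) else Inl (c i))" for j i
  have cA: "c i \<in> A" "c i \<notin> D" if "i < l j" "j < t" for i j
    using c(2)[of i] t(7)[OF that(2)] that by auto
  have s0: "0 \<le> s j" if "j \<le> t" for j
    using t(5)[of j] that t(2,3) by (cases "j = 0"; cases "j = t") auto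
  have cnt: "int n - int m * int (card {i. i < l j \<and> nb j i \<in> S' <+> (Y' <+> Q)}) = path_inc (int m) s True Q j"
    if "j < t" "A \<subseteq> S'" for j S' Y' Q
  proof -
    let ?P = "\<lambda>i. nb j i \<in> S' <+> (Y' <+> Q)"
    have P0: "?P 0 \<longleftrightarrow> j = 0 \<or> j - 1 \<in> Q" using c(2)[of 0] that by (auto simp: nb_def)
    have P1: "?P 1" using c(2)[of 1] that m_pos n_pos by (auto simp: nb_def)
    have "int (card {i. i < l j \<and> ?P i}) = int (l j) - of_bool (\<not> ?P 0) - of_bool (\<not> ?P 1)"
    proof (rule card_missing)
      show "?P i" if "i < l j" "2 \<le> i" for i using cA[OF that(1) \<open>j < t\<close>] that \<open>A \<subseteq> S'\<close> by (auto simp: nb_def)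
      show "?P 0 \<or> 1 \<le> l j" using P0 t(5)[of j] t(8)[of j] \<open>j < t\<close> by auto
    qed (use P1 in auto)
    then have "int n - int m * int (card {i. i < l j \<and> ?P i}) =
        (int n - int m * int (l j)) + int m * of_bool (\<not> ?P 0) + int m * of_bool (\<not> ?P 1)"
      by (rule weight_missing)
    then show ?thesis using P1 unfolding t(6)[OF that(1)] P0 by (auto simp: path_inc_def)
  qed
  have ps: "0 \<le> (\<Sum>j\<in>Q. path_inc (int m) s True Q j)"
      "t - 1 \<in> Q \<Longrightarrow> 1 \<le> (\<Sum>j\<in>Q. path_inc (int m) s True Q j)" if "Q \<subseteq> {..<t}" for Q
    using path_sum[of t s "int m" 0 0 True t Q] t s0 that by auto
  have nbS: "nb j i \<in> (S - D) <+> (({} - {}) <+> {..<j})" if "j < t" "i < l j" for j i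
    using cA[OF that(2,1)] S(2) that by (auto simp: nb_def)
  have nbi: "inj_on (nb j) {..<l j}" if "j < t" for j
  proof (rule inj_onI)
    fix i i' assume i: "i \<in> {..<l j}" "i' \<in> {..<l j}" "nb j i = nb j i'"
    then have "i \<le> n + m" "i' \<le> n + m" using t(7)[OF that] by auto
    then show "i = i'" using i inj_onD[OF c(1), of i i'] by (auto simp: nb_def split: if_splits)
  qed
  have pos: "0 \<le> dl ({} \<union> Y') - dl {} +
      (\<Sum>j\<in>Q. int n - int m * int (card {i. i < l j \<and> nb j i \<in> S <+> (Y' <+> Q)}))"
    if "Y' \<subseteq> {} - {}" "Q \<subseteq> {..<t}" for Y' Q
  proof -
    have "(\<Sum>j\<in>Q. int n - int m * int (card {i. i < l j \<and> nb j i \<in> S <+> (Y' <+> Q)}))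
        = (\<Sum>j\<in>Q. path_inc (int m) s True Q j)" using that S by (intro sum.cong cnt) auto
    then show ?thesis using ps[OF that(2)] that by simp
  qed
  obtain f :: "'a \<Rightarrow> 'a" and q :: "nat \<Rightarrow> 'a" where
      f: "ss (S \<union> f ` ({} - {}) \<union> q ` {..<t})" "inj_on q {..<t}" "q ` {..<t} \<inter> (S \<union> f ` ({} - {})) = {}"
      "\<And>S' Y' Q. {} \<union> D \<subseteq> S' \<Longrightarrow> S' \<subseteq> S \<Longrightarrow> Y' \<subseteq> {} - {} \<Longrightarrow> Q \<subseteq> {..<t} \<Longrightarrow>
      dl (S' \<union> f ` Y' \<union> q ` Q) = dl S' + (dl ({} \<union> Y') - dl {}) +
        (\<Sum>j\<in>Q. int n - int m * int (card {i. i < l j \<and> nb j i \<in> S' <+> (Y' <+> Q)}))"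
    apply (rule extend_by_copy_and_path[OF S(1) ss_empty empty_subsetI empty_subsetI _ _ nbS nbi pos])
          apply (use D S in blast, use D in simp)
        apply assumption+
    subgoal premises p for f q by (rule p(1)[OF p(5-8)])
    done
  have W: "ss (S \<union> q ` {..<t})" using f(1) by simp
  have dT: "dl (S' \<union> q ` Q) = dl S' + (\<Sum>j\<in>Q. path_inc (int m) s True Q j)"
    if "A \<subseteq> S'" "S' \<subseteq> S" "Q \<subseteq> {..<t}" for S' Q
  proof -
    have "dl (S' \<union> q ` Q) = dl S' + (\<Sum>j\<in>Q. int n - int m * int (card {i. i < l j \<and> nb j i \<in> S' <+> ({} <+> Q)}))"
      using f(4)[of S' "{}" Q] that D by auto
    also have "(\<Sum>j\<in>Q. int n - int m * int (card {i. i < l j \<and> nb j i \<in> S' <+> ({} <+> Q)})) =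
        (\<Sum>j\<in>Q. path_inc (int m) s True Q j)" using that by (intro sum.cong cnt) auto
    finally show ?thesis .
  qed
  define y where "y = q (t - 1)"
  have yW: "y \<in> S \<union> q ` {..<t}" using t(1) by (auto simp: y_def)
  have "dm A + 1 \<le> dm (insert y A)"
  proof (rule dm_ge[OF W])
    show "insert y A \<subseteq> S \<union> q ` {..<t}" using yW S(2) by auto
    fix T assume T: "insert y A \<subseteq> T" "T \<subseteq> S \<union> q ` {..<t}"
    define Q where "Q = {j. j < t \<and> q j \<in> T}"
    have Q: "Q \<subseteq> {..<t}" "t - 1 \<in> Q" using T t(1) by (auto simp: Q_def y_def)
    have "T = (T \<inter> S) \<union> q ` Q" using T by (auto simp: Q_def)
    moreover have "A \<subseteq> T \<inter> S" using T S by auto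
    moreover from this have "dm A \<le> dl (T \<inter> S)"
      using fs_Int(2)[OF ss_fs[OF S(1)]] by (intro dm_le) auto
    ultimately show "dm A + 1 \<le> dl T" using dT[of "T \<inter> S" Q] ps(2)[OF Q] Q(1) by simp
  qed
  moreover have "dm (insert y A) \<le> dm A + 1"
  proof -
    have "dm (insert y A) \<le> dl (S \<union> q ` {..<t})" using yW S ss_fs[OF W] by (intro dm_le) auto
    also have "\<dots> = dm A + 1" using dT[of S "{..<t}"] S path_sum_full[of "int m" s t] t(2,3) by simp
    finally show ?thesis .
  qed
  moreover have "y \<in> V" using yW ss_fs[OF W] by (auto simp: fs_def)
  ultimately show ?thesis using that by force
qed

text \<open>A copy of \<open>y\<close> is joined to \<open>x\<close> by a path along which the predimension drops from one, the
  dimension of \<open>y\<close>, to zero. Then the path and the copy have dimension zero over \<open>A \<union> {x}\<close>. The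
  copy alone is self-sufficient: without \<open>x\<close> the path saves an edge of weight \<open>m\<close>, and with
  it the dimension of \<open>x\<close>, which is at least one, compensates.\<close>

lemma dim_one_transfer:
  assumes A: "fs A" "r + n + m \<le> card A"
    and y: "y \<in> V" "dm (insert y A) = dm A + 1" and x: "x \<in> V" "x \<notin> cl A"
  obtains p where "p \<in> Stab A" "p y \<in> cl (insert x A)"
proof -
  have dx: "dm A + 1 \<le> dm (insert x A)" using x cl_iff[OF A(1), of x] by linarith
  have ycl: "y \<notin> cl A" using y(2) by (simp add: cl_def)
  obtain S0 where S0: "ss S0" "insert x A \<subseteq> S0" "dl S0 = dm (insert x A)"
    using dm_attained[of "insert x A"] A x by auto
  obtain Y0 where Y0: "ss Y0" "insert y A \<subseteq> Y0" "dl Y0 = dm A + 1"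
    using dm_attained[of "insert y A"] A y by auto
  have AS: "A \<subseteq> S0" "A \<subseteq> Y0" using S0 Y0 by auto
  obtain C where C: "ss C" "A \<subseteq> C" "C \<subseteq> cl A" "dl C = dm A" and S': "ss (S0 \<union> C)" "dl (S0 \<union> C) = dl S0"
    and Y': "ss (Y0 \<union> C)" "dl (Y0 \<union> C) = dl Y0" "(Y0 \<union> C) \<inter> cl A = C"
    by (rule ss_covers_common_closure[OF A(1) S0(1) AS(1) Y0(1) AS(2)])
  define S where "S = S0 \<union> C"
  define Y where "Y = Y0 \<union> C"
  have SY: "ss S" "ss Y" "C \<subseteq> S" "C \<subseteq> Y" using S' Y' by (auto simp: S_def Y_def)
  have dS: "dl S = dm (insert x A)" "dl Y = dl C + 1" using S' Y' S0 Y0 C by (auto simp: S_def Y_def)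
  have xS: "x \<in> S" "x \<notin> C" "y \<in> Y" "y \<notin> C" using S0 Y0 C x ycl by (auto simp: S_def Y_def)
  obtain D c where D: "D \<subseteq> A" "card D = r - 2" and c0: "inj_on c {..n + m}"
      "c ` {..n + m} \<subseteq> A - D"
    by (rule attachment_points[OF A])
  have c: "inj_on c {..n + m}" "\<And>i. i \<le> n + m \<Longrightarrow> c i \<in> A - D" using c0 by auto
  obtain t s l where t: "0 < t" "s 0 = 1" "s t = 0" "\<And>j. j < t \<Longrightarrow> s j \<le> int m"
      "\<And>j. 0 < j \<Longrightarrow> j < t \<Longrightarrow> 1 \<le> s j"
      "\<And>j. j < t \<Longrightarrow> int n - int m * int (l j) = s (Suc j) - s j"
      "\<And>j. j < t \<Longrightarrow> l j \<le> n + m" "\<And>j. j < t \<Longrightarrow> 1 \<le> s j \<Longrightarrow> 1 \<le> l j"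
      "\<And>j. j < t \<Longrightarrow> 1 \<le> s j \<Longrightarrow> s (Suc j) = 0 \<Longrightarrow> 2 \<le> l j"
    by (rule path_numbers[of m n 1 0]) (use coprime_mn m_pos m_le_n in \<open>auto simp: coprime_commute\<close>)
  have s1: "1 \<le> s j" if "j < t" for j using t(2) t(5)[of j] that by (cases "j = 0") auto
  have l1: "1 \<le> l j" if "j < t" for j using t(8) s1 that by simp
  have l2: "2 \<le> l (t - 1)" using t(9)[of "t - 1"] s1[of "t - 1"] t(1,3) by simp
  define nb :: "nat \<Rightarrow> nat \<Rightarrow> 'a + ('a + nat)" where
    "nb j i = (if i = 0 then (if j = 0 then Inr (Inl y) else Inr (Inr (j - 1)))
       else if i = 1 \<and> j = t - 1 then Inl x else Inl (c i))" for j i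
  have cA: "c i \<in> A" "c i \<notin> D" "c i \<noteq> x" if "i < l j" "j < t" for i j
    using c(2)[of i] t(7)[OF that(2)] that xS(2) C(2) by auto
  \<comment> \<open>The increment at the \<open>j\<close>-th vertex, where the last vertex saves an edge if \<open>x\<close> is absent.\<close>
  define pt where "pt pres xin Q j = path_inc (int m) s pres Q j + (if j = t - 1 \<and> \<not> xin then int m else 0)"
    for pres xin Q j
  have cnt: "int n - int m * int (card {i. i < l j \<and> nb j i \<in> S' <+> (Y' <+> Q)}) = pt (y \<in> Y') (x \<in> S') Q j"
    if "j < t" "A \<subseteq> S'" for j S' Y' Q
  proof -
    let ?P = "\<lambda>i. nb j i \<in> S' <+> (Y' <+> Q)"
    have P0: "?P 0 \<longleftrightarrow> (if j = 0 then y \<in> Y' else j - 1 \<in> Q)" by (auto simp: nb_def)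
    have P1: "?P 1 \<longleftrightarrow> \<not> (j = t - 1 \<and> x \<notin> S')"
      using c(2)[of 1] that m_pos n_pos by (auto simp: nb_def)
    have "int (card {i. i < l j \<and> ?P i}) = int (l j) - of_bool (\<not> ?P 0) - of_bool (\<not> ?P 1)"
    proof (rule card_missing)
      show "?P i" if "i < l j" "2 \<le> i" for i using cA[OF that(1) \<open>j < t\<close>] that \<open>A \<subseteq> S'\<close> by (auto simp: nb_def)
      show "?P 0 \<or> 1 \<le> l j" using l1 \<open>j < t\<close> by simp
      show "?P 1 \<or> 2 \<le> l j" using P1 l2 by auto
    qed
    then have "int n - int m * int (card {i. i < l j \<and> ?P i}) =
        (int n - int m * int (l j)) + int m * of_bool (\<not> ?P 0) + int m * of_bool (\<not> ?P 1)"
      by (rule weight_missing)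
    then show ?thesis unfolding t(6)[OF that(1)] P0 P1 by (auto simp: path_inc_def pt_def)
  qed
  have ptT: "(\<Sum>j\<in>Q. pt pres True Q j) = (\<Sum>j\<in>Q. path_inc (int m) s pres Q j)" for Q pres
    by (simp add: pt_def)
  have s0: "0 \<le> s j" if "j \<le> t" for j using s1[of j] that t(3) by (cases "j = t") auto
  have psT: "0 \<le> 1 + (\<Sum>j\<in>Q. path_inc (int m) s True Q j)" if "Q \<subseteq> {..<t}" for Q
    using path_sum[of t s "int m" 0 1 True t Q] t s0 that by simp
  have psF: "0 \<le> (\<Sum>j\<in>Q. path_inc (int m) s False Q j)" if "Q \<subseteq> {..<t}" for Q
    using path_sum[of t s "int m" 0 0 False t Q] t s0 that by simp
  \<comment> \<open>Without \<open>x\<close>, either the last vertex saves an edge, or the values before it are at least one.\<close>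
  have psX: "0 \<le> (\<Sum>j\<in>Q. pt True False Q j)" if Q: "Q \<subseteq> {..<t}" for Q
  proof (cases "t - 1 \<in> Q")
    case True
    have "finite Q" using Q finite_subset by auto
    then have "(\<Sum>j\<in>Q. pt True False Q j) = (\<Sum>j\<in>Q. path_inc (int m) s True Q j) + int m"
      using True by (simp add: pt_def sum.distrib sum.delta)
    then show ?thesis using psT[OF Q] m_pos by simp
  next
    case False
    have Q1: "Q \<subseteq> {..<t - 1}"
    proof
      fix j assume "j \<in> Q"
      then have "j < t" "j \<noteq> t - 1" using Q False by auto
      then show "j \<in> {..<t - 1}" by simp
    qed
    have "(\<Sum>j\<in>Q. pt True False Q j) = (\<Sum>j\<in>Q. path_inc (int m) s True Q j)"
      using False by (intro sum.cong) (auto simp: pt_def)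
    moreover have "1 \<le> 1 + (\<Sum>j\<in>Q. path_inc (int m) s True Q j)"
      using path_sum[of "t - 1" s "int m" 1 1 True "t - 1" Q] t s1 Q1 by simp
    ultimately show ?thesis by simp
  qed
  have fsY: "fs (C \<union> Y')" if "Y' \<subseteq> Y - C" for Y'
    using that SY(4) by (intro fs_subset[OF ss_fs[OF SY(2)]]) auto
  have DS: "D \<subseteq> S" using D C SY by auto
  have nbS: "nb j i \<in> (S - D) <+> ((Y - C) <+> {..<j})" if "j < t" "i < l j" for j i
    using cA[OF that(2,1)] xS D C SY that by (auto simp: nb_def)
  have nbi: "inj_on (nb j) {..<l j}" if "j < t" for j
  proof (rule inj_onI)
    fix i i' assume i: "i \<in> {..<l j}" "i' \<in> {..<l j}" "nb j i = nb j i'"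
    then have "i \<le> n + m" "i' \<le> n + m" "c i \<noteq> x" "c i' \<noteq> x" using t(7)[OF that] cA that by auto
    then show "i = i'" using i inj_onD[OF c(1), of i i'] by (auto simp: nb_def split: if_splits)
  qed
  have pos: "0 \<le> dl (C \<union> Y') - dl C +
      (\<Sum>j\<in>Q. int n - int m * int (card {i. i < l j \<and> nb j i \<in> S <+> (Y' <+> Q)}))"
    if h: "Y' \<subseteq> Y - C" "Q \<subseteq> {..<t}" for Y' Q
  proof -
    have eq: "(\<Sum>j\<in>Q. int n - int m * int (card {i. i < l j \<and> nb j i \<in> S <+> (Y' <+> Q)}))
        = (\<Sum>j\<in>Q. pt (y \<in> Y') (x \<in> S) Q j)" using h C SY by (intro sum.cong cnt) auto
    have eq2: "\<dots> = (\<Sum>j\<in>Q. path_inc (int m) s (y \<in> Y') Q j)" using xS ptT by simp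
    show ?thesis
    proof (cases "y \<in> Y'")
      case True
      have "dm (insert y A) \<le> dl (C \<union> Y')" using True C(2) fsY[OF h(1)] by (intro dm_le) auto
      then show ?thesis unfolding eq eq2 using True psT[OF h(2)] y(2) C(4) by simp
    next
      case False
      have "dl C \<le> dl (C \<union> Y')" using fsY[OF h(1)] by (intro ss_le[OF C(1)]) auto
      then show ?thesis unfolding eq eq2 using False psF[OF h(2)] by simp
    qed
  qed
  obtain f :: "'a \<Rightarrow> 'a" and q :: "nat \<Rightarrow> 'a" where
      f: "\<And>x. x \<in> C \<Longrightarrow> f x = x" "iso f Y" "ss (S \<union> f ` (Y - C) \<union> q ` {..<t})"
      "\<And>S' Y' Q. C \<union> D \<subseteq> S' \<Longrightarrow> S' \<subseteq> S \<Longrightarrow> Y' \<subseteq> Y - C \<Longrightarrow> Q \<subseteq> {..<t} \<Longrightarrow>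
      dl (S' \<union> f ` Y' \<union> q ` Q) = dl S' + (dl (C \<union> Y') - dl C) +
        (\<Sum>j\<in>Q. int n - int m * int (card {i. i < l j \<and> nb j i \<in> S' <+> (Y' <+> Q)}))"
    apply (rule extend_by_copy_and_path[OF SY DS D(2) nbS nbi pos])
         apply assumption+
    subgoal premises p for f q by (rule p(1)[OF p(2,3,5,8)])
    done
  define W where "W = S \<union> f ` (Y - C) \<union> q ` {..<t}"
  have W: "ss W" using f(3) by (simp add: W_def)
  have CY: "C \<union> (Y - C) = Y" using SY by auto
  have dT: "dl (S' \<union> f ` (Y - C) \<union> q ` Q) = dl S' + 1 + (\<Sum>j\<in>Q. pt True (x \<in> S') Q j)"
    if "C \<subseteq> S'" "S' \<subseteq> S" "Q \<subseteq> {..<t}" for S' Q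
  proof -
    have "dl (S' \<union> f ` (Y - C) \<union> q ` Q) = dl S' + (dl Y - dl C) +
        (\<Sum>j\<in>Q. int n - int m * int (card {i. i < l j \<and> nb j i \<in> S' <+> ((Y - C) <+> Q)}))"
      using f(4)[of S' "Y - C" Q] that D C CY by auto
    also have "(\<Sum>j\<in>Q. int n - int m * int (card {i. i < l j \<and> nb j i \<in> S' <+> ((Y - C) <+> Q)})) =
        (\<Sum>j\<in>Q. pt (y \<in> Y - C) (x \<in> S') Q j)" using that C by (intro sum.cong cnt) auto
    finally show ?thesis using dS xS by simp
  qed
  have fC: "f ` C = C"
  proof -
    have "f ` C = (\<lambda>x. x) ` C" using f(1) by (intro image_cong) auto
    then show ?thesis by simp
  qed
  have fY: "f ` Y = C \<union> f ` (Y - C)" using fC image_Un[of f C "Y - C"] CY by simp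
  have fYs: "ss (f ` Y)"
  proof (rule ss_subI[OF W])
    show "f ` Y \<subseteq> W" using fY SY by (auto simp: W_def)
    fix T assume T: "f ` Y \<subseteq> T" "T \<subseteq> W"
    define Q where "Q = {j. j < t \<and> q j \<in> T}"
    have Q: "Q \<subseteq> {..<t}" by (auto simp: Q_def)
    have TQ: "T = (T \<inter> S) \<union> f ` (Y - C) \<union> q ` Q" using T fY by (auto simp: Q_def W_def)
    have CT: "C \<subseteq> T \<inter> S" using T fY SY by auto
    have fT: "fs (T \<inter> S)" using fs_Int(2)[OF ss_fs[OF SY(1)]] .
    have "dl T = dl (T \<inter> S) + 1 + (\<Sum>j\<in>Q. pt True (x \<in> T \<inter> S) Q j)"
      using dT[OF CT _ Q] TQ by simp
    moreover have "dl C \<le> dl (T \<inter> S) + (\<Sum>j\<in>Q. pt True (x \<in> T \<inter> S) Q j)"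
    proof (cases "x \<in> T \<inter> S")
      case True
      have "dm (insert x A) \<le> dl (T \<inter> S)" using True CT C(2) fT by (intro dm_le) auto
      then show ?thesis using True psT[OF Q] ptT dx C(4) by simp
    next
      case False
      then have xF: "(x \<in> T \<inter> S) = False" by simp
      have "dl C \<le> dl (T \<inter> S)" using CT fT by (intro ss_le[OF C(1)]) auto
      then show ?thesis unfolding xF using psX[OF Q] by simp
    qed
    ultimately show "dl (f ` Y) \<le> dl T" using iso_delta[OF f(2)] dS by simp
  qed
  have fid: "f v = v" if "v \<in> Y \<inter> cl A" for v using that Y'(3) f(1) by (auto simp: Y_def)
  have AY: "A \<subseteq> Y" using C SY by auto
  obtain p where p: "p \<in> Stab A" "\<And>v. v \<in> Y \<Longrightarrow> p v = f v"
    using homogeneity[OF A(1) SY(2) AY f(2) fYs fid] by metis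
  have "p y \<in> W" using p(2) xS fY SY by (auto simp: W_def)
  have "dl W = dl S + 1 + (\<Sum>j<t. path_inc (int m) s True {..<t} j)"
    unfolding W_def using dT[of S "{..<t}"] SY xS ptT by simp
  then have dW: "dl W = dm (insert x A)" using path_sum_full[of "int m" s t] t(2,3) dS by simp
  have "dm (insert x A \<union> {p y}) \<le> dl W"
    using \<open>p y \<in> W\<close> S0 C x ss_fs[OF W] by (intro dm_le) (auto simp: W_def S_def)
  then have "{p y} \<subseteq> cl (insert x A)"
    using dW A x \<open>p y \<in> W\<close> ss_fs[OF W] by (intro cl_I) (auto simp: fs_def)
  then show ?thesis using that p(1) by simp
qed

end

section \<open>Bounded automorphisms are trivial\<close>

context hrushovski_generic
begin

lemma dm_relative_mono:
  assumes "fs Z" "Y \<subseteq> Z" "v \<in> V" shows "dm (insert v Z) + dm Y \<le> dm (insert v Y) + dm Z"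
proof -
  have "fs Y" using assms fs_subset by blast
  then have "dm (insert v Y \<union> Z) + dm Y \<le> dm (insert v Y) + dm Z"
    using assms by (intro dm_submodular) auto
  moreover have "insert v Y \<union> Z = insert v Z" using assms by auto
  ultimately show ?thesis by simp
qed

lemma dm_insert_le: assumes "fs Y" "v \<in> V" shows "dm (insert v Y) \<le> dm Y + int n"
proof -
  obtain B where B: "ss B" "Y \<subseteq> B" "dl B = dm Y" by (rule dm_attained[OF assms(1)])
  have f: "finite B" "fs B" using B by (auto simp: ss_def fs_def)
  have "int (card (insert v B)) \<le> int (card B) + 1" using f by (simp add: card_insert_if)
  then have "int n * int (card (insert v B)) \<le> int n * int (card B) + int n"
    by (metis (no_types) distrib_left mult.right_neutral mult_left_mono of_nat_0_le_iff)
  moreover have "card (edges_on M B) \<le> card (edges_on M (insert v B))"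
    using f by (intro card_mono finite_edges_on) (auto simp: edges_on_def)
  then have "int m * int (card (edges_on M B)) \<le> int m * int (card (edges_on M (insert v B)))"
    by (intro mult_left_mono) auto
  ultimately have "dl (insert v B) \<le> dl B + int n" by (simp add: delta_def)
  moreover have "dm (insert v Y) \<le> dl (insert v B)" using B f assms by (intro dm_le) auto
  ultimately show ?thesis using B by simp
qed

lemma Stab_image_Un: "p \<in> Stab A \<Longrightarrow> fs A \<Longrightarrow> p ` (A \<union> X) = A \<union> p ` X"
  by (simp add: image_Un Stab_image cl_sup)

lemma Stab_dm: assumes "p \<in> Stab A" "fs A" "fs X" shows "dm (A \<union> p ` X) = dm (A \<union> X)"
  using aut_dm[OF Stab_aut[OF assms(1)], of "A \<union> X"] assms by (simp add: Stab_image_Un)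

lemma Stab_ind:
  assumes "p \<in> Stab B" "A \<subseteq> B" "fs B" "fs X" shows "ind A (p ` X) B \<longleftrightarrow> ind A X B"
proof -
  have a: "aut p" "fs A" using assms Stab_aut fs_subset by auto
  have "p ` A = A" "p ` B = B" using assms cl_sup[OF assms(3)] by (auto intro!: Stab_image)
  then show ?thesis using ind_aut[OF a assms(4,3)] by simp
qed

text \<open>The order matters: a member of the list may have larger dimension over \<open>A\<close> alone.\<close>

primrec basis :: "'a list \<Rightarrow> 'a set \<Rightarrow> bool" where
  "basis [] A \<longleftrightarrow> True"
| "basis (y # ys) A \<longleftrightarrow> y \<in> V \<and> dm (insert y A) = dm A + 1 \<and> basis ys (insert y A)"

lemma basis_fs: "basis ys A \<Longrightarrow> fs (set ys)"
  by (induction ys arbitrary: A) auto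

lemma basis_dm: "basis ys A \<Longrightarrow> dm (A \<union> set ys) = dm A + int (length ys)"
  by (induction ys arbitrary: A) force+

lemma basis_aut: "basis ys A \<Longrightarrow> aut p \<Longrightarrow> fs A \<Longrightarrow> basis (map p ys) (p ` A)"
proof (induction ys arbitrary: A)
  case (Cons y ys)
  have "dm (insert (p y) (p ` A)) = dm (insert y A)" "dm (p ` A) = dm A"
    using aut_dm[OF Cons.prems(2), of "insert y A"] aut_dm[OF Cons.prems(2,3)] Cons.prems by auto
  moreover have "basis (map p ys) (p ` insert y A)"
    by (rule Cons.IH) (use Cons.prems in auto)
  ultimately show ?case using Cons.prems aut_V[OF Cons.prems(2)] by simp
qed simp

lemma basis_Fx: assumes "basis ys A" "p \<in> Stab A" "fs A" shows "basis (map p ys) A"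
  using basis_aut[OF assms(1) Stab_aut[OF assms(2)] assms(3)] Stab_image[OF assms(2) cl_sup[OF assms(3)]] by simp

text \<open>Over an independent set the dimensions of all members stay the same.\<close>

lemma basis_ind:
  "basis ys A \<Longrightarrow> ind A (set ys) B \<Longrightarrow> fs B \<Longrightarrow> A \<subseteq> B \<Longrightarrow> basis ys B"
proof (induction ys arbitrary: A B)
  case (Cons y ys)
  have f: "y \<in> V" "fs (set ys)" "fs A" "fs B"
    using Cons.prems basis_fs fs_subset by auto
  have i: "ind A B ({y} \<union> set ys)" using Cons.prems(2) by (simp add: ind_sym)
  have "ind A B {y}" by (rule ind_mono[OF i]) (use f in auto)
  then have "dm (insert y B) = dm B + 1"
    using Cons.prems(1,4) by (simp add: ind_def Un_absorb1)
  moreover have "ind (A \<union> {y}) B (set ys)" by (rule ind_base[OF i]) (use f in auto)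
  then have "ind (insert y A) (set ys) B" by (simp add: ind_sym)
  then have i': "ind (insert y A) (set ys) (insert y B)" by (simp add: ind_def Un_ac)
  have "basis ys (insert y B)"
    by (rule Cons.IH[OF _ i']) (use Cons.prems f in auto)
  ultimately show ?case using f by simp
qed simp

text \<open>By iterating \<open>dim_one_transfer\<close>: each new member of the basis lowers by one the dimension of
  \<open>X\<close> over the members found so far.\<close>

lemma exists_basis:
  assumes A0: "fs A0" "r + n + m \<le> card A0" and y0: "y0 \<in> V" "dm (insert y0 A0) = dm A0 + 1"
    and X: "fs X"
  shows "\<exists>ys. basis ys A0 \<and> set ys \<subseteq> cl (A0 \<union> X) \<and> X \<subseteq> cl (A0 \<union> set ys) \<and>
    (\<forall>y\<in>set ys. \<exists>p\<in>Stab A0. y = p y0)"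
proof -
  have "\<exists>ys. basis ys A \<and> set ys \<subseteq> cl (A \<union> X) \<and> X \<subseteq> cl (A \<union> set ys) \<and>
      (\<forall>y\<in>set ys. \<exists>p\<in>Stab A0. y = p y0)" if "A0 \<subseteq> A" "fs A" "nat (dm (A \<union> X) - dm A) = k" for A k
    using that
  proof (induction k arbitrary: A rule: less_induct)
    case (less k)
    show ?case
    proof (cases "X \<subseteq> cl A")
      case True
      moreover have "basis [] A" "set [] \<subseteq> cl (A \<union> X)" by simp_all
      ultimately show ?thesis by (metis Un_empty_right empty_iff list.set(1))
    next
      case False
      then obtain x where x: "x \<in> X" "x \<notin> cl A" by auto
      have xV: "x \<in> V" using x X by (auto simp: fs_def)
      have fy0: "fs {y0}" using y0 by simp
      obtain p where p: "p \<in> Stab A0" "ind A0 (p ` {y0}) A"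
        by (rule independent_copy[OF A0(1) fy0 less.prems(2)])
      have pV: "p y0 \<in> V" using aut_V[OF Stab_aut[OF p(1)]] y0 by simp
      have "dm (A0 \<union> p ` {y0}) = dm A0 + 1" using Stab_dm[OF p(1), of "{y0}"] A0 y0 by simp
      then have py: "dm (insert (p y0) A) = dm A + 1"
        using p(2) less.prems(1) by (simp add: ind_def Un_absorb1)
      have cA: "r + n + m \<le> card A"
        using A0(2) card_mono[OF fs_finite[OF less.prems(2)] less.prems(1)] by simp
      obtain q where q: "q \<in> Stab A" "q (p y0) \<in> cl (insert x A)"
        by (rule dim_one_transfer[OF less.prems(2) cA pV py xV x(2)])
      define y where "y = q (p y0)"
      have yV: "y \<in> V" using aut_V[OF Stab_aut[OF q(1)]] pV by (simp add: y_def)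
      have y: "dm (insert y A) = dm A + 1"
        using Stab_dm[OF q(1) less.prems(2), of "{p y0}"] pV py by (simp add: y_def)
      have fAX: "fs (A \<union> X)" using less.prems X by simp
      have ycl: "y \<in> cl (A \<union> X)"
        using q(2) cl_mono[OF fAX, of "insert x A"] x by (auto simp: y_def)
      have dAX: "dm (insert y A \<union> X) = dm (A \<union> X)" using ycl by (simp add: cl_def)
      have "dm (insert y A) \<le> dm (insert y A \<union> X)" using fAX yV by (intro dm_mono) auto
      then have "nat (dm (insert y A \<union> X) - dm (insert y A)) < k"
        using less.prems(3) y dAX by linarith
      from less.IH[OF this, of "insert y A"] obtain ys where ys: "basis ys (insert y A)"
          "set ys \<subseteq> cl (insert y A \<union> X)" "X \<subseteq> cl (insert y A \<union> set ys)"
          "\<forall>y\<in>set ys. \<exists>p\<in>Stab A0. y = p y0"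
        using less.prems yV by auto
      have "cl (insert y A \<union> X) \<subseteq> cl (A \<union> X)"
        using fAX yV ycl cl_sup[OF fAX] by (intro cl_least) auto
      moreover have "q \<circ> p \<in> Stab A0"
        using Stab_comp[OF Stab_mono[OF less.prems(2,1) q(1)] p(1)] .
      then have "\<exists>p\<in>Stab A0. y = p y0" by (intro bexI[of _ "q \<circ> p"]) (simp_all add: y_def)
      ultimately show ?thesis
        using ys y yV ycl by (intro exI[of _ "y # ys"]) auto
    qed
  qed
  from this[OF order_refl A0(1) refl] show ?thesis .
qed

text \<open>Submodularity, as the intersections of the \<open>X v\<close> contain \<open>C\<close>.\<close>

lemma delta_union_le:
  assumes "finite K" "K \<noteq> {}" "\<And>v. v \<in> K \<Longrightarrow> fs (X v) \<and> C \<subseteq> X v \<and> dl (X v) \<le> dm C + d"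
  shows "fs (\<Union>v\<in>K. X v) \<and> C \<subseteq> (\<Union>v\<in>K. X v) \<and> dl (\<Union>v\<in>K. X v) \<le> dm C + int (card K) * d"
  using assms
proof (induction K rule: finite_ne_induct)
  case (singleton v)
  then show ?case by simp
next
  case (insert v K)
  let ?U = "\<Union>v\<in>K. X v"
  have ih: "fs ?U" "C \<subseteq> ?U" "dl ?U \<le> dm C + int (card K) * d" using insert by auto
  have v: "fs (X v)" "C \<subseteq> X v" "dl (X v) \<le> dm C + d" using insert by auto
  have "dm C \<le> dl (X v \<inter> ?U)" using ih v by (intro dm_le) (auto intro: fs_Int)
  then have "dl (X v \<union> ?U) \<le> dm C + int (card K) * d + d"
    using delta_submodular[OF fs_finite[OF v(1)] fs_finite[OF ih(1)]] ih(3) v(3) by linarith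
  also have "\<dots> = dm C + int (card (insert v K)) * d"
    using insert.hyps by (simp add: algebra_simps)
  finally have "dl (X v \<union> ?U) \<le> dm C + int (card (insert v K)) * d" .
  then show ?case using ih v by auto
qed

text \<open>A competing superset of \<open>Z \<union> J\<close> pays \<open>n\<close> for each vertex of the hyperedge that it contains, and
  saves \<open>m \<le> n\<close> only if it contains all of them.\<close>

lemma new_edge_dim:
  assumes S: "ss S" "b \<in> S" "Z \<subseteq> S" and b: "dm Z + int n \<le> dm (insert b Z)"
    and N: "finite N" "card N = r - 1" "N \<inter> S = {}" "ss (S \<union> N)"
    and dN: "\<And>S' N'. S' \<subseteq> S \<Longrightarrow> N' \<subseteq> N \<Longrightarrow> dl (S' \<union> N') =
       dl S' + int n * int (card N') - (if b \<in> S' \<and> N' = N then int m else 0)"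
    and J: "J \<subseteq> insert b N"
  shows "dm Z + int n * int (card J) - (if J = insert b N then int m else 0) \<le> dm (Z \<union> J)"
proof (rule dm_ge[OF N(4)])
  show "Z \<union> J \<subseteq> S \<union> N" using S J by auto
  fix T assume T: "Z \<union> J \<subseteq> T" "T \<subseteq> S \<union> N"
  have bN: "b \<notin> N" using S N by auto
  have fT: "fs (T \<inter> S)" using fs_Int(2)[OF ss_fs[OF S(1)]] .
  have "T = (T \<inter> S) \<union> (T \<inter> N)" using T by auto
  then have dT: "dl T = dl (T \<inter> S) + int n * int (card (T \<inter> N)) - (if b \<in> T \<inter> S \<and> T \<inter> N = N then int m else 0)"
    using dN[of "T \<inter> S" "T \<inter> N"] by simp
  have lS: "dm Z + int n * of_bool (b \<in> T) \<le> dl (T \<inter> S)"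
  proof (cases "b \<in> T")
    case True
    then have "dm (insert b Z) \<le> dl (T \<inter> S)" using fT S T by (intro dm_le) auto
    then show ?thesis using b True by simp
  next
    case False
    have "dm Z \<le> dl (T \<inter> S)" using fT S T by (intro dm_le) auto
    then show ?thesis using False by simp
  qed
  define k where "k = card (T \<inter> N) + of_bool (b \<in> T)"
  have kT: "card (T \<inter> insert b N) = k"
    using bN N(1) by (auto simp: k_def Int_insert_right)
  have Jk: "card J \<le> k" unfolding kT[symmetric] using T J N(1) by (intro card_mono) auto
  have nk: "int n * int (card (T \<inter> N)) + int n * of_bool (b \<in> T) = int n * int k"
    by (simp add: k_def algebra_simps)
  show "dm Z + int n * int (card J) - (if J = insert b N then int m else 0) \<le> dl T"
  proof (cases "b \<in> T \<and> N \<subseteq> T")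
    case False
    then have "dm Z + int n * int k \<le> dl T" using dT lS nk by (auto simp: Int_absorb1)
    moreover have "int n * int (card J) \<le> int n * int k" using Jk by (intro mult_left_mono) auto
    ultimately show ?thesis by auto
  next
    case True
    then have k: "k = r" using N(1,2) bN r_ge_2 by (simp add: k_def Int_absorb1)
    have TN: "T \<inter> N = N" "b \<in> T \<inter> S" using True S by auto
    have l: "dm Z + int n * int r - int m \<le> dl T" using dT lS nk True k TN by simp
    show ?thesis
    proof (cases "J = insert b N")
      case True
      then have "card J = r" using N bN r_ge_2 by simp
      then show ?thesis using l True by simp
    next
      case False
      then have "card J < card (insert b N)" using J N(1) by (intro psubset_card_mono) auto
      then have "int (card J) + 1 \<le> int r" using N bN r_ge_2 by simp
      then have "int n * (int (card J) + 1) \<le> int n * int r" by (intro mult_left_mono) auto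
      then have "int n * int (card J) + int n \<le> int n * int r" by (simp add: distrib_left)
      then show ?thesis using l False m_le_n by simp
    qed
  qed
qed

text \<open>An element \<open>b\<close> of maximal dimension lies on a hyperedge \<open>K\<close> any two vertices of which have
  distinct closures over \<open>C\<close>. If \<open>g ` K\<close> were another hyperedge, then both would cross between the
  sets \<open>X v\<close>, which are optimal for the closures of the vertices \<open>v\<close>. Two crossing hyperedges lower
  the predimension by \<open>2 * m\<close>, but the dimension of \<open>K\<close> is only \<open>m\<close> less than the sum of the
  dimensions of its vertices.\<close>

lemma bounded_fixes_generic:
  assumes g: "aut g" and C: "fs C" and bd: "\<And>x. x \<in> V \<Longrightarrow> g x \<in> cl (insert x C)"
    and b: "b \<in> V" "dm (C \<union> iv g ` C) + int n \<le> dm (insert b (C \<union> iv g ` C))"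
  shows "g b = b"
proof -
  define C' where "C' = C \<union> iv g ` C"
  have C': "fs C'" "C \<subseteq> C'" using C g by (auto simp: C'_def aut_fs aut_inv)
  have gC': "C \<subseteq> g ` C'" using g by (auto simp: C'_def image_Un)
  have gV: "g v \<in> V" if "v \<in> V" for v using aut_V[OF g] that by simp
  have fS: "fs (insert b (insert (g b) C'))" using C' b gV by simp
  obtain S where S: "ss S" "insert b (insert (g b) C') \<subseteq> S" by (rule dm_attained[OF fS])
  then have bS: "b \<in> S" "g b \<in> S" "C' \<subseteq> S" by auto
  obtain N where N: "finite N" "card N = r - 1" "N \<inter> S = {}" "ss (S \<union> N)" "insert b N \<in> E"
    "\<And>e. e \<in> E \<Longrightarrow> e \<subseteq> S \<union> N \<Longrightarrow> e \<subseteq> S \<or> e = insert b N"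
    "\<And>S' N'. S' \<subseteq> S \<Longrightarrow> N' \<subseteq> N \<Longrightarrow> dl (S' \<union> N') =
       dl S' + int n * int (card N') - (if b \<in> S' \<and> N' = N then int m else 0)"
    using add_edge[OF S(1) bS(1)] by metis
  define K where "K = insert b N"
  have bN: "b \<notin> N" using bS N by auto
  have K: "finite K" "card K = r" using N bN r_ge_2 by (auto simp: K_def)
  have KV: "v \<in> V" if "v \<in> K" for v using that b ss_fs[OF N(4)] by (auto simp: K_def fs_def)
  have Nne: "N \<noteq> {}" using N r_ge_2 by auto
  note dimC' = new_edge_dim[OF S(1) bS(1) bS(3) b(2)[folded C'_def] N(1-4) N(7), folded K_def]
  have CS: "C \<subseteq> S" using C' bS by auto
  have "dm (insert b C') + dm C \<le> dm (insert b C) + dm C'"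
    using dm_relative_mono[OF C' b(1)] .
  then have bC: "dm C + int n \<le> dm (insert b C)" using b(2) by (simp add: C'_def)
  note dimC = new_edge_dim[OF S(1) bS(1) CS bC N(1-4) N(7), folded K_def]
  have single: "J \<noteq> K" if "J = {v}" for J v using that K r_ge_2 by (auto dest: arg_cong[of _ _ card])
  have gen: "dm C + int n \<le> dm (insert (g v) C)" if "v \<in> K" for v
  proof -
    have "dm C' + int n \<le> dm (C' \<union> {v})" using dimC'[of "{v}"] single[of "{v}" v] that by simp
    then have "dm (g ` C') + int n \<le> dm (insert (g v) (g ` C'))"
      using aut_dm[OF g C'(1)] aut_dm[OF g, of "insert v C'"] C' KV[OF that] by simp
    moreover have "dm (insert (g v) (g ` C')) + dm C \<le> dm (insert (g v) C) + dm (g ` C')"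
      using dm_relative_mono[of "g ` C'" C "g v"] gC' C' g gV KV[OF that] by (simp add: aut_fs)
    ultimately show ?thesis by simp
  qed
  have pair: "v \<notin> cl (insert u C)" if uv: "u \<in> K" "v \<in> K" "u \<noteq> v" for u v
  proof
    assume "v \<in> cl (insert u C)"
    then have le: "dm (C \<union> {u, v}) \<le> dm C + int n"
      using dm_insert_le[OF C KV[OF uv(1)]] by (simp add: cl_def insert_commute)
    have "dm C + int n * 2 - (if {u, v} = K then int m else 0) \<le> dm (C \<union> {u, v})"
      using dimC[of "{u, v}"] uv by simp
    moreover have "{u, v} = K \<Longrightarrow> int m < int n"
    proof -
      assume "{u, v} = K"
      then have "card {u, v} = r" using K(2) by simp
      then have "r = 2" using uv(3) by simp
      then show ?thesis using edge_positive by simp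
    qed
    ultimately show False using le n_pos by (auto split: if_splits)
  qed
  have exch: "v \<in> cl (insert (g v) C)" if v: "v \<in> K" for v
  proof -
    have f: "fs (insert (g v) C)" "v \<in> V" "fs (insert v C)" using C KV[OF v] gV by auto
    have "dm (insert (g v) (insert v C)) = dm (insert v C)" using bd[OF f(2)] by (simp add: cl_def)
    then have "dm (insert v (insert (g v) C)) \<le> dm (insert (g v) C)"
      using dm_insert_le[OF C f(2)] gen[OF v] by (simp add: insert_commute)
    then show ?thesis using cl_iff[OF f(1,2)] by simp
  qed
  have gpair: "g v \<notin> cl (insert u C)" if uv: "u \<in> K" "v \<in> K" "u \<noteq> v" for u v
  proof
    assume a: "g v \<in> cl (insert u C)"
    have f: "fs (insert u C)" "fs (insert (g v) C)" using C KV gV uv by auto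
    have "insert (g v) C \<subseteq> cl (insert u C)" using a cl_sup[OF f(1)] by auto
    then have "v \<in> cl (insert u C)" using cl_least[OF f] exch[OF uv(2)] by auto
    then show False using pair[OF uv] by simp
  qed
  have "\<exists>X. ss X \<and> insert v (insert (g v) C) \<subseteq> X \<and> dl X \<le> dm C + int n \<and> X \<subseteq> cl (insert v C)"
    if v: "v \<in> K" for v
  proof -
    have f: "fs (insert v C)" "v \<in> V" using C KV[OF v] by auto
    obtain X where X: "ss X" "insert v C \<union> {g v} \<subseteq> X" "dl X = dm (insert v C)" "X \<subseteq> cl (insert v C)"
      by (rule cl_ss_cover[OF f(1), of "{g v}"]) (use bd[OF f(2)] in auto)
    then show ?thesis using dm_insert_le[OF C f(2)] by (intro exI[of _ X]) auto
  qed
  then obtain X where X: "\<And>v. v \<in> K \<Longrightarrow> ss (X v) \<and> insert v (insert (g v) C) \<subseteq> X v \<and>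
      dl (X v) \<le> dm C + int n \<and> X v \<subseteq> cl (insert v C)" by metis
  define U where "U = (\<Union>v\<in>N. X v)"
  have U: "fs U" "C \<subseteq> U" "dl U \<le> dm C + int (r - 1) * int n"
    using delta_union_le[OF N(1) Nne, of X C "int n"] X N(2) ss_fs by (auto simp: U_def K_def)
  have XN: "v \<in> X v" "g v \<in> X v" if "v \<in> K" for v using X[OF that] by auto
  have bK: "b \<in> K" and NK: "\<And>v. v \<in> N \<Longrightarrow> v \<in> K \<and> v \<noteq> b" using bN by (auto simp: K_def)
  have Xb: "fs (X b)" "C \<subseteq> X b" "dl (X b) \<le> dm C + int n" using X[OF bK] ss_fs by auto
  obtain w where w: "w \<in> N" using Nne by auto
  have Xcl: "u \<notin> X v \<and> g u \<notin> X v" if "u \<in> K" "v \<in> K" "u \<noteq> v" for u v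
    using X[OF that(2)] pair[OF that(2,1)] gpair[OF that(2,1)] that(3) by auto
  have "b \<notin> X v \<and> g b \<notin> X v" if "v \<in> N" for v using Xcl[of b v] NK[OF that] bK by blast
  then have out: "b \<notin> U" "g b \<notin> U" "w \<notin> X b" "g w \<notin> X b"
    using Xcl[of w b] NK[OF w] bK by (auto simp: U_def)
  have "g ` K = K"
  proof (rule ccontr)
    assume ne: "g ` K \<noteq> K"
    \<comment> \<open>Both hyperedges cross between \<open>X b\<close> and the union \<open>U\<close> of the sets belonging to the other vertices.\<close>
    let ?cr = "{e \<in> E. e \<subseteq> U \<union> X b \<and> \<not> e \<subseteq> U \<and> \<not> e \<subseteq> X b}"
    have KE: "K \<in> E" using N(5) by (simp add: K_def)
    then have gKE: "g ` K \<in> E" using g by (simp only: aut_def)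
    have "K \<subseteq> U \<union> X b" "g ` K \<subseteq> U \<union> X b" using XN by (auto simp: K_def U_def)
    moreover have "\<not> K \<subseteq> U" "\<not> K \<subseteq> X b" "\<not> g ` K \<subseteq> U" "\<not> g ` K \<subseteq> X b"
      using out bK NK[OF w] by auto
    ultimately have "{K, g ` K} \<subseteq> ?cr" using KE gKE by simp
    moreover have "finite ?cr"
      by (rule finite_subset[of _ "Pow (U \<union> X b)"]) (use U Xb in \<open>auto simp: fs_finite\<close>)
    ultimately have "card {K, g ` K} \<le> card ?cr" by (intro card_mono)
    then have "2 \<le> card ?cr" using ne by simp
    then have c: "int m * 2 \<le> int m * int (card ?cr)" by (intro mult_left_mono) auto
    have "dm C \<le> dl (U \<inter> X b)" using U Xb by (intro dm_le) (auto intro: fs_Int)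
    moreover have "dm (C \<union> K) \<le> dl (U \<union> X b)" using U Xb XN by (intro dm_le) (auto simp: K_def U_def)
    moreover have "dm C + int n * int r - int m \<le> dm (C \<union> K)" using dimC[of K] K by simp
    moreover have "int (r - 1) * int n + int n = int n * int r"
      using r_ge_2 by (simp add: algebra_simps of_nat_diff)
    ultimately have "int m * 2 \<le> int m"
      using delta_modular[OF fs_finite[OF U(1)] fs_finite[OF Xb(1)]] c U(3) Xb(3) by linarith
    then show False using m_pos by simp
  qed
  then have "g b \<in> insert b N" using bK by (auto simp: K_def)
  then show ?thesis using bS(2) N(3) by auto
qed

text \<open>Let \<open>C\<close> be the union of \<open>B\<close> and \<open>g ` B\<close>. A basis of realizations of the type of \<open>y\<close> shows that \<open>g\<close>
  maps every \<open>x\<close> into the closure of \<open>C \<union> {x}\<close>, and so it fixes all elements of maximal dimension.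
  An element of smaller dimension lies on a hyperedge all of whose other vertices have larger
  dimension; by induction these are fixed, and no other vertex completes the hyperedge.\<close>

lemma bounded_trivial:
  assumes g: "aut g" and B: "fs B" "r + n + m \<le> card B"
    and y: "y \<in> V" "dm (insert y B) = dm B + 1"
    and bd: "\<And>p. p \<in> Stab B \<Longrightarrow> g (p y) \<in> cl (insert (p y) B)"
  shows "g = id"
proof -
  define C where "C = B \<union> g ` B"
  have C: "fs C" using B g by (simp add: C_def aut_fs)
  have bdC: "g x \<in> cl (insert x C)" if x: "x \<in> V" for x
  proof -
    have fx: "fs {x}" "fs (insert x C)" using x C by auto
    obtain ys where ys: "basis ys B" "set ys \<subseteq> cl (B \<union> {x})" "{x} \<subseteq> cl (B \<union> set ys)"
        "\<forall>v\<in>set ys. \<exists>p\<in>Stab B. v = p y"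
      using exists_basis[OF B y fx(1)] by metis
    have fys: "fs (set ys)" using basis_fs ys by blast
    have sub: "cl (B \<union> {x}) \<subseteq> cl (insert x C)" using fx by (intro cl_mono) (auto simp: C_def)
    have "g v \<in> cl (insert x C)" if v: "v \<in> set ys" for v
    proof -
      obtain p where "p \<in> Stab B" "v = p y" using ys v by auto
      then have "g v \<in> cl (insert v B)" using bd by simp
      moreover have "insert v B \<subseteq> cl (insert x C)"
        using v ys(2) sub cl_sup[OF fx(2)] by (auto simp: C_def)
      then have "cl (insert v B) \<subseteq> cl (insert x C)"
        using fx B fys v by (intro cl_least) (auto simp: fs_def)
      ultimately show ?thesis by auto
    qed
    moreover have "g ` B \<subseteq> cl (insert x C)" using cl_sup[OF fx(2)] by (auto simp: C_def)
    ultimately have "g ` (B \<union> set ys) \<subseteq> cl (insert x C)" by auto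
    then have "cl (g ` (B \<union> set ys)) \<subseteq> cl (insert x C)"
      using fx B fys g by (intro cl_least) (simp_all add: aut_fs)
    moreover have "g x \<in> cl (g ` (B \<union> set ys))" using aut_cl[OF g, of "B \<union> set ys" x] B fys ys(3) by simp
    ultimately show ?thesis by auto
  qed
  define C' where "C' = C \<union> iv g ` C"
  have C': "fs C'" using C g by (simp add: C'_def aut_fs aut_inv)
  have gV: "g v \<in> V" if "v \<in> V" for v using aut_V[OF g] that by simp
  have "g x = x" if "x \<in> V" "nat (dm C' + int n - dm (insert x C')) = k" for x k
    using that
  proof (induction k arbitrary: x rule: less_induct)
    case (less k)
    have xV: "x \<in> V" by fact
    show ?case
    proof (cases "dm C' + int n \<le> dm (insert x C')")
      case True
      then show ?thesis using bounded_fixes_generic[OF g C bdC xV] by (simp add: C'_def)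
    next
      case False
      have fS: "fs (insert x (insert (g x) C'))" using C' xV gV by simp
      obtain S where S: "ss S" "insert x (insert (g x) C') \<subseteq> S" by (rule dm_attained[OF fS])
      then have xS: "x \<in> S" "g x \<in> S" "C' \<subseteq> S" by auto
      obtain N where N: "finite N" "card N = r - 1" "N \<inter> S = {}" "ss (S \<union> N)" "insert x N \<in> E"
        "\<And>e. e \<in> E \<Longrightarrow> e \<subseteq> S \<union> N \<Longrightarrow> e \<subseteq> S \<or> e = insert x N"
        "\<And>S' N'. S' \<subseteq> S \<Longrightarrow> N' \<subseteq> N \<Longrightarrow> dl (S' \<union> N') =
           dl S' + int n * int (card N') - (if x \<in> S' \<and> N' = N then int m else 0)"
        using add_edge[OF S(1) xS(1)] by metis
      have Nne: "N \<noteq> {}" using N r_ge_2 by auto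
      have fixN: "g v = v" if v: "v \<in> N" for v
      proof -
        have vV: "v \<in> V" using v ss_fs[OF N(4)] by (auto simp: fs_def)
        have "dm (insert x C') + 1 \<le> dm (insert v C')"
        proof (rule dm_ge[OF N(4)])
          show "insert v C' \<subseteq> S \<union> N" using v xS by auto
          fix T assume T: "insert v C' \<subseteq> T" "T \<subseteq> S \<union> N"
          have "T = (T \<inter> S) \<union> (T \<inter> N)" using T by auto
          then have dT: "dl T = dl (T \<inter> S) + int n * int (card (T \<inter> N)) -
              (if x \<in> T \<inter> S \<and> T \<inter> N = N then int m else 0)"
            using N(7)[of "T \<inter> S" "T \<inter> N"] by simp
          have fT: "fs (T \<inter> S)" using fs_Int(2)[OF ss_fs[OF S(1)]] .
          show "dm (insert x C') + 1 \<le> dl T"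
          proof (cases "x \<in> T \<inter> S \<and> T \<inter> N = N")
            case True
            have "dm (insert x C') \<le> dl (T \<inter> S)" using True fT T xS by (intro dm_le) auto
            moreover have "int m < int n * int (r - 1)"
              using edge_positive by (metis mult.commute of_nat_less_iff of_nat_mult)
            moreover have "dl T = dl (T \<inter> S) + int n * int (r - 1) - int m"
              using dT True N(2) by (simp del: One_nat_def of_nat_diff)
            ultimately show ?thesis by linarith
          next
            case F: False
            have "dm C' \<le> dl (T \<inter> S)" using fT T xS by (intro dm_le) auto
            moreover have "1 \<le> card (T \<inter> N)" using T v N(1) by (simp add: Suc_le_eq card_gt_0_iff) blast
            then have "int n * 1 \<le> int n * int (card (T \<inter> N))" by (intro mult_left_mono) auto
            moreover have "dl T = dl (T \<inter> S) + int n * int (card (T \<inter> N))"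
              unfolding dT if_not_P[OF F] by simp
            ultimately show ?thesis using False by linarith
          qed
        qed
        then have "nat (dm C' + int n - dm (insert v C')) < k" using less.prems(2) False by linarith
        then show ?thesis using less.IH vV by blast
      qed
      have "g ` N = N" using image_cong[OF refl fixN, of N] by simp
      then have gN: "g ` insert x N = insert (g x) N" by simp
      have "g ` insert x N \<in> E" using N(5) g by (simp only: aut_def)
      then have "insert (g x) N \<in> E" using gN by simp
      moreover have "insert (g x) N \<subseteq> S \<union> N" "\<not> insert (g x) N \<subseteq> S" using xS Nne N(3) by auto
      ultimately have "insert (g x) N = insert x N" using N(6) by blast
      then show ?thesis using xS N(3) by auto
    qed
  qed
  then have "g x = x" for x using g by (cases "x \<in> V") (auto simp: aut_def)
  then show ?thesis by auto
qed

text \<open>The members of the basis are moved one after the other, each time independently from all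
  elements and images obtained before. For a single element of dimension one this is possible by
  \<open>bounded_trivial\<close>.\<close>

lemma moves_basis:
  assumes g: "aut g" "g \<noteq> id"
  shows "basis ys B \<Longrightarrow> fs B \<Longrightarrow> r + n + m \<le> card B \<Longrightarrow>
    \<exists>p\<in>Stab B. dm B + 2 * int (length ys) \<le> dm (B \<union> p ` set ys \<union> g ` p ` set ys)"
proof (induction "length ys" arbitrary: ys B)
  case 0
  then show ?case by (intro bexI[of _ id]) (auto simp: Stab_id)
next
  case (Suc k ys0 B)
  then obtain y ys where ys0: "ys0 = y # ys" "length ys = k" by (cases ys0) auto
  have y: "y \<in> V" "dm (insert y B) = dm B + 1" "basis ys (insert y B)" using Suc.prems ys0 by auto
  obtain p1 where p1: "p1 \<in> Stab B" "g (p1 y) \<notin> cl (insert (p1 y) B)"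
    using bounded_trivial[OF g(1) Suc.prems(2,3) y(1,2)] g(2) by metis
  define z where "z = p1 y"
  have a1: "aut p1" using Stab_aut p1 by blast
  have zV: "z \<in> V" "g z \<in> V" using aut_V[OF a1] aut_V[OF g(1)] y by (auto simp: z_def)
  have p1B: "p1 ` insert y B = insert z B"
    using Stab_image[OF p1(1) cl_sup[OF Suc.prems(2)]] by (simp add: z_def)
  have fy: "fs (insert y B)" "fs (insert z B)" using y zV Suc.prems by auto
  have b1: "basis (map p1 ys) (insert z B)" using basis_aut[OF y(3) a1 fy(1)] p1B by simp
  have dz: "dm (insert z B) = dm B + 1" using aut_dm[OF a1 fy(1)] p1B y by simp
  define B' where "B' = insert (g z) (insert z B)"
  have B': "fs B'" "insert z B \<subseteq> B'" using zV fy by (auto simp: B'_def)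
  have "dm B' \<noteq> dm (insert z B)" using p1(2) zV by (simp add: B'_def z_def cl_def)
  moreover have "dm (insert z B) \<le> dm B'" using B' by (intro dm_mono)
  ultimately have dB': "dm B + 2 \<le> dm B'" using dz by simp
  obtain p2 where p2: "p2 \<in> Stab (insert z B)" "ind (insert z B) (p2 ` set (map p1 ys)) B'"
    by (rule independent_copy[OF fy(2) basis_fs[OF b1] B'(1)])
  define zs where "zs = map p2 (map p1 ys)"
  have zs: "set zs = p2 ` p1 ` set ys" "length zs = k" using ys0 by (auto simp: zs_def)
  have "ind (insert z B) (set zs) B'" using p2(2) by (simp add: zs_def image_image)
  then have bz: "basis zs B'"
    using basis_ind[OF basis_Fx[OF b1 p2(1) fy(2)] _ B'] by (simp only: zs_def)
  have cB': "r + n + m \<le> card B'"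
    using Suc.prems(3) card_mono[of B' B] B' by (auto simp: fs_finite)
  obtain p3 where p3: "p3 \<in> Stab B'" "dm B' + 2 * int (length zs) \<le> dm (B' \<union> p3 ` set zs \<union> g ` p3 ` set zs)"
    using Suc.hyps(1)[OF _ bz B'(1) cB'] zs(2) by auto
  define p where "p = p3 \<circ> (p2 \<circ> p1)"
  have "p3 \<in> Stab B" "p2 \<in> Stab B"
    using Stab_mono[OF B'(1) _ p3(1), of B] Stab_mono[OF fy(2) _ p2(1), of B] B'(2) by auto
  then have p: "p \<in> Stab B" unfolding p_def using p1(1) by (intro Stab_comp)
  have "p2 z = z" using Stab_fixes[OF p2(1)] cl_sup[OF fy(2)] by auto
  moreover have "p3 z = z" using Stab_fixes[OF p3(1)] cl_sup[OF B'(1)] B'(2) by auto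
  ultimately have "p y = z" by (simp add: p_def z_def)
  then have "p ` set ys0 = insert z (p3 ` set zs)" by (auto simp: ys0 zs p_def image_comp)
  then have "B \<union> p ` set ys0 \<union> g ` p ` set ys0 = B' \<union> p3 ` set zs \<union> g ` p3 ` set zs"
    by (auto simp: B'_def)
  then show ?case using p3(2) dB' zs(2) ys0 by (intro bexI[OF _ p]) simp
qed

text \<open>A basis of the closure of \<open>X\<close> is moved in place of \<open>X\<close>. To bound the dimension of its image
  under \<open>g\<close>, it is first made independent from \<open>A \<union> g ` A\<close>.\<close>

lemma moves_independently:
  assumes g: "aut g" "g \<noteq> id" and A: "fs A" and X: "fs X"
  obtains p where "p \<in> Stab A" "ind A (p ` X) (g ` p ` X)"
proof -
  obtain A0 where A0: "fs A0" "A \<subseteq> A0" "r + n + m \<le> card A0" by (rule enlarge[OF A])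
  obtain p0 where p0: "p0 \<in> Stab A" "ind A (p0 ` X) A0" by (rule independent_copy[OF A X A0(1)])
  define X0 where "X0 = p0 ` X"
  have X0: "fs X0" using Stab_aut[OF p0(1)] X by (simp add: X0_def aut_fs)
  \<comment> \<open>The basis consists of realizations of the type of \<open>y0\<close>.\<close>
  obtain y0 where y0: "y0 \<in> V" "dm (insert y0 A0) = dm A0 + 1" by (rule exists_dim_one[OF A0(1,3)])
  obtain ys where ys: "basis ys A0" "set ys \<subseteq> cl (A0 \<union> X0)" "X0 \<subseteq> cl (A0 \<union> set ys)"
    using exists_basis[OF A0(1,3) y0 X0] by metis
  have fys: "fs (set ys)" using basis_fs ys(1) .
  define A1 where "A1 = A0 \<union> g ` A0"
  have A1: "fs A1" "A0 \<subseteq> A1" using A0 g by (auto simp: A1_def aut_fs)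
  obtain p1 where p1: "p1 \<in> Stab A0" "ind A0 (p1 ` set ys) A1"
    by (rule independent_copy[OF A0(1) fys A1(1)])
  have b1: "basis (map p1 ys) A1"
    using basis_ind[OF basis_Fx[OF ys(1) p1(1) A0(1)]] p1(2) A1 by simp
  have cA1: "r + n + m \<le> card A1" using A0(3) card_mono[OF fs_finite[OF A1(1)] A1(2)] by simp
  obtain p2 where p2: "p2 \<in> Stab A1"
    "dm A1 + 2 * int (length ys) \<le> dm (A1 \<union> p2 ` p1 ` set ys \<union> g ` p2 ` p1 ` set ys)"
    using moves_basis[OF g b1 A1(1) cA1] by auto
  define Y where "Y = p2 ` p1 ` set ys"
  have fp1: "fs (p1 ` set ys)" using Stab_aut[OF p1(1)] fys by (simp add: aut_fs)
  have fY: "fs Y" "fs (g ` Y)" using Stab_aut[OF p2(1)] fp1 g by (auto simp: Y_def aut_fs)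
  have dY: "dm (A1 \<union> Y) = dm A1 + int (length ys)"
    using Stab_dm[OF p2(1) A1(1) fp1] basis_dm[OF b1] by (simp add: Y_def)
  have p20: "p2 \<in> Stab A0" using Stab_mono[OF A1 p2(1)] .
  have dY0: "dm (A0 \<union> Y) = dm A0 + int (length ys)"
    using Stab_dm[OF p20 A0(1) fp1] Stab_dm[OF p1(1) A0(1) fys] basis_dm[OF ys(1)] by (simp add: Y_def)
  have "dm (g ` A0 \<union> g ` Y) = dm A0 + int (length ys)" "dm (g ` A0) = dm A0"
    using aut_dm[OF g(1), of "A0 \<union> Y"] aut_dm[OF g(1) A0(1)] dY0 A0 fY by (auto simp: image_Un)
  moreover have "dm (A1 \<union> (g ` A0 \<union> g ` Y)) + dm (g ` A0) \<le> dm A1 + dm (g ` A0 \<union> g ` Y)"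
    using A1 A0 fY g by (intro dm_submodular) (auto simp: aut_fs A1_def)
  moreover have "A1 \<union> (g ` A0 \<union> g ` Y) = A1 \<union> g ` Y" by (auto simp: A1_def)
  ultimately have "dm (A1 \<union> g ` Y) \<le> dm A1 + int (length ys)" by simp
  then have i1: "ind A1 Y (g ` Y)" using p2(2) dY A1 fY by (subst ind_iff) (auto simp: Y_def)
  have "ind A0 Y A1" using Stab_ind[OF p2(1) A1(2,1) fp1] p1(2) by (simp add: Y_def)
  then have i0: "ind A0 Y (A1 \<union> g ` Y)"
    by (rule ind_trans) (use i1 A1 in \<open>simp add: Un_absorb1\<close>)
  define p where "p = p2 \<circ> p1"
  have p: "p \<in> Stab A0" unfolding p_def using p20 p1(1) by (rule Stab_comp)
  define X1 where "X1 = p ` X0"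
  have X1: "fs X1" "fs (g ` X1)" using Stab_aut[OF p] X0 g by (auto simp: X1_def aut_fs)
  have pA0: "p ` (A0 \<union> set ys) = A0 \<union> Y"
    using Stab_image_Un[OF p A0(1)] by (simp add: p_def Y_def image_comp)
  have cX1: "X1 \<subseteq> cl (A0 \<union> Y)"
  proof -
    have "p ` X0 \<subseteq> p ` cl (A0 \<union> set ys)" using ys(3) by (rule image_mono)
    then show ?thesis using aut_cl_image[OF Stab_aut[OF p], of "A0 \<union> set ys"] A0 fys pA0 by (simp add: X1_def)
  qed
  have "g ` X1 \<subseteq> g ` cl (A0 \<union> Y)" using cX1 by (rule image_mono)
  also have "\<dots> = cl (g ` A0 \<union> g ` Y)"
    using aut_cl_image[OF g(1), of "A0 \<union> Y"] A0 fY by (simp add: image_Un)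
  also have "\<dots> \<subseteq> cl (A0 \<union> (A1 \<union> g ` Y))" using A0 A1 fY by (intro cl_mono) (auto simp: A1_def)
  finally have cgX: "g ` X1 \<subseteq> cl (A0 \<union> (A1 \<union> g ` Y))" .
  have "ind A0 Y (g ` X1)"
    by (rule ind_cl[OF i0 A0(1) fY(1)]) (use A1 fY X1 cgX in \<open>auto simp: fs_finite\<close>)
  then have "ind A0 (g ` X1) Y" by (simp add: ind_sym)
  then have "ind A0 (g ` X1) X1"
    by (rule ind_cl) (use A0 fY X1 cX1 in \<open>auto simp: fs_finite\<close>)
  then have i2: "ind A0 X1 (g ` X1)" by (simp add: ind_sym)
  have "ind A X1 A0" using Stab_ind[OF p A0(2,1) X0] p0(2) by (simp add: X1_def X0_def)
  then have "ind A X1 (A0 \<union> g ` X1)" by (rule ind_trans) (use i2 A0 in \<open>simp add: Un_absorb1\<close>)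
  then have "ind A X1 (g ` X1)" by (rule ind_mono) (use A A0 X1 in auto)
  moreover have "p \<circ> p0 \<in> Stab A" using Stab_mono[OF A0(1,2) p] p0(1) by (rule Stab_comp)
  moreover have "(p \<circ> p0) ` X = X1" by (simp add: X1_def X0_def image_comp)
  ultimately show ?thesis using that[of "p \<circ> p0"] by simp
qed

end

section \<open>Products of conjugates\<close>

context hrushovski_generic
begin

definition cj :: "('a \<Rightarrow> 'a) \<Rightarrow> ('a \<Rightarrow> 'a) \<Rightarrow> 'a \<Rightarrow> 'a" where
  "cj a f = a \<circ> f \<circ> iv a"

lemma cj_apply: "cj a f v = a (f (iv a v))"
  by (simp add: cj_def)

lemma aut_cj: "aut a \<Longrightarrow> aut f \<Longrightarrow> aut (cj a f)"
  by (simp add: cj_def aut_comp aut_inv)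

lemma iv_eqI: assumes "aut p" "p x = y" shows "iv p y = x"
  using assms by auto

lemma iv_comp: assumes "aut p" "aut q" shows "iv (p \<circ> q) = iv q \<circ> iv p"
proof
  fix x show "iv (p \<circ> q) x = (iv q \<circ> iv p) x"
    by (rule iv_eqI[OF aut_comp[OF assms]]) (use assms in simp)
qed

lemma iv_cj: assumes "aut a" "aut f" shows "iv (cj a f) = cj a (iv f)"
proof
  fix x show "iv (cj a f) x = cj a (iv f) x"
    by (rule iv_eqI[OF aut_cj[OF assms]]) (use assms in \<open>simp add: cj_apply\<close>)
qed

lemma cj_cj: "aut a \<Longrightarrow> aut k \<Longrightarrow> cj a (cj k g) = cj (a \<circ> k) g"
  by (simp add: cj_def iv_comp comp_assoc)

lemma cj_nontrivial: assumes "aut a" "aut f" "f \<noteq> id" shows "cj a f \<noteq> id"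
proof
  assume c: "cj a f = id"
  have "f x = x" for x
  proof -
    have "a (f x) = a x" using fun_cong[OF c, of "a x"] assms by (simp add: cj_apply)
    then show ?thesis using aut_inj[OF assms(1), of UNIV] by (auto dest: injD)
  qed
  then show False using assms(3) by auto
qed

lemma iv_nontrivial: assumes "aut f" "f \<noteq> id" shows "iv f \<noteq> id"
proof
  assume "iv f = id"
  then have "f x = x" for x using aut_inv_apply(2)[OF assms(1), of x] by simp
  then show False using assms(2) by auto
qed

lemma cj_fixed:
  assumes "a \<in> Stab A" "u \<in> cl A" "f u \<in> cl A" shows "cj a f u = f u"
  using Stab_fixes[OF assms(1,3)] Stab_fixes[OF Stab_inv[OF assms(1)] assms(2)] by (simp add: cj_apply)

text \<open>Some realization of the type of \<open>X\<close> is moved independently from itself; carry it back to \<open>X\<close>, and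
  then move the image away from \<open>B\<close>.\<close>

lemma conjugate_image_independent:
  assumes f: "aut f" "f \<noteq> id" and A: "fs A" and X: "fs X" and B: "fs B"
  obtains a where "a \<in> Stab A" "ind A (cj a f ` X) (X \<union> B)"
proof -
  obtain s where s: "s \<in> Stab A" "ind A (s ` X) (f ` s ` X)"
    using moves_independently[OF f A X] by metis
  have as: "aut s" "aut (iv s)" using Stab_aut s Stab_inv by blast+
  define U where "U = iv s ` f ` s ` X"
  have U: "fs U" using as f X by (simp add: U_def aut_fs)
  have "iv s ` A = A" using Stab_image[OF Stab_inv[OF s(1)] cl_sup[OF A]] .
  then have "ind (iv s ` A) (iv s ` s ` X) (iv s ` f ` s ` X) \<longleftrightarrow> ind A X U"
    using as by (simp add: U_def)
  then have i1: "ind A X U"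
    using ind_aut[OF as(2) A, of "s ` X" "f ` s ` X"] s(2) as f X by (simp add: aut_fs)
  have AX: "fs (A \<union> X)" using A X by simp
  obtain q where q: "q \<in> Stab (A \<union> X)" "ind (A \<union> X) (q ` U) B"
    by (rule independent_copy[OF AX U B])
  have aq: "aut q" using Stab_aut q(1) .
  have qA: "q ` A = A" "q ` X = X" using cl_sup[OF AX] by (auto intro!: Stab_image[OF q(1)])
  have ivqX: "iv q ` X = X" using cl_sup[OF AX] by (intro Stab_image[OF Stab_inv[OF q(1)]]) auto
  have "ind A X (q ` U)" using ind_aut[OF aq A X U] i1 qA by simp
  then have "ind A (q ` U) X" by (simp add: ind_sym)
  then have i2: "ind A (q ` U) (X \<union> B)" using q(2) by (rule ind_trans)
  define a where "a = q \<circ> iv s"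
  have qF: "q \<in> Stab A" using Stab_mono[OF AX _ q(1)] by simp
  have a: "a \<in> Stab A" unfolding a_def using qF Stab_inv[OF s(1)] by (rule Stab_comp)
  have "cj a f = (\<lambda>x. q (iv s (f (s (iv q x)))))"
    using aq as by (simp add: cj_def a_def iv_comp aut_inv_inv fun_eq_iff)
  then have "cj a f ` X = q ` iv s ` f ` s ` iv q ` X" by (simp add: image_image)
  then have "cj a f ` X = q ` U" using ivqX by (simp add: U_def)
  then show ?thesis using that[OF a] i2 by simp
qed

text \<open>Choosing a realization \<open>Y\<close> of the type of \<open>X\<close> independent from \<open>iv f ` A\<close> as well, its image \<open>f ` Y\<close>
  becomes independent from \<open>A \<union> Y\<close> over \<open>f ` X1\<close>. So \<open>Y, f ` Y\<close> and \<open>X, q ` X\<close> are in the same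
  position over \<open>A\<close>, and by stationarity an automorphism over \<open>A\<close> maps the first pair to the
  second.\<close>

lemma conjugate_agrees:
  assumes f: "aut f" "f \<noteq> id" and X1: "fs X1" and A: "A = X1 \<union> f ` X1"
    and X: "fs X" and q: "aut q" "\<And>v. v \<in> cl X1 \<Longrightarrow> q v = f v"
    and i1: "ind X1 X A" and i2: "ind (f ` X1) (q ` X) (A \<union> X)"
  obtains a where "a \<in> Stab A" "\<And>v. v \<in> cl (X1 \<union> X) \<Longrightarrow> cj a f v = q v"
proof -
  define X2 where "X2 = f ` X1"
  have fX2: "fs X2" using f X1 by (simp add: X2_def aut_fs)
  have fA: "fs A" "X1 \<subseteq> A" "X2 \<subseteq> A" using A X1 fX2 by (auto simp: X2_def)
  define B where "B = A \<union> iv f ` A"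
  have B: "fs B" "A \<subseteq> B" using fA f by (auto simp: B_def aut_fs aut_inv)
  have AB: "A \<subseteq> f ` B" using f by (auto simp: B_def image_Un)
  obtain s0 where s0: "s0 \<in> Stab A" "ind A (s0 ` X) B" by (rule independent_copy[OF fA(1) X B(1)])
  have s0X: "fs (s0 ` X)" using Stab_aut[OF s0(1)] X by (simp add: aut_fs)
  obtain s1 where s1: "s1 \<in> Stab B" "ind B (s1 ` s0 ` X) (f ` s1 ` s0 ` X)"
    using moves_independently[OF f B(1) s0X] by metis
  define s where "s = s1 \<circ> s0"
  have s1A: "s1 \<in> Stab A" using Stab_mono[OF B s1(1)] .
  have s: "s \<in> Stab A" unfolding s_def using s1A s0(1) by (rule Stab_comp)
  have as: "aut s" "aut (iv s)" using Stab_aut s Stab_inv by blast+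
  define Y where "Y = s ` X"
  have Ydef: "Y = s1 ` s0 ` X" by (simp add: Y_def s_def image_comp)
  have Y: "fs Y" "fs (f ` Y)" using as X f by (simp_all add: Y_def aut_fs)
  have j1: "ind X1 Y A" using Stab_ind[OF s fA(2,1) X] i1 by (simp add: Y_def)
  have j2: "ind A Y B" using Stab_ind[OF s1(1) B(2,1) s0X] s0(2) by (simp add: Ydef)
  have "ind X1 Y (A \<union> B)" by (rule ind_trans[OF j1]) (use j2 fA in \<open>simp add: Un_absorb1\<close>)
  then have j3: "ind X1 Y B" using B by (simp add: Un_absorb1)
  have "ind X1 Y (B \<union> f ` Y)"
    by (rule ind_trans[OF j3]) (use s1(2) fA B in \<open>simp add: Ydef Un_absorb1\<close>)
  then have "ind X1 Y (A \<union> f ` Y)" by (rule ind_mono) (use X1 Y B fA in auto)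
  then have "ind (X1 \<union> A) Y (f ` Y)" by (rule ind_base) (use X1 Y fA in auto)
  then have j4: "ind A (f ` Y) Y" using fA by (simp add: Un_absorb1 ind_sym)
  have "ind X2 (f ` Y) (f ` B)" using ind_aut[OF f(1) X1 Y(1) B(1)] j3 by (simp add: X2_def)
  then have "ind X2 (f ` Y) A" by (rule ind_mono) (use AB fX2 Y B f in \<open>auto simp: aut_fs\<close>)
  then have j5: "ind X2 (f ` Y) (A \<union> Y)"
    by (rule ind_trans) (use j4 fA in \<open>simp add: Un_absorb1\<close>)
  define h where "h = (\<lambda>x. iv s (f (s x)))"
  have "h = iv s \<circ> (f \<circ> s)" by (auto simp: h_def)
  then have h: "aut h" using as f by (simp add: aut_comp)
  have hX: "h ` X = iv s ` f ` Y" by (simp add: h_def Y_def image_image)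
  have fix_s: "s ` X1 = X1" "iv s ` X2 = X2" "iv s ` A = A"
    using cl_sup[OF fA(1)] fA by (auto intro!: Stab_image[OF s] Stab_image[OF Stab_inv[OF s]])
  have hX1: "h ` X1 = X2"
  proof -
    have "h ` X1 = iv s ` f ` s ` X1" by (simp add: h_def image_image)
    then show ?thesis using fix_s by (simp add: X2_def)
  qed
  have "ind (iv s ` X2) (iv s ` f ` Y) (iv s ` (A \<union> Y))"
    using ind_aut[OF as(2) fX2 Y(2), of "A \<union> Y"] j5 fA Y by simp
  then have k1: "ind X2 (h ` X) (A \<union> X)" using fix_s as hX by (simp add: image_Un Y_def)
  define u where "u = q \<circ> iv h"
  have u: "u \<in> Stab X2"
  proof -
    have "u v = v" if v: "v \<in> cl X2" for v
    proof -
      have "v \<in> cl (h ` X1)" using v hX1 by simp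
      then have w: "iv h v \<in> cl X1" using aut_cl[OF h X1, of "iv h v"] h by simp
      have "s (iv h v) = iv h v" using Stab_fixes[OF s] w cl_mono[OF fA(1,2)] by auto
      then have "h (iv h v) = iv s (f (iv h v))" by (simp add: h_def)
      then have "s v = f (iv h v)" using h as by (metis aut_inv_apply(2))
      moreover have "s v = v" using Stab_fixes[OF s] v cl_mono[OF fA(1,3)] by auto
      ultimately show ?thesis using q(2)[OF w] by (simp add: u_def)
    qed
    then show ?thesis using q h by (simp add: Stab_def u_def aut_comp aut_inv)
  qed
  have uX: "u ` h ` X = q ` X" using h by (simp add: u_def image_image)
  have fhX: "fs (h ` X)" "fs (A \<union> X)" using h X fA by (auto simp: aut_fs)
  have k2: "ind X2 (u ` h ` X) (A \<union> X)" using i2 uX by (simp add: X2_def)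
  obtain w where w: "w \<in> Stab (X2 \<union> (A \<union> X))" "\<And>v. v \<in> cl (X2 \<union> h ` X) \<Longrightarrow> w v = u v"
    using stationarity[OF fX2 fhX u k1 k2] by metis
  have fW: "fs (X2 \<union> (A \<union> X))" using fX2 fhX by simp
  have aw: "aut w" using Stab_aut w(1) .
  define a where "a = w \<circ> iv s"
  have "w \<in> Stab A" using Stab_mono[OF fW _ w(1)] by auto
  then have a: "a \<in> Stab A" unfolding a_def using Stab_inv[OF s] by (rule Stab_comp)
  have "cj a f v = q v" if v: "v \<in> cl (X1 \<union> X)" for v
  proof -
    have "v \<in> cl (X2 \<union> (A \<union> X))" using v cl_mono[OF fW, of "X1 \<union> X"] fA by auto
    then have "iv w v = v" using Stab_fixes[OF Stab_inv[OF w(1)]] by simp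
    then have "cj a f v = w (h v)" using aw as by (simp add: cj_apply a_def iv_comp aut_inv_inv h_def)
    moreover have "h v \<in> cl (X2 \<union> h ` X)"
      using v aut_cl[OF h, of "X1 \<union> X" v] X1 X hX1 by (simp add: image_Un)
    ultimately have "cj a f v = u (h v)" using w(2) by simp
    then show ?thesis using h by (simp add: u_def)
  qed
  then show ?thesis using that[OF a] by simp
qed

text \<open>The first and the last conjugate bring the images of \<open>X\<close> and the preimages of \<open>p ` X\<close> into general
  position, whatever the position of \<open>X\<close> and \<open>p ` X\<close> themselves. Then \<open>conjugate_agrees\<close> lets the
  middle conjugate connect them.\<close>

lemma three_conjugates:
  assumes f: "aut f1" "f1 \<noteq> id" "aut f2" "f2 \<noteq> id" "aut f3" "f3 \<noteq> id"
    and X1: "fs X1" and eq: "X2 = f2 ` X1" "X0 = iv f1 ` X1" "X3 = f3 ` X2"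
      "A1 = X0 \<union> X1" "A2 = X1 \<union> X2" "A3 = X2 \<union> X3"
    and i1: "ind X1 X0 (A2 \<union> A3)" and i2: "ind X2 X3 A2"
    and p: "aut p" "\<And>v. v \<in> cl X0 \<Longrightarrow> p v = f3 (f2 (f1 v))" and X: "fs X"
  obtains a1 a2 a3 where "a1 \<in> Stab A1" "a2 \<in> Stab A2" "a3 \<in> Stab A3"
    "\<And>v. v \<in> cl (X0 \<union> X) \<Longrightarrow> cj a3 f3 (cj a2 f2 (cj a1 f1 v)) = p v"
proof -
  have fX: "fs X2" "fs X0" "fs X3" using X1 f eq by (auto simp: aut_fs aut_inv)
  have fA: "fs A1" "fs A2" "fs A3" using fX X1 eq by auto
  have sub: "X1 \<subseteq> A1" "X0 \<subseteq> A1" "X1 \<subseteq> A2" "X2 \<subseteq> A2" "X2 \<subseteq> A3" using eq by auto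
  have pX: "fs (p ` X)" using p X by (simp add: aut_fs)
  have fB: "fs (A2 \<union> A3)" using fA by simp
  obtain a1 where a1: "a1 \<in> Stab A1" "ind A1 (cj a1 f1 ` X) (X \<union> (A2 \<union> A3))"
    by (rule conjugate_image_independent[OF f(1,2) fA(1) X fB])
  define e1 where "e1 = cj a1 f1"
  have e1: "aut e1" using f Stab_aut[OF a1(1)] by (simp add: e1_def aut_cj)
  define Y1 where "Y1 = e1 ` X"
  have Y1: "fs Y1" using e1 X by (simp add: Y1_def aut_fs)
  have fB3: "fs (A2 \<union> Y1)" using fA Y1 by simp
  obtain a3 where a3: "a3 \<in> Stab A3" "ind A3 (cj a3 (iv f3) ` p ` X) (p ` X \<union> (A2 \<union> Y1))"
    by (rule conjugate_image_independent[OF aut_inv[OF f(5)] iv_nontrivial[OF f(5,6)] fA(3) pX fB3])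
  define e3 where "e3 = cj a3 f3"
  have e3: "aut e3" using f Stab_aut[OF a3(1)] by (simp add: e3_def aut_cj)
  have ive3: "iv e3 = cj a3 (iv f3)" unfolding e3_def using Stab_aut[OF a3(1)] f(5) by (rule iv_cj)
  define q where "q = (\<lambda>v. iv e3 (p (iv e1 v)))"
  have "q = iv e3 \<circ> (p \<circ> iv e1)" by (auto simp: q_def)
  then have aq: "aut q" using e3 e1 p by (simp add: aut_comp aut_inv)
  have qY: "q ` Y1 = cj a3 (iv f3) ` p ` X"
    unfolding Y1_def using e1 by (simp add: q_def image_image ive3)
  define Y2 where "Y2 = q ` Y1"
  have Y2: "fs Y2" using aq Y1 by (simp add: Y2_def aut_fs)
  \<comment> \<open>\<open>Y1\<close> is independent from \<open>A2 \<union> A3\<close> over \<open>X1\<close>, although \<open>X\<close> need not be.\<close>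
  have "ind A1 Y1 (A2 \<union> A3)"
    by (rule ind_mono[OF a1(2)[folded e1_def, folded Y1_def]]) (use fA X Y1 in auto)
  then have j1: "ind (X1 \<union> A1) (A2 \<union> A3) Y1" using sub by (simp add: Un_absorb1 ind_sym)
  have "X1 \<union> A1 = X1 \<union> X0" using eq by auto
  then have "ind X1 A1 (A2 \<union> A3)" using i1 by (simp add: ind_def)
  then have "ind X1 (A2 \<union> A3) A1" by (simp add: ind_sym)
  then have "ind X1 (A2 \<union> A3) (A1 \<union> Y1)" using j1 by (rule ind_trans)
  then have "ind X1 (A2 \<union> A3) Y1" by (rule ind_mono) (use X1 fA Y1 in auto)
  then have j2: "ind X1 Y1 (A2 \<union> A3)" by (simp add: ind_sym)
  have j3: "ind X1 Y1 A2" by (rule ind_mono[OF j2]) (use X1 fA Y1 in auto)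
  have "ind (X1 \<union> A2) Y1 A3" by (rule ind_base[OF j2]) (use X1 fA Y1 in auto)
  then have "ind (X2 \<union> A2) A3 Y1" using sub by (simp add: Un_absorb1 ind_sym)
  moreover have "X2 \<union> A3 = X2 \<union> X3" using eq by auto
  then have "ind X2 A3 A2" using i2 by (simp add: ind_def)
  ultimately have "ind X2 A3 (A2 \<union> Y1)" using ind_trans by blast
  then have j4: "ind X2 (A2 \<union> Y1) A3" by (simp add: ind_sym)
  have "ind A3 Y2 (A2 \<union> Y1)"
    by (rule ind_mono[OF a3(2)[folded qY, folded Y2_def]]) (use fA pX Y1 Y2 in auto)
  then have "ind (X2 \<union> A3) (A2 \<union> Y1) Y2" using sub by (simp add: Un_absorb1 ind_sym)
  with j4 have "ind X2 (A2 \<union> Y1) (A3 \<union> Y2)" by (rule ind_trans)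
  then have "ind X2 (A2 \<union> Y1) Y2" by (rule ind_mono) (use fX fA Y1 Y2 in auto)
  then have j5: "ind (f2 ` X1) (q ` Y1) (A2 \<union> Y1)" by (simp add: ind_sym Y2_def eq(1))
  have qf2: "q v = f2 v" if v: "v \<in> cl X1" for v
  proof -
    have X0cl: "iv f1 v \<in> cl X0" using v aut_cl[OF aut_inv[OF f(1)] X1] by (simp add: eq(2))
    have vA: "v \<in> cl A1" "iv f1 v \<in> cl A1" using v X0cl cl_mono[OF fA(1)] sub by auto
    have "iv e1 v = iv f1 v"
      using cj_fixed[of a1 A1 v "iv f1", OF a1(1) vA] iv_cj[OF Stab_aut[OF a1(1)] f(1)] by (simp add: e1_def)
    then have "p (iv e1 v) = f3 (f2 v)" using p(2)[OF X0cl] f by simp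
    moreover have f2v: "f2 v \<in> cl X2" using v aut_cl[OF f(3) X1] by (simp add: eq(1))
    then have "f3 (f2 v) \<in> cl X3" using aut_cl[OF f(5) fX(1)] by (simp add: eq(3))
    then have "f2 v \<in> cl A3" "f3 (f2 v) \<in> cl A3" using f2v cl_mono[OF fA(3)] eq(6) by auto
    then have "e3 (f2 v) = f3 (f2 v)" using cj_fixed[of a3 A3 "f2 v" f3, OF a3(1)] by (simp add: e3_def)
    then have "iv e3 (f3 (f2 v)) = f2 v" using e3 by (metis aut_inv_apply(1))
    ultimately show ?thesis by (simp add: q_def)
  qed
  have A2: "A2 = X1 \<union> f2 ` X1" using eq by simp
  obtain a2 where a2: "a2 \<in> Stab A2" "\<And>v. v \<in> cl (X1 \<union> Y1) \<Longrightarrow> cj a2 f2 v = q v"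
    using conjugate_agrees[OF f(3,4) X1 A2 Y1 aq qf2 j3 j5] by metis
  have "cj a3 f3 (cj a2 f2 (cj a1 f1 v)) = p v" if v: "v \<in> cl (X0 \<union> X)" for v
  proof -
    have "e1 x = f1 x" if x: "x \<in> X0" for x
    proof -
      have "x \<in> cl A1" using cl_sup[OF fA(1)] sub x by auto
      moreover have "f1 x \<in> X1" using x f eq(2) by auto
      then have "f1 x \<in> cl A1" using cl_sup[OF fA(1)] sub by auto
      ultimately show ?thesis using cj_fixed[of a1 A1 x f1, OF a1(1)] by (simp add: e1_def)
    qed
    then have "e1 ` X0 = f1 ` X0" by (intro image_cong) auto
    then have "e1 ` X0 = X1" using eq(2) f by simp
    then have "e1 v \<in> cl (X1 \<union> Y1)"
      using v aut_cl[OF e1, of "X0 \<union> X" v] fX X by (simp add: image_Un Y1_def)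
    then have "cj a2 f2 (e1 v) = iv e3 (p v)" using a2(2) e1 by (simp add: q_def)
    then show ?thesis using e3 by (simp add: e1_def e3_def[symmetric])
  qed
  then show ?thesis using that a1(1) a2(1) a3(1) by blast
qed

text \<open>The three conjugators are given by one function on the natural numbers, so that sequences of
  triples can be formed.\<close>

definition pr :: "('a \<Rightarrow> 'a) \<Rightarrow> (nat \<Rightarrow> 'a \<Rightarrow> 'a) \<Rightarrow> 'a \<Rightarrow> 'a" where
  "pr g K v = cj (K 2) g (cj (K 1) g (cj (K 0) g v))"

text \<open>The flexibility that keeps the back-and-forth going: the conjugators may be multiplied by
  elements that fix the sets \<open>A i\<close>, on which they are already determined.\<close>

definition good :: "('a \<Rightarrow> 'a) \<Rightarrow> (nat \<Rightarrow> 'a \<Rightarrow> 'a) \<Rightarrow> (nat \<Rightarrow> 'a set) \<Rightarrow> 'a set \<Rightarrow> bool" where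
  "good g K A X0 \<longleftrightarrow> fs X0 \<and> (\<forall>p X. aut p \<longrightarrow> (\<forall>v\<in>cl X0. p v = pr g K v) \<longrightarrow> fs X \<longrightarrow>
     (\<exists>a. (\<forall>i. a i \<in> Stab (A i)) \<and> (\<forall>v\<in>cl (X0 \<union> X). pr g (\<lambda>i. a i \<circ> K i) v = p v)))"

lemma good_mono: assumes "good g K A X0" "fs Z" shows "good g K A (X0 \<union> Z)"
  unfolding good_def
proof (intro conjI allI impI)
  show "fs (X0 \<union> Z)" using assms by (simp add: good_def)
  fix p X assume p: "aut p" "\<forall>v\<in>cl (X0 \<union> Z). p v = pr g K v" "fs X"
  have "\<forall>v\<in>cl X0. p v = pr g K v" using p(2) cl_mono[of "X0 \<union> Z" X0] assms by (auto simp: good_def)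
  moreover have "fs (Z \<union> X)" using assms p by simp
  ultimately show "\<exists>a. (\<forall>i. a i \<in> Stab (A i)) \<and> (\<forall>v\<in>cl (X0 \<union> Z \<union> X). pr g (\<lambda>i. a i \<circ> K i) v = p v)"
    using assms(1) p(1) unfolding good_def by (simp add: Un_assoc)
qed

lemma goodI:
  assumes g: "aut g" "g \<noteq> id" and K: "\<And>i. aut (K i)"
    and X1: "fs X1" and eq: "X2 = cj (K 1) g ` X1" "X0 = iv (cj (K 0) g) ` X1" "X3 = cj (K 2) g ` X2"
      "A 0 = X0 \<union> X1" "A 1 = X1 \<union> X2" "A 2 = X2 \<union> X3"
    and i1: "ind X1 X0 (A 1 \<union> A 2)" and i2: "ind X2 X3 (A 1)"
  shows "good g K A X0"
  unfolding good_def
proof (intro conjI allI impI)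
  have f: "aut (cj (K i) g)" "cj (K i) g \<noteq> id" for i using g K by (auto simp: aut_cj cj_nontrivial)
  show "fs X0" using X1 f by (simp add: eq(2) aut_fs aut_inv)
  fix p X assume p: "aut p" "\<forall>v\<in>cl X0. p v = pr g K v" "fs X"
  have pv: "p v = cj (K 2) g (cj (K 1) g (cj (K 0) g v))" if "v \<in> cl X0" for v
    using p(2) that by (simp add: pr_def)
  obtain a1 a2 a3 where a: "a1 \<in> Stab (A 0)" "a2 \<in> Stab (A 1)" "a3 \<in> Stab (A 2)"
    "\<And>v. v \<in> cl (X0 \<union> X) \<Longrightarrow> cj a3 (cj (K 2) g) (cj a2 (cj (K 1) g) (cj a1 (cj (K 0) g) v)) = p v"
    using three_conjugates[OF f(1)[of 0] f(2)[of 0] f(1)[of 1] f(2)[of 1] f(1)[of 2] f(2)[of 2]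
      X1 eq i1 i2 p(1) pv p(3)] by metis
  let ?a = "\<lambda>i::nat. if i = 0 then a1 else if i = 1 then a2 else if i = 2 then a3 else id"
  have "?a i \<in> Stab (A i)" for i using a(1-3) Stab_id by simp
  moreover have "pr g (\<lambda>i. ?a i \<circ> K i) v = p v" if "v \<in> cl (X0 \<union> X)" for v
    using a(4)[OF that] cj_cj[OF Stab_aut[OF a(1)] K] cj_cj[OF Stab_aut[OF a(2)] K] cj_cj[OF Stab_aut[OF a(3)] K]
    by (simp add: pr_def)
  ultimately show "\<exists>a. (\<forall>i. a i \<in> Stab (A i)) \<and> (\<forall>v\<in>cl (X0 \<union> X). pr g (\<lambda>i. a i \<circ> K i) v = p v)"
    by (intro exI[of _ ?a]) blast
qed

text \<open>Over the empty set all conditions of independence are void.\<close>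

lemma good_start: assumes "aut g" "g \<noteq> id" "\<And>i. aut (K i)" shows "good g K (\<lambda>i. {}) {}"
  by (rule goodI[of g K "{}" "{}" "{}" "{}" "\<lambda>i. {}", OF assms]) (auto simp: ind_def)

text \<open>The set \<open>X1\<close> is chosen so large that it contains all given sets, together with the preimages
  needed for its image \<open>X2\<close> to contain the last two. The two outer conjugates are then moved into
  independent position over \<open>X1\<close> and \<open>X2\<close>.\<close>

lemma extend_to_good:
  assumes g: "aut g" "g \<noteq> id" and K: "\<And>i. aut (K i)" and C: "\<And>i. fs (C i)"
  shows "\<exists>b A X0. (\<forall>i. b i \<in> Stab (C i)) \<and> (\<forall>i. C i \<subseteq> A i \<and> fs (A i)) \<and>
    good g (\<lambda>i. b i \<circ> K i) A X0"
proof -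
  define f where "f i = cj (K i) g" for i
  have f: "aut (f i)" for i using g K by (simp add: f_def aut_cj)
  define X1 where "X1 = C 0 \<union> C 1 \<union> C 2 \<union> iv (f 1) ` (C 1 \<union> C 2)"
  define X2 where "X2 = f 1 ` X1"
  define A1 where "A1 = X1 \<union> X2"
  have fX: "fs X1" "fs X2" "fs A1" using C f by (auto simp: X1_def X2_def A1_def aut_fs aut_inv)
  have CX2: "C 1 \<union> C 2 \<subseteq> X2"
  proof -
    have "f 1 ` iv (f 1) ` (C 1 \<union> C 2) \<subseteq> X2" unfolding X2_def X1_def by (intro image_mono) auto
    then show ?thesis using f by simp
  qed
  have f3: "fs (f 2 ` X2)" using f fX by (simp add: aut_fs)
  obtain b2 where b2: "b2 \<in> Stab X2" "ind X2 (b2 ` f 2 ` X2) A1"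
    by (rule independent_copy[OF fX(2) f3 fX(3)])
  define X3 where "X3 = b2 ` f 2 ` X2"
  define A2 where "A2 = X2 \<union> X3"
  have fX3: "fs X3" "fs A2" "fs (A1 \<union> A2)"
    using f3 Stab_aut[OF b2(1)] fX by (auto simp: X3_def A2_def aut_fs)
  have f1: "fs (iv (f 0) ` X1)" using f fX by (simp add: aut_fs aut_inv)
  obtain b0 where b0: "b0 \<in> Stab X1" "ind X1 (b0 ` iv (f 0) ` X1) (A1 \<union> A2)"
    by (rule independent_copy[OF fX(1) f1 fX3(3)])
  define X0 where "X0 = b0 ` iv (f 0) ` X1"
  have fX0: "fs X0" using f1 Stab_aut[OF b0(1)] by (simp add: X0_def aut_fs)
  define b where "b i = (if i = 0 then b0 else if i = 2 then b2 else id)" for i :: nat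
  define A where "A i = (if i = 0 then X0 \<union> X1 else if i = 1 then A1 else if i = 2 then A2 else C i)" for i :: nat
  have b: "b i \<in> Stab (C i)" for i
    using Stab_mono[OF fX(1) _ b0(1), of "C 0"] Stab_mono[OF fX(2) _ b2(1), of "C 2"] CX2 Stab_id
    by (auto simp: b_def X1_def)
  have bK: "aut (b i \<circ> K i)" for i using Stab_aut[OF b] K by (simp add: aut_comp)
  have cb: "cj (b i \<circ> K i) g = cj (b i) (f i)" for i
    using cj_cj[OF Stab_aut[OF b] K] by (simp add: f_def)
  have ivb: "iv b0 ` X1 = X1" "iv b2 ` X2 = X2"
    using Stab_image[OF Stab_inv[OF b0(1)] cl_sup[OF fX(1)]] Stab_image[OF Stab_inv[OF b2(1)] cl_sup[OF fX(2)]]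
    by auto
  have "good g (\<lambda>i. b i \<circ> K i) A X0"
  proof (rule goodI[OF g bK fX(1)])
    show "X2 = cj (b 1 \<circ> K 1) g ` X1" unfolding cb by (simp add: X2_def b_def cj_def)
    have "iv (cj b0 (f 0)) = cj b0 (iv (f 0))" using Stab_aut[OF b0(1)] f by (rule iv_cj)
    then have "iv (cj b0 (f 0)) ` X1 = b0 ` iv (f 0) ` iv b0 ` X1"
      by (simp add: cj_def image_comp)
    then show "X0 = iv (cj (b 0 \<circ> K 0) g) ` X1" unfolding cb using ivb by (simp add: X0_def b_def)
    have "cj b2 (f 2) ` X2 = b2 ` f 2 ` iv b2 ` X2" by (simp add: cj_def image_comp)
    then show "X3 = cj (b 2 \<circ> K 2) g ` X2" unfolding cb using ivb by (simp add: X3_def b_def)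
  qed (use b0 b2 in \<open>auto simp: A_def A1_def A2_def X0_def X3_def\<close>)
  moreover have "C i \<subseteq> A i" for i using CX2 by (auto simp: A_def A1_def A2_def X1_def)
  moreover have "fs (A i)" for i using fX fX0 fX3 C by (simp add: A_def)
  ultimately show ?thesis using b by blast
qed

text \<open>The second product is extended to a good one, its values on \<open>X0\<close> being kept by fixing the orbit
  \<open>X0, X1, X2, X3\<close>. The first product is good, so it can follow; then the roles are exchanged.\<close>

lemma exchange_step:
  assumes g: "aut g" "g \<noteq> id" and H: "aut H"
    and K: "\<And>i. aut (K i)" and L: "\<And>i. aut (L i)" and B: "\<And>i. fs (B i)"
    and good: "good g K A X0" and match: "\<forall>v\<in>cl X0. pr g K v = H (pr g L v)" and Z: "fs Z"
  shows "\<exists>a b B' Y0. (\<forall>i. a i \<in> Stab (A i)) \<and> (\<forall>i. b i \<in> Stab (B i)) \<and>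
    (\<forall>i. B i \<union> Z \<union> (b i \<circ> L i) ` Z \<subseteq> B' i \<and> fs (B' i)) \<and>
    good g (\<lambda>i. b i \<circ> L i) B' Y0 \<and> Z \<subseteq> Y0 \<and>
    (\<forall>v\<in>cl Y0. pr g (\<lambda>i. b i \<circ> L i) v = iv H (pr g (\<lambda>i. a i \<circ> K i) v))"
proof -
  define f where "f i = cj (L i) g" for i
  have f: "aut (f i)" for i using g L by (simp add: f_def aut_cj)
  have X0: "fs X0" using good by (simp add: good_def)
  define X1 where "X1 = f 0 ` X0"
  define X2 where "X2 = f 1 ` X1"
  define X3 where "X3 = f 2 ` X2"
  have fX: "fs X1" "fs X2" "fs X3" using X0 f by (auto simp: X1_def X2_def X3_def aut_fs)
  \<comment> \<open>Fixing the orbit of \<open>X0\<close> keeps the product on \<open>cl X0\<close>, fixing \<open>L i ` Z\<close> determines \<open>L i\<close> on \<open>Z\<close>.\<close>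
  define C where "C i = B i \<union> Z \<union> L i ` Z \<union> X0 \<union> X1 \<union> X2 \<union> X3" for i
  have C: "fs (C i)" for i using B Z L X0 fX by (simp add: C_def aut_fs)
  obtain b B' Y where b0: "\<forall>i. b i \<in> Stab (C i)" "\<forall>i. C i \<subseteq> B' i \<and> fs (B' i)"
      "good g (\<lambda>i. b i \<circ> L i) B' Y"
    using extend_to_good[of g L C, OF g L C] by (elim exE conjE)
  have b: "b i \<in> Stab (C i)" "C i \<subseteq> B' i" "fs (B' i)" "good g (\<lambda>i. b i \<circ> L i) B' Y" for i
    using b0 by auto
  have bB: "b i \<in> Stab (B i)" for i using Stab_mono[OF C _ b(1), of "B i" i] by (auto simp: C_def)
  have bL: "aut (b i \<circ> L i)" for i using Stab_aut[OF b(1)] L by (simp add: aut_comp)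
  have same: "cj (b i \<circ> L i) g u = f i u" if "u \<in> cl (X0 \<union> X1 \<union> X2)" "f i u \<in> cl (X1 \<union> X2 \<union> X3)" for i u
  proof -
    have "u \<in> cl (C i)" "f i u \<in> cl (C i)"
      using that cl_mono[OF C[of i], of "X0 \<union> X1 \<union> X2"] cl_mono[OF C[of i], of "X1 \<union> X2 \<union> X3"]
      by (auto simp: C_def)
    then show ?thesis using cj_fixed[of "b i" "C i" u "f i", OF b(1)] cj_cj[OF Stab_aut[OF b(1)] L] by (simp add: f_def)
  qed
  have fsU: "fs (X0 \<union> X1 \<union> X2)" "fs (X1 \<union> X2 \<union> X3)" using X0 fX by auto
  have prb: "pr g (\<lambda>i. b i \<circ> L i) v = pr g L v" if v: "v \<in> cl X0" for v
  proof -
    have v1: "f 0 v \<in> cl X1" using v aut_cl[OF f X0] by (simp add: X1_def)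
    then have v2: "f 1 (f 0 v) \<in> cl X2" using aut_cl[OF f fX(1)] by (simp add: X2_def)
    then have v3: "f 2 (f 1 (f 0 v)) \<in> cl X3" using aut_cl[OF f fX(2)] by (simp add: X3_def)
    have up: "cl X0 \<subseteq> cl (X0 \<union> X1 \<union> X2)" "cl X1 \<subseteq> cl (X0 \<union> X1 \<union> X2)" "cl X2 \<subseteq> cl (X0 \<union> X1 \<union> X2)"
      "cl X1 \<subseteq> cl (X1 \<union> X2 \<union> X3)" "cl X2 \<subseteq> cl (X1 \<union> X2 \<union> X3)" "cl X3 \<subseteq> cl (X1 \<union> X2 \<union> X3)"
      using cl_mono[OF fsU(1), of X0] cl_mono[OF fsU(1), of X1] cl_mono[OF fsU(1), of X2]
        cl_mono[OF fsU(2), of X1] cl_mono[OF fsU(2), of X2] cl_mono[OF fsU(2), of X3]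
      by (simp_all add: le_supI1 le_supI2)
    have "cj (b 0 \<circ> L 0) g v = f 0 v" using v v1 up by (intro same) (blast+)
    moreover have "cj (b 1 \<circ> L 1) g (f 0 v) = f 1 (f 0 v)" using v1 v2 up by (intro same) (blast+)
    moreover have "cj (b 2 \<circ> L 2) g (f 1 (f 0 v)) = f 2 (f 1 (f 0 v))" using v2 v3 up by (intro same) (blast+)
    ultimately show ?thesis by (simp add: pr_def f_def)
  qed
  define p where "p v = H (pr g (\<lambda>i. b i \<circ> L i) v)" for v
  have "p = H \<circ> (cj (b 2 \<circ> L 2) g \<circ> (cj (b 1 \<circ> L 1) g \<circ> cj (b 0 \<circ> L 0) g))"
    by (auto simp: p_def pr_def)
  then have ap: "aut p" using H bL g by (simp add: aut_comp aut_cj)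
  have pK: "\<forall>v\<in>cl X0. p v = pr g K v" using match prb by (simp add: p_def)
  have Y: "fs Y" using b(4) by (simp add: good_def)
  then have fYZ: "fs (Y \<union> Z)" using Z by simp
  obtain a where a: "\<forall>i. a i \<in> Stab (A i)" "\<forall>v\<in>cl (X0 \<union> (Y \<union> Z)). pr g (\<lambda>i. a i \<circ> K i) v = p v"
    using good[unfolded good_def, THEN conjunct2, THEN spec, THEN spec, THEN mp, THEN mp, THEN mp, OF ap pK fYZ]
    by (elim exE conjE)
  show ?thesis
  proof (rule exI[of _ a], rule exI[of _ b], rule exI[of _ B'], rule exI[of _ "Y \<union> Z"],
      intro conjI allI ballI)
    show "a i \<in> Stab (A i)" for i using a by simp
    show "b i \<in> Stab (B i)" for i by (rule bB)
    show "fs (B' i)" for i by (rule b(3))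
    show "B i \<union> Z \<union> (b i \<circ> L i) ` Z \<subseteq> B' i" for i
    proof -
      have "L i ` Z \<subseteq> cl (C i)" using cl_sup[OF C[of i]] by (auto simp: C_def)
      then have "b i ` L i ` Z = L i ` Z" by (rule Stab_image[OF b(1)])
      then have "(b i \<circ> L i) ` Z = L i ` Z" by (simp add: image_image)
      then show ?thesis using b(2)[of i] by (auto simp: C_def)
    qed
    show "good g (\<lambda>i. b i \<circ> L i) B' (Y \<union> Z)" using good_mono[OF b(4) Z] .
    show "Z \<subseteq> Y \<union> Z" by simp
    show "pr g (\<lambda>i. b i \<circ> L i) v = iv H (pr g (\<lambda>i. a i \<circ> K i) v)" if v: "v \<in> cl (Y \<union> Z)" for v
    proof -
      have "v \<in> cl (X0 \<union> (Y \<union> Z))" using v cl_mono[of "X0 \<union> (Y \<union> Z)" "Y \<union> Z"] X0 fYZ by auto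
      then show ?thesis using a(2) H by (simp add: p_def)
    qed
  qed
qed

text \<open>Two products that agree up to \<open>h\<close> on \<open>X0\<close>, the first one being good; the sets \<open>A i\<close> and \<open>B i\<close> are
  those on which the conjugators are already determined.\<close>

definition matched :: "('a \<Rightarrow> 'a) \<Rightarrow> ('a \<Rightarrow> 'a) \<Rightarrow> (nat \<Rightarrow> 'a \<Rightarrow> 'a) \<Rightarrow> (nat \<Rightarrow> 'a set) \<Rightarrow>
    (nat \<Rightarrow> 'a \<Rightarrow> 'a) \<Rightarrow> (nat \<Rightarrow> 'a set) \<Rightarrow> 'a set \<Rightarrow> bool" where
  "matched g h K A L B X0 \<longleftrightarrow> (\<forall>i. aut (K i) \<and> aut (L i) \<and> fs (A i) \<and> fs (B i)) \<and>
     good g K A X0 \<and> (\<forall>v\<in>cl X0. pr g K v = h (pr g L v))"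

definition extends :: "(nat \<Rightarrow> 'a \<Rightarrow> 'a) \<Rightarrow> (nat \<Rightarrow> 'a set) \<Rightarrow> (nat \<Rightarrow> 'a \<Rightarrow> 'a) \<Rightarrow> (nat \<Rightarrow> 'a set) \<Rightarrow>
    'a set \<Rightarrow> bool" where
  "extends K A K' A' Z \<longleftrightarrow> (\<forall>i. (\<exists>c\<in>Stab (A i). K' i = c \<circ> K i) \<and> A i \<union> Z \<union> K' i ` Z \<subseteq> A' i)"

text \<open>Two steps, one in each direction.\<close>

lemma matched_round:
  assumes g: "aut g" "g \<noteq> id" and h: "aut h" and st: "matched g h K A L B X0" and Z: "fs Z"
  shows "\<exists>K' A' L' B' Y. matched g h K' A' L' B' Y \<and> extends K A K' A' Z \<and> extends L B L' B' Z \<and> Z \<subseteq> Y"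
proof -
  have K: "aut (K i)" and L: "aut (L i)" and A: "fs (A i)" and B: "fs (B i)" for i
    using st by (auto simp: matched_def)
  have gd: "good g K A X0" and mt: "\<forall>v\<in>cl X0. pr g K v = h (pr g L v)"
    using st by (auto simp: matched_def)
  obtain a b B' Y0 where 1: "\<forall>i. a i \<in> Stab (A i)" "\<forall>i. b i \<in> Stab (B i)"
    "\<forall>i. B i \<union> Z \<union> (b i \<circ> L i) ` Z \<subseteq> B' i \<and> fs (B' i)"
    "good g (\<lambda>i. b i \<circ> L i) B' Y0" "Z \<subseteq> Y0"
    "\<forall>v\<in>cl Y0. pr g (\<lambda>i. b i \<circ> L i) v = iv h (pr g (\<lambda>i. a i \<circ> K i) v)"
    using exchange_step[of g h K L B A X0 Z, OF g h K L B gd mt Z] by (elim exE conjE)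
  define K1 where "K1 i = a i \<circ> K i" for i
  define L1 where "L1 i = b i \<circ> L i" for i
  have KL1: "aut (K1 i)" "aut (L1 i)" for i
    using Stab_aut[of "a i" "A i"] Stab_aut[of "b i" "B i"] 1(1,2) K L
    by (simp_all add: K1_def L1_def aut_comp)
  have B': "fs (B' i)" for i using 1(3) by simp
  have gd1: "good g L1 B' Y0" using 1(4) by (simp add: L1_def[abs_def])
  have mt1: "\<forall>v\<in>cl Y0. pr g L1 v = iv h (pr g K1 v)"
    using 1(6) by (simp add: L1_def[abs_def] K1_def[abs_def])
  obtain c e A' Y1 where 2: "\<forall>i. c i \<in> Stab (B' i)" "\<forall>i. e i \<in> Stab (A i)"
    "\<forall>i. A i \<union> Z \<union> (e i \<circ> K1 i) ` Z \<subseteq> A' i \<and> fs (A' i)"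
    "good g (\<lambda>i. e i \<circ> K1 i) A' Y1" "Z \<subseteq> Y1"
    "\<forall>v\<in>cl Y1. pr g (\<lambda>i. e i \<circ> K1 i) v = iv (iv h) (pr g (\<lambda>i. c i \<circ> L1 i) v)"
    using exchange_step[of g "iv h" L1 K1 A B' Y0 Z, OF g aut_inv[OF h] KL1(2,1) A gd1 mt1 Z]
    by (elim exE conjE)
  define K2 where "K2 i = e i \<circ> K1 i" for i
  define L2 where "L2 i = c i \<circ> L1 i" for i
  have "matched g h K2 A' L2 B' Y1"
    unfolding matched_def
  proof (intro conjI allI ballI)
    show "aut (K2 i)" "aut (L2 i)" for i
      using Stab_aut[of "e i" "A i"] Stab_aut[of "c i" "B' i"] 2(1,2) KL1
      by (simp_all add: K2_def L2_def aut_comp)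
    show "fs (A' i)" "fs (B' i)" for i using 2(3) B' by auto
    show "good g K2 A' Y1" using 2(4) by (simp add: K2_def[abs_def])
    show "pr g K2 v = h (pr g L2 v)" if "v \<in> cl Y1" for v
      using 2(6) that h by (simp add: K2_def[abs_def] L2_def[abs_def] aut_inv_inv)
  qed
  moreover have "extends K A K2 A' Z"
    unfolding extends_def
  proof (intro allI conjI)
    fix i
    have "e i \<circ> a i \<in> Stab (A i)" using 1(1) 2(2) Stab_comp by blast
    then show "\<exists>c\<in>Stab (A i). K2 i = c \<circ> K i"
      by (rule bexI[rotated]) (simp add: K2_def K1_def comp_assoc)
    show "A i \<union> Z \<union> K2 i ` Z \<subseteq> A' i" using 2(3) by (simp add: K2_def)
  qed
  moreover have "extends L B L2 B' Z"
    unfolding extends_def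
  proof (intro allI conjI)
    fix i
    have BB: "B i \<union> Z \<union> L1 i ` Z \<subseteq> B' i" using 1(3) by (simp add: L1_def)
    then have "c i \<in> Stab (B i)" using Stab_mono[OF B'[of i], of "B i" "c i"] 2(1) by auto
    then have "c i \<circ> b i \<in> Stab (B i)" using 1(2) Stab_comp by blast
    then show "\<exists>c\<in>Stab (B i). L2 i = c \<circ> L i"
      by (rule bexI[rotated]) (simp add: L2_def L1_def comp_assoc)
    have "L1 i ` Z \<subseteq> cl (B' i)" using BB cl_sup[OF B'[of i]] by auto
    then have "c i ` L1 i ` Z = L1 i ` Z" using Stab_image[of "c i" "B' i"] 2(1) by simp
    then have "L2 i ` Z = L1 i ` Z" by (simp add: L2_def image_comp)
    then show "B i \<union> Z \<union> L2 i ` Z \<subseteq> B' i" using BB by simp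
  qed
  ultimately show ?thesis using 2(5) by blast
qed

definition pointwise_limit :: "(nat \<Rightarrow> 'a \<Rightarrow> 'a) \<Rightarrow> ('a \<Rightarrow> 'a) \<Rightarrow> bool" where
  "pointwise_limit f p \<longleftrightarrow> (\<forall>v\<in>V. \<forall>\<^sub>F t in sequentially. f t v = p v)"

lemma pointwise_limit_comp:
  assumes "pointwise_limit f p" "pointwise_limit f' p'" "aut p'" shows "pointwise_limit (\<lambda>t v. f t (f' t v)) (\<lambda>v. p (p' v))"
  unfolding pointwise_limit_def
proof
  fix v assume v: "v \<in> V"
  then have "p' v \<in> V" using aut_V[OF assms(3)] by simp
  then have "\<forall>\<^sub>F t in sequentially. f t (p' v) = p (p' v)" "\<forall>\<^sub>F t in sequentially. f' t v = p' v"
    using assms(1,2) v by (auto simp: pointwise_limit_def)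
  then show "\<forall>\<^sub>F t in sequentially. f t (f' t v) = p (p' v)" by eventually_elim simp
qed

text \<open>Conjugators and their inverses are eventually constant at each point, since every \<open>z j\<close> and its
  image are eventually fixed by the multipliers.\<close>

lemma extends_limit:
  assumes K: "\<And>t i. aut (K t i)" and A: "\<And>t i. fs (A t i)"
    and ext: "\<And>t. extends (K t) (A t) (K (Suc t)) (A (Suc t)) (z ` {..t})" and z: "range z = V"
    and K0: "K 0 i = id"
  obtains k where "k \<in> Stab {}" "pointwise_limit (\<lambda>t. K t i) k" "pointwise_limit (\<lambda>t. iv (K t i)) (iv k)"
proof -
  \<comment> \<open>The points at which the limit is determined at stage \<open>t\<close>.\<close>
  define F where "F t = {u. K t i u \<in> A t i}" for t
  have AV: "A t i \<subseteq> V" for t using A[of t i] by (simp add: fs_def)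
  have st: "\<exists>c\<in>Stab (A t i). K (Suc t) i = c \<circ> K t i" "A t i \<subseteq> A (Suc t) i"
    "z ` {..t} \<subseteq> A (Suc t) i" "K (Suc t) i ` z ` {..t} \<subseteq> A (Suc t) i" for t
    using ext[of t] unfolding extends_def by auto
  have step: "K (Suc t) i u = K t i u" if u: "u \<in> F t" for t u
  proof -
    obtain c where c: "c \<in> Stab (A t i)" "K (Suc t) i = c \<circ> K t i" using st(1) by blast
    have "K t i u \<in> cl (A t i)" using u cl_sup[OF A[of t i]] by (auto simp: F_def)
    then show ?thesis using Stab_fixes[OF c(1)] c(2) by simp
  qed
  have inc: "F t \<subseteq> F (Suc t)" for t using step[of _ t] st(2)[of t] by (auto simp: F_def)
  have FV: "F t \<subseteq> V" "K t i ` F t \<subseteq> V" for t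
    using aut_V[OF K[of t i]] AV[of t] by (auto simp: F_def)
  have Az: "z j \<in> A (Suc j) i" for j using st(3)[of j] by auto
  have Fz: "z j \<in> F (Suc j)" for j using st(4)[of j] by (auto simp: F_def)
  have dom: "V \<subseteq> (\<Union>t. F t)"
  proof
    fix v assume "v \<in> V"
    then have "v \<in> range z" using z by simp
    then obtain j where "v = z j" by (rule rangeE)
    then show "v \<in> (\<Union>t. F t)" using Fz[of j] by blast
  qed
  have Fim: "K t i ` F t = A t i" for t
  proof (intro equalityI subsetI)
    fix v assume v: "v \<in> A t i"
    then have "iv (K t i) v \<in> F t" using K by (simp add: F_def)
    moreover have "v = K t i (iv (K t i) v)" using K by simp
    ultimately show "v \<in> K t i ` F t" by (rule rev_image_eqI)
  qed (auto simp: F_def)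
  have ran: "V \<subseteq> (\<Union>t. K t i ` F t)"
  proof
    fix v assume "v \<in> V"
    then have "v \<in> range z" using z by simp
    then obtain j where "v = z j" by (rule rangeE)
    then show "v \<in> (\<Union>t. K t i ` F t)" unfolding Fim using Az[of j] by blast
  qed
  have iso: "iso (K t i) (F t)" for t using K by (rule aut_iso)
  obtain k where k: "aut k" "\<And>t u. u \<in> F t \<Longrightarrow> k u = K t i u"
    using aut_limit[of "\<lambda>t. K t i" F, OF iso inc step FV dom ran] by metis
  have mono: "F s \<subseteq> F t" if "s \<le> t" for s t using lift_Suc_mono_le[of F, OF inc that] .
  have cv: "pointwise_limit (\<lambda>t. K t i) k"
    unfolding pointwise_limit_def
  proof
    fix v assume "v \<in> V"
    then obtain s where s: "v \<in> F s" using dom by blast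
    have "K t i v = k v" if "s \<le> t" for t using k(2)[of v t] s mono[OF that] by auto
    then show "\<forall>\<^sub>F t in sequentially. K t i v = k v" unfolding eventually_sequentially by blast
  qed
  have Amono: "A s i \<subseteq> A t i" if "s \<le> t" for s t
    using lift_Suc_mono_le[of "\<lambda>t. A t i", OF st(2) that] .
  have cvi: "pointwise_limit (\<lambda>t. iv (K t i)) (iv k)"
    unfolding pointwise_limit_def
  proof
    fix v assume "v \<in> V"
    then obtain s where s: "v \<in> A s i" using ran unfolding Fim by blast
    have "iv (K t i) v = iv k v" if "s \<le> t" for t
    proof -
      have "v \<in> A t i" using s Amono[OF that] by auto
      then have "iv (K t i) v \<in> F t" using K by (simp add: F_def)
      then have "k (iv (K t i) v) = v" using k(2) K by simp
      then show ?thesis using iv_eqI[OF k(1), of "iv (K t i) v" v] by simp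
    qed
    then show "\<forall>\<^sub>F t in sequentially. iv (K t i) v = iv k v" unfolding eventually_sequentially by blast
  qed
  have K1: "K t i v = v" if v: "v \<in> cl {}" for t v
  proof (induction t)
    case (Suc t)
    obtain c where c: "c \<in> Stab (A t i)" "K (Suc t) i = c \<circ> K t i" using st(1) by blast
    have "v \<in> cl (A t i)" using v cl_mono[OF A[of t i], of "{}"] by auto
    then show ?case using Stab_fixes[OF c(1)] c(2) Suc by simp
  qed (simp add: K0)
  have "k v = v" if v: "v \<in> cl {}" for v
  proof -
    obtain s where "v \<in> F s" using dom v cl_V by blast
    then show ?thesis using k(2) K1[OF v] by simp
  qed
  then have "k \<in> Stab {}" using k(1) by (simp add: Stab_def)
  then show ?thesis using that cv cvi by blast
qed

lemma pointwise_limit_cj: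
  assumes "pointwise_limit (\<lambda>t. K t) k" "pointwise_limit (\<lambda>t. iv (K t)) (iv k)" "aut k" "aut g"
  shows "pointwise_limit (\<lambda>t. cj (K t) g) (cj k g)"
proof -
  have "pointwise_limit (\<lambda>t. g) g" by (simp add: pointwise_limit_def)
  from pointwise_limit_comp[OF this assms(2) aut_inv[OF assms(3)]]
  have "pointwise_limit (\<lambda>t v. g (iv (K t) v)) (\<lambda>v. g (iv k v))" .
  moreover have "aut (g \<circ> iv k)" using assms by (intro aut_comp aut_inv)
  then have "aut (\<lambda>v. g (iv k v))" by (simp add: o_def)
  ultimately have "pointwise_limit (\<lambda>t v. K t (g (iv (K t) v))) (\<lambda>v. k (g (iv k v)))"
    by (rule pointwise_limit_comp[OF assms(1)])
  then show ?thesis by (simp add: cj_def o_def)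
qed

lemma pointwise_limit_pr:
  assumes "\<And>i. pointwise_limit (\<lambda>t. K t i) (k i)" "\<And>i. pointwise_limit (\<lambda>t. iv (K t i)) (iv (k i))" "\<And>i. aut (k i)" "aut g"
  shows "pointwise_limit (\<lambda>t. pr g (K t)) (pr g k)"
proof -
  have c: "pointwise_limit (\<lambda>t. cj (K t i) g) (cj (k i) g)" "aut (cj (k i) g)" for i
    using assms by (auto intro!: pointwise_limit_cj aut_cj)
  have "pointwise_limit (\<lambda>t v. cj (K t 1) g (cj (K t 0) g v)) (\<lambda>v. cj (k 1) g (cj (k 0) g v))"
    by (rule pointwise_limit_comp[OF c(1) c(1) c(2)])
  moreover have "aut (cj (k 1) g \<circ> cj (k 0) g)" using c(2) by (intro aut_comp)
  then have "aut (\<lambda>v. cj (k 1) g (cj (k 0) g v))" by (simp add: o_def)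
  ultimately have "pointwise_limit (\<lambda>t v. cj (K t 2) g (cj (K t 1) g (cj (K t 0) g v)))
      (\<lambda>v. cj (k 2) g (cj (k 1) g (cj (k 0) g v)))"
    by (rule pointwise_limit_comp[OF c(1)])
  then show ?thesis by (simp add: pr_def[abs_def])
qed

text \<open>The limit of the back-and-forth. It starts with trivial conjugators: over the empty set both
  products agree, as \<open>g\<close> and \<open>h\<close> fix its closure.\<close>

lemma product_of_six:
  assumes g: "aut g" "g \<noteq> id" and h: "h \<in> Stab {}" and gF: "g \<in> Stab {}"
  obtains k l where "\<And>i. k i \<in> Stab {}" "\<And>i. l i \<in> Stab {}" "\<And>v. pr g k v = h (pr g l v)"
proof -
  have ah: "aut h" using Stab_aut h .
  define z where "z = from_nat_into V"
  have z: "range z = V" unfolding z_def using V_nonempty V_countable by (rule range_from_nat_into)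
  let ?P = "\<lambda>(t::nat) (K, A, L, B, X). matched g h K A L B X \<and> (t = 0 \<longrightarrow> K = (\<lambda>i. id) \<and> L = (\<lambda>i. id))"
  let ?Q = "\<lambda>t (K, A, L, B, X) (K', A', L', B', X').
    extends K A K' A' (z ` {..t}) \<and> extends L B L' B' (z ` {..t}) \<and> z ` {..t} \<subseteq> X'"
  have "\<exists>G. \<forall>t. ?P t (G t) \<and> ?Q t (G t) (G (Suc t))"
  proof (rule dependent_nat_choice)
    have gd: "good g (\<lambda>i. id) (\<lambda>i. {}) {}" using good_start[of g "\<lambda>i. id"] g aut_id by blast
    have "pr g (\<lambda>i. id) v = v" if "v \<in> cl {}" for v
      using Stab_fixes[OF gF that] by (simp add: pr_def cj_def)
    then have "matched g h (\<lambda>i. id) (\<lambda>i. {}) (\<lambda>i. id) (\<lambda>i. {}) {}"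
      using gd aut_id Stab_fixes[OF h] by (simp add: matched_def)
    then show "\<exists>x. ?P 0 x" by (intro exI[of _ "(\<lambda>i. id, \<lambda>i. {}, \<lambda>i. id, \<lambda>i. {}, {})"]) simp
    fix x t assume P: "?P t x"
    obtain K A L B X where x: "x = (K, A, L, B, X)" by (cases x)
    have m: "matched g h K A L B X" using P x by simp
    have fz: "fs (z ` {..t})" using z by (auto simp: fs_def)
    obtain K' A' L' B' Y where "matched g h K' A' L' B' Y" "extends K A K' A' (z ` {..t})"
        "extends L B L' B' (z ` {..t})" "z ` {..t} \<subseteq> Y"
      using matched_round[OF g ah m fz] by (elim exE conjE)
    then show "\<exists>y. ?P (Suc t) y \<and> ?Q t x y"
      unfolding x by (intro exI[of _ "(K', A', L', B', Y)"]) simp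
  qed
  then obtain G where G: "\<forall>t. ?P t (G t) \<and> ?Q t (G t) (G (Suc t))" ..
  define K where "K t = fst (G t)" for t
  define A where "A t = fst (snd (G t))" for t
  define L where "L t = fst (snd (snd (G t)))" for t
  define B where "B t = fst (snd (snd (snd (G t))))" for t
  define X where "X t = snd (snd (snd (snd (G t))))" for t
  have m: "matched g h (K t) (A t) (L t) (B t) (X t)" and
    e: "extends (K t) (A t) (K (Suc t)) (A (Suc t)) (z ` {..t})"
      "extends (L t) (B t) (L (Suc t)) (B (Suc t)) (z ` {..t})" and
    X: "z ` {..t} \<subseteq> X (Suc t)" for t
    using spec[OF G, of t] unfolding K_def A_def L_def B_def X_def by (simp_all add: case_prod_unfold)
  have zero: "K 0 i = id" "L 0 i = id" for i
    using spec[OF G, of 0] unfolding K_def L_def by (simp_all add: case_prod_unfold)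
  have auts: "aut (K t i)" "aut (L t i)" "fs (A t i)" "fs (B t i)" for t i
    using m[of t] by (simp_all add: matched_def)
  have "\<exists>k. k \<in> Stab {} \<and> pointwise_limit (\<lambda>t. K t i) k \<and> pointwise_limit (\<lambda>t. iv (K t i)) (iv k)" for i
    using extends_limit[of K A z i, OF auts(1,3) e(1) z zero(1)] by metis
  then obtain k where k: "\<And>i. k i \<in> Stab {} \<and> pointwise_limit (\<lambda>t. K t i) (k i) \<and> pointwise_limit (\<lambda>t. iv (K t i)) (iv (k i))"
    by metis
  have "\<exists>l. l \<in> Stab {} \<and> pointwise_limit (\<lambda>t. L t i) l \<and> pointwise_limit (\<lambda>t. iv (L t i)) (iv l)" for i
    using extends_limit[of L B z i, OF auts(2,4) e(2) z zero(2)] by metis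
  then obtain l where l: "\<And>i. l i \<in> Stab {} \<and> pointwise_limit (\<lambda>t. L t i) (l i) \<and> pointwise_limit (\<lambda>t. iv (L t i)) (iv (l i))"
    by metis
  have ck: "pointwise_limit (\<lambda>t. pr g (K t)) (pr g k)" using k g Stab_aut by (intro pointwise_limit_pr) blast+
  have cl': "pointwise_limit (\<lambda>t. pr g (L t)) (pr g l)" using l g Stab_aut by (intro pointwise_limit_pr) blast+
  have autpr: "aut (pr g k)" if "\<And>i. k i \<in> Stab {}" for k
  proof -
    have "pr g k = cj (k 2) g \<circ> (cj (k 1) g \<circ> cj (k 0) g)" by (auto simp: pr_def)
    then show ?thesis using that Stab_aut g by (metis aut_comp aut_cj)
  qed
  have eqV: "pr g k v = h (pr g l v)" if v: "v \<in> V" for v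
  proof -
    have "v \<in> range z" using v z by simp
    then obtain j where j: "v = z j" by (rule rangeE)
    have "pr g (K t) v = h (pr g (L t) v)" if t: "Suc j \<le> t" for t
    proof -
      obtain t' where t': "t = Suc t'" using t by (cases t) auto
      have "v \<in> X t" using X[of t'] j t unfolding t' by auto
      moreover have "fs (X t)" using m[of t] by (simp add: matched_def good_def)
      ultimately have "v \<in> cl (X t)" using cl_sup by auto
      then show ?thesis using m[of t] by (simp add: matched_def)
    qed
    then have "\<forall>\<^sub>F t in sequentially. pr g (K t) v = h (pr g (L t) v)"
      unfolding eventually_sequentially by blast
    moreover have "\<forall>\<^sub>F t in sequentially. pr g (K t) v = pr g k v"
      "\<forall>\<^sub>F t in sequentially. pr g (L t) v = pr g l v" using ck cl' v by (auto simp: pointwise_limit_def)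
    ultimately have "\<forall>\<^sub>F t in sequentially. pr g k v = h (pr g l v)" by eventually_elim simp
    then show ?thesis by simp
  qed
  have "pr g k v = h (pr g l v)" for v
  proof (cases "v \<in> V")
    case False
    have "aut (pr g k)" "aut (pr g l)" using autpr k l by blast+
    then show ?thesis using False ah by (simp add: aut_def)
  qed (rule eqV)
  then show ?thesis using that[of k l] k l by blast
qed

end

section \<open>The automorphism group\<close>

context hrushovski_generic
begin

abbreviation G :: "('a \<Rightarrow> 'a) monoid" where "G \<equiv> Aut_over M (cl {})"

text \<open>Elements of the group are undefined outside the vertex set.\<close>

definition rs :: "('a \<Rightarrow> 'a) \<Rightarrow> 'a \<Rightarrow> 'a" where
  "rs p = restrict p V"

lemma carrier_G: "carrier G = {f \<in> Bij V. embedding f M M \<and> (\<forall>x\<in>cl {}. f x = x)}"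
  by (simp add: Aut_over_def)

lemma rs_carrier: assumes "p \<in> Stab {}" shows "rs p \<in> carrier G"
proof -
  have p: "aut p" using Stab_aut assms .
  have rs: "rs p x = p x" if "x \<in> V" for x using that by (simp add: rs_def)
  have rsi: "rs p ` e = p ` e" if "e \<subseteq> V" for e using that rs by (intro image_cong) auto
  have pV: "p ` V = V"
  proof (intro equalityI subsetI)
    fix y assume "y \<in> V"
    then have "iv p y \<in> V" using aut_V[OF aut_inv[OF p]] by simp
    moreover have "y = p (iv p y)" using p by simp
    ultimately show "y \<in> p ` V" by (rule rev_image_eqI)
  qed (use aut_V[OF p] in auto)
  have inj: "inj_on (rs p) V" using aut_inj[OF p, of V] rs by (simp add: inj_on_def)
  then have "bij_betw (rs p) V V" using rsi[of V] pV by (simp add: bij_betw_def)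
  then have "rs p \<in> Bij V" by (simp add: Bij_def rs_def)
  moreover have "embedding (rs p) M M"
    unfolding embedding_def using inj rsi pV p by (auto simp: aut_def)
  moreover have "\<forall>x\<in>cl {}. rs p x = x" using rs cl_V[of "{}"] Stab_fixes[OF assms] by (simp add: subset_iff)
  ultimately show ?thesis by (simp add: carrier_G)
qed

lemma carrier_rs: assumes "f \<in> carrier G" obtains p where "p \<in> Stab {}" "f = rs p"
proof -
  have f: "f \<in> extensional V" "inj_on f V" "f ` V = V" "embedding f M M" "\<forall>x\<in>cl {}. f x = x"
    using assms by (auto simp: carrier_G Bij_def bij_betw_def)
  define p where "p x = (if x \<in> V then f x else x)" for x
  have pV: "p x \<in> V \<longleftrightarrow> x \<in> V" for x using f(3) by (auto simp: p_def)
  have "inj p"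
  proof (rule injI)
    fix x y assume xy: "p x = p y"
    then have "x \<in> V \<longleftrightarrow> y \<in> V" using pV by metis
    then show "x = y" using xy f(2) by (auto simp: p_def dest: inj_onD split: if_splits)
  qed
  moreover have "\<exists>x. y = p x" for y
  proof (cases "y \<in> V")
    case True
    then obtain x where "x \<in> V" "y = f x" using f(3) by (metis imageE)
    then show ?thesis by (intro exI[of _ x]) (simp add: p_def)
  next
    case False
    then show ?thesis by (intro exI[of _ y]) (simp add: p_def)
  qed
  then have "surj p" unfolding surj_def by blast
  moreover have "p ` e \<in> E \<longleftrightarrow> e \<in> E" for e
  proof (cases "e \<subseteq> V")
    case True
    then have "p ` e = f ` e" by (intro image_cong) (auto simp: p_def)
    then show ?thesis using f(4) True by (simp add: embedding_def)
  next
    case False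
    then have "\<not> p ` e \<subseteq> V" using pV by auto
    then show ?thesis using False edge_props(1) by blast
  qed
  ultimately have "aut p" by (simp add: aut_def bij_def p_def)
  then have "p \<in> Stab {}" using f(5) cl_V by (auto simp: Stab_def p_def)
  moreover have "f = rs p"
  proof
    fix x show "f x = rs p x" using f(1) by (auto simp: rs_def p_def extensional_def)
  qed
  ultimately show ?thesis using that by blast
qed

lemma rs_mult: assumes "p \<in> Stab {}" "q \<in> Stab {}" shows "rs p \<otimes>\<^bsub>G\<^esub> rs q = rs (p \<circ> q)"
proof -
  have "rs p \<in> Bij V" "rs q \<in> Bij V" using rs_carrier assms by (auto simp: carrier_G)
  then have "rs p \<otimes>\<^bsub>G\<^esub> rs q = compose V (rs p) (rs q)" by (simp add: Aut_over_def BijGroup_def)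
  also have "\<dots> = rs (p \<circ> q)"
    using aut_V[OF Stab_aut[OF assms(2)]] by (auto simp: compose_def rs_def fun_eq_iff)
  finally show ?thesis .
qed

lemma rs_one: "\<one>\<^bsub>G\<^esub> = rs id"
  by (auto simp: Aut_over_def BijGroup_def rs_def)

lemma rs_inj: assumes "aut p" "aut q" "rs p = rs q" shows "p = q"
proof
  fix x show "p x = q x"
  proof (cases "x \<in> V")
    case True
    then show ?thesis using fun_cong[OF assms(3), of x] by (simp add: rs_def)
  qed (use assms in \<open>simp add: aut_def\<close>)
qed

lemma group_G: "group G"
proof (rule groupI)
  fix x y assume "x \<in> carrier G" "y \<in> carrier G"
  then obtain p q where "p \<in> Stab {}" "x = rs p" "q \<in> Stab {}" "y = rs q" by (metis carrier_rs)
  then show "x \<otimes>\<^bsub>G\<^esub> y \<in> carrier G" using rs_carrier[OF Stab_comp] by (simp add: rs_mult)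
next
  show "\<one>\<^bsub>G\<^esub> \<in> carrier G" unfolding rs_one by (rule rs_carrier[OF Stab_id(1)])
next
  fix x y z assume "x \<in> carrier G" "y \<in> carrier G" "z \<in> carrier G"
  then obtain p q s where "p \<in> Stab {}" "x = rs p" "q \<in> Stab {}" "y = rs q" "s \<in> Stab {}" "z = rs s"
    by (metis carrier_rs)
  then show "x \<otimes>\<^bsub>G\<^esub> y \<otimes>\<^bsub>G\<^esub> z = x \<otimes>\<^bsub>G\<^esub> (y \<otimes>\<^bsub>G\<^esub> z)" by (simp add: rs_mult Stab_comp comp_assoc)
next
  fix x assume "x \<in> carrier G"
  then obtain p where p: "p \<in> Stab {}" "x = rs p" by (rule carrier_rs)
  then show "\<one>\<^bsub>G\<^esub> \<otimes>\<^bsub>G\<^esub> x = x" unfolding rs_one by (simp add: rs_mult Stab_id)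
  have "iv p \<circ> p = id" using Stab_aut[OF p(1)] by auto
  then have "rs (iv p) \<otimes>\<^bsub>G\<^esub> x = \<one>\<^bsub>G\<^esub>"
    using p rs_mult[OF Stab_inv[OF p(1)] p(1)] by (simp only: rs_one)
  then show "\<exists>y\<in>carrier G. y \<otimes>\<^bsub>G\<^esub> x = \<one>\<^bsub>G\<^esub>" using rs_carrier[OF Stab_inv[OF p(1)]] by blast
qed

lemma rs_inv: assumes "p \<in> Stab {}" shows "inv\<^bsub>G\<^esub> (rs p) = rs (iv p)"
proof (rule group.inv_equality[OF group_G])
  have "iv p \<circ> p = id" using Stab_aut[OF assms] by auto
  then show "rs (iv p) \<otimes>\<^bsub>G\<^esub> rs p = \<one>\<^bsub>G\<^esub>"
    using rs_mult[OF Stab_inv[OF assms] assms] by (simp only: rs_one)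
qed (use assms rs_carrier Stab_inv in auto)

lemma rs_conjugate:
  assumes "k \<in> Stab {}" "g \<in> Stab {}" shows "rs (cj k g) \<in> conjugates G (rs g)"
proof -
  have "rs (cj k g) = rs k \<otimes>\<^bsub>G\<^esub> rs g \<otimes>\<^bsub>G\<^esub> inv\<^bsub>G\<^esub> (rs k)"
    using assms by (simp add: rs_inv rs_mult Stab_comp Stab_inv cj_def)
  then show ?thesis unfolding conjugates_def using rs_carrier[OF assms(1)] by blast
qed

primrec comps :: "('a \<Rightarrow> 'a) list \<Rightarrow> 'a \<Rightarrow> 'a" where
  "comps [] = (\<lambda>v. v)"
| "comps (p # ps) = p \<circ> comps ps"

lemma comps_append: "comps (ps @ qs) v = comps ps (comps qs v)"
  by (induction ps) auto

lemma rs_list_product: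
  "set ps \<subseteq> Stab {} \<Longrightarrow> list_product G (map rs ps) = rs (comps ps) \<and> comps ps \<in> Stab {}"
proof (induction ps)
  case Nil
  then show ?case by (simp add: list_product_def rs_one Stab_id id_def)
next
  case (Cons p ps)
  then have ps: "list_product G (map rs ps) = rs (comps ps)" "comps ps \<in> Stab {}" "p \<in> Stab {}"
    by auto
  have "list_product G (map rs (p # ps)) = rs p \<otimes>\<^bsub>G\<^esub> list_product G (map rs ps)"
    by (simp add: list_product_def)
  then show ?case unfolding ps(1) rs_mult[OF ps(3,2)] using Stab_comp[OF ps(3,2)] by (simp add: o_def)
qed

text \<open>The six factors are followed by 45 pairs of \<open>g\<close> and its inverse.\<close>

lemma product_of_96:
  assumes g: "g \<in> Stab {}" "g \<noteq> id" and h: "h \<in> Stab {}"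
  shows "\<exists>xs. length xs = 96 \<and>
    set xs \<subseteq> conjugates G (rs g) \<union> conjugates G (inv\<^bsub>G\<^esub> (rs g)) \<and> rs h = list_product G xs"
proof -
  have ag: "aut g" using Stab_aut g(1) .
  obtain k l where k: "\<And>i. k i \<in> Stab {}" and l: "\<And>i. l i \<in> Stab {}"
      and eq: "\<And>v. pr g k v = h (pr g l v)"
    using product_of_six[OF ag g(2) h g(1)] by metis
  have al: "aut (l i)" for i using Stab_aut l .
  define six where "six = [cj (k 2) g, cj (k 1) g, cj (k 0) g,
    cj (l 0) (iv g), cj (l 1) (iv g), cj (l 2) (iv g)]"
  define pad where "pad = concat (replicate 45 [cj id g, cj id (iv g)])"
  have cancel: "cj k g (cj k (iv g) u) = u" if "aut k" for k u
    using that ag by (simp add: cj_apply)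
  have "comps (concat (replicate j [cj id g, cj id (iv g)])) v = v" for j v
    by (induction j) (simp_all add: cancel aut_id)
  then have pad: "comps pad v = v" for v by (simp add: pad_def)
  have six: "comps six v = h v" for v
  proof -
    define w where "w = cj (l 0) (iv g) (cj (l 1) (iv g) (cj (l 2) (iv g) v))"
    have "pr g l w = v" by (simp add: pr_def w_def cancel al)
    then have "h v = pr g k w" using eq by simp
    then show ?thesis by (simp add: six_def w_def pr_def)
  qed
  have all: "comps (six @ pad) = h" using six pad by (simp add: fun_eq_iff comps_append)
  have mem: "p \<in> Stab {} \<and> rs p \<in> conjugates G (rs g) \<union> conjugates G (inv\<^bsub>G\<^esub> (rs g))"
    if p: "p \<in> set (six @ pad)" for p
  proof -
    have "(\<exists>k\<in>Stab {}. p = cj k g) \<or> (\<exists>k\<in>Stab {}. p = cj k (iv g))"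
      using p k l Stab_id by (auto simp: six_def pad_def)
    then obtain k' where k': "k' \<in> Stab {}" "p = cj k' g \<or> p = cj k' (iv g)" by blast
    have "cj k' f \<in> Stab {}" if "f \<in> Stab {}" for f
      using k' that by (simp add: cj_def Stab_comp Stab_inv)
    then show ?thesis
      using k' rs_conjugate[OF k'(1) g(1)] rs_conjugate[OF k'(1) Stab_inv[OF g(1)]] g(1)
      by (auto simp: rs_inv Stab_inv)
  qed
  have "list_product G (map rs (six @ pad)) = rs h"
    using rs_list_product[of "six @ pad"] mem all by auto
  moreover have "length (map rs (six @ pad)) = 96"
    by (simp add: six_def pad_def length_concat sum_list_replicate)
  moreover have "set (map rs (six @ pad)) \<subseteq> conjugates G (rs g) \<union> conjugates G (inv\<^bsub>G\<^esub> (rs g))"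
    using mem by auto
  ultimately show ?thesis by (intro exI[of _ "map rs (six @ pad)"]) simp
qed

lemma product_of_96_carrier:
  assumes "g \<in> carrier G" "g \<noteq> \<one>\<^bsub>G\<^esub>" "h \<in> carrier G"
  shows "\<exists>xs. length xs = 96 \<and>
    set xs \<subseteq> conjugates G g \<union> conjugates G (inv\<^bsub>G\<^esub> g) \<and> h = list_product G xs"
proof -
  obtain p where p: "p \<in> Stab {}" "g = rs p" by (rule carrier_rs[OF assms(1)])
  obtain q where q: "q \<in> Stab {}" "h = rs q" by (rule carrier_rs[OF assms(3)])
  have "p \<noteq> id" using assms(2) p(2) rs_one by auto
  then show ?thesis using product_of_96[OF p(1) _ q(1)] p q by simp
qed

lemma nontrivial: "carrier G \<noteq> {\<one>\<^bsub>G\<^esub>}"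
proof -
  have f0: "fs {}" by simp
  obtain A where A: "fs A" "r + n + m \<le> card A" using enlarge[OF f0] by metis
  obtain y where y: "y \<in> V" "dm (insert y A) = dm A + 1" by (rule exists_dim_one[OF A])
  have y1: "dm {} < dm {y}" using dm_relative_mono[OF A(1) _ y(1), of "{}"] y(2) by simp
  have fy: "fs {y}" using y by simp
  obtain p where p: "p \<in> Stab {}" "ind {} (p ` {y}) {y}" by (rule independent_copy[OF f0 fy fy])
  have "p y \<noteq> y" using p(2) y1 by (auto simp: ind_def)
  then have "p \<noteq> id" by auto
  then have "rs p \<noteq> \<one>\<^bsub>G\<^esub>" unfolding rs_one using rs_inj[OF Stab_aut[OF p(1)] aut_id(1)] by auto
  then show ?thesis using rs_carrier[OF p(1)] by auto
qed

lemma simple_G: "is_simple_group G"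
  unfolding is_simple_group_def
proof (intro conjI allI impI)
  show "group G" by (rule group_G)
  show "carrier G \<noteq> {\<one>\<^bsub>G\<^esub>}" by (rule nontrivial)
  fix N assume N: "N \<lhd> G"
  have sub: "subgroup N G" using N by (rule normal_imp_subgroup)
  show "N = {\<one>\<^bsub>G\<^esub>} \<or> N = carrier G"
  proof (cases "N = {\<one>\<^bsub>G\<^esub>}")
    case False
    then obtain g where g: "g \<in> N" "g \<noteq> \<one>\<^bsub>G\<^esub>" using subgroup.one_closed[OF sub] by auto
    have gi: "g \<in> carrier G" "inv\<^bsub>G\<^esub> g \<in> N"
      using g subgroup.mem_carrier[OF sub] subgroup.m_inv_closed[OF sub] by auto
    have conj: "conjugates G u \<subseteq> N" if "u \<in> N" for u
      using that normal.inv_op_closed2[OF N] by (auto simp: conjugates_def)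
    have prod: "list_product G xs \<in> N" if "set xs \<subseteq> N" for xs
      using that
      by (induction xs) (auto simp: list_product_def subgroup.one_closed[OF sub] subgroup.m_closed[OF sub])
    have "h \<in> N" if h: "h \<in> carrier G" for h
    proof -
      obtain xs where "set xs \<subseteq> conjugates G g \<union> conjugates G (inv\<^bsub>G\<^esub> g)" "h = list_product G xs"
        using product_of_96_carrier[OF gi(1) g(2) h] by blast
      then show ?thesis using prod[of xs] conj[OF g(1)] conj[OF gi(2)] by blast
    qed
    then show ?thesis using subgroup.subset[OF sub] by auto
  qed simp
qed

end

theorem theorem4p15:
  fixes r m n :: nat and M\<^sub>0 :: "'a hypergraph"
  assumes "r \<ge> 2" and "m \<ge> 1" and "n \<ge> 1" and "coprime m n"
    and "is_generic r m n M\<^sub>0"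
    and "(r = 2 \<and> n > m) \<or> (r \<ge> 3 \<and> n \<ge> m)"
  defines "G \<equiv> Aut_over M\<^sub>0 (cld m n M\<^sub>0 {})"
  shows "is_simple_group G \<and>
    (\<forall>g\<in>carrier G. g \<noteq> \<one>\<^bsub>G\<^esub> \<longrightarrow>
      (\<forall>h\<in>carrier G. \<exists>xs. length xs = 96 \<and>
         set xs \<subseteq> conjugates G g \<union> conjugates G (inv\<^bsub>G\<^esub> g) \<and>
         h = list_product G xs))"
proof -
  have pos: "m < (r - 1) * n"
    using assms(6)
  proof
    assume a: "r \<ge> 3 \<and> n \<ge> m"
    then have "2 * n \<le> (r - 1) * n" by (intro mult_right_mono) auto
    then show ?thesis using a assms(3) by linarith
  qed simp
  interpret hrushovski_generic r m n M\<^sub>0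
    by unfold_locales (use assms(1-6) pos in auto)
  have "G = Aut_over M\<^sub>0 (cl {})" unfolding G_def by (simp add: cld_eq_cl)
  then show ?thesis using simple_G product_of_96_carrier by simp
qed

end
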